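(* Let $R$ be a skew-invertible Hecke symmetry, let $(\mathcal{D}(R^{-1}),\mathcal{M}(R))$ be the associated quantum double, $\hat L=MD$, and let $\hat{\mathcal{L}}(R)$ be the subalgebra of the double generated by the entries of $\hat L$. For every integer $k\ge1$ and every (noncommutative) polynomial $Q(R_1,\dots,R_{k-1})$ in $R_1,\dots,R_{k-1}$, the normally ordered form of the generalized Casimir operator $C_Q^{(k)}(\hat L)=\mathrm{Tr}_{R(1\dots k)}\bigl(Q(R_1,\dots,R_{k-1})\hat L_{\overline{1\to k}}\bigr)$, that is, the element $$:\!C_Q^{(k)}(\hat L)\!:\;=\mathrm{Tr}_{R(1\dots k)}\bigl(Q(R_1,\dots,R_{k-1}):\!\hat L_{\overline{1\to k}}\!:\bigr),$$ belongs to the characteristic subalgebra of $\hat{\mathcal{L}}(R)$ and, therefore, is a central quantum differential operator (i.e. a central element of $\hat{\mathcal{L}}(R)$).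
   Context: **Hecke symmetry.** $V$ is a complex vector space of dimension $N$. $I$ is the identity operator on $V$ or the $N\times N$ unit matrix, and $P$ is the flip on $V^{\otimes 2}$. A Hecke symmetry is $R\in\mathrm{End}(V^{\otimes 2})$ satisfying $(R\otimes I)(I\otimes R)(R\otimes I)=(I\otimes R)(R\otimes I)(I\otimes R)$ and $(qI\otimes I-R)(q^{-1}I\otimes I+R)=0$. Here $q\in\mathbb{C}\setminus\{0,\pm1\}$ is generic: $q^n\neq1$ for all positive integers $n$. Standing assumptions: $R$ is skew-invertible, i.e. there is $\Psi\in\mathrm{End}(V^{\otimes2})$ with $\mathrm{Tr}_2R_{12}\Psi_{23}=\mathrm{Tr}_2\Psi_{12}R_{23}=P_{13}$; $R^{-1}$ is also skew-invertible; and $R$ is taken from a family having a limit as $q\to1$ which is an involutive symmetry ($R^2=I\otimes I$ in the limit). **Matrix notation.** $R_i=I^{\otimes(i-1)}\otimes R\otimes I^{\otimes(k-i-1)}$ acts on $V^{\otimes k}$, with $k$ sufficiently large. For an $N\times N$ matrix $X$ (possibly with noncommuting entries, row index lower and column index upper) put $X_{\overline1}=X_1=X\otimes I^{\otimes(k-1)}$, $X_{\overline{r+1}}=R_rX_{\overline r}R_r^{-1}$, and $X_{\overline{1\to n}}=X_{\overline1}X_{\overline2}\cdots X_{\overline n}$. **R-trace.** $C$ is the $N\times N$ matrix with entries $C_i^j=\sum_k\Psi_{ik}^{jk}$, and $\mathrm{Tr}_{R(1\dots n)}(X)=\mathrm{Tr}_1(\cdots\mathrm{Tr}_n(C_1C_2\cdots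 C_nX)\cdots)$ for $X\in(\mathrm{Mat}_N)^{\otimes n}$, where $C_i$ is $C$ placed in the $i$-th tensor factor. **Algebras.** $\mathcal{M}(R)$ is the unital associative algebra generated by the entries of $M=\|m_i^j\|$ with relations $R_1M_1R_1M_1=M_1R_1M_1R_1$. $\mathcal{D}(R^{-1})$ is the unital associative algebra generated by the entries of $D=\|\partial_i^j\|$ with relations $R_1^{-1}D_1R_1^{-1}D_1=D_1R_1^{-1}D_1R_1^{-1}$. The quantum double $(\mathcal{D}(R^{-1}),\mathcal{M}(R))$ is the algebra formed by these two algebras together with the permutation relations $D_1R_1M_1R_1=R_1M_1R_1^{-1}D_1+R_1$. The entries of $\hat L=MD$ are $\hat l_i^j=\sum_km_i^k\partial_k^j$. **Characteristic subalgebra of $\hat{\mathcal{L}}(R)$.** It is the central subalgebra formed by (finite linear combinations of) all generalized Casimir operators $C_Q^{(k)}(\hat L)$, for all $k\ge1$ and all polynomials $Q$ in $R_1,\dots,R_{k-1}$ (together with the unit). **Normal ordering.** It is defined by the rule $:\!D_1M_{\overline2}\!:\,=M_{\overline2}D_1R_1^{-2}$. More generally, the normal ordered form $:w:$ of an expression $w$ in $M$ and $D$ (with $\hat L$ written as $MD$) is obtained by applying inside the colons the homogeneous permutation relations $D_1R_1M_1=R_1M_1R_1^{-1}D_1R_1^{-1}$ (the permutation relations of the double with the constant term dropped), together with the defining relations of $\mathcal{M}(R)$ and $\mathcal{D}(R^{-1})$, until all entries of $D$ are to the right of all entries of $M$; the resulting ordered expression is then regarded as an element of the quantum double. *)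

theory Defs
  imports
    "HOL-Analysis.Analysis"
    "HOL-Library.Poly_Mapping"
    "HOL-Algebra.QuotRing"
    "HOL-Algebra.Generated_Rings"
begin

section \<open>Matrices on tensor powers\<close>

text \<open>
  A basis of \<open>V\<close> is indexed by the finite type \<open>'n\<close>, so \<open>N = CARD('n)\<close>.  An element of
  \<open>End (V\<^sup>\<otimes>\<^sup>k)\<close>, possibly with entries in a noncommutative ring, is a function of a row and a column
  multi-index, both lists of length \<open>k\<close>; its values on other lists are irrelevant.  For a matrix
  \<open>A\<close> on \<open>V \<otimes> V\<close>, the entry \<open>A $ (i, j) $ (k, l)\<close> is \<open>A\<^sub>i\<^sub>j\<^sup>k\<^sup>l\<close> (lower indices: row, upper indices:
  column).
\<close>

type_synonym ('n, 'a) tmat = "'n list \<Rightarrow> 'n list \<Rightarrow> 'a"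
type_synonym 'n rmat = "complex ^ ('n \<times> 'n) ^ ('n \<times> 'n)"

definition idx :: "nat \<Rightarrow> 'n list set" where
  "idx k = {a. length a = k}"

definition tmult :: "nat \<Rightarrow> ('n, 'a::semiring_0) tmat \<Rightarrow> ('n, 'a) tmat \<Rightarrow> ('n, 'a) tmat" where
  "tmult k A B = (\<lambda>a b. \<Sum>c\<in>idx k. A a c * B c b)"

definition tid :: "('n, 'a::zero_neq_one) tmat" where
  "tid = (\<lambda>a b. if a = b then 1 else 0)"

definition tprod :: "nat \<Rightarrow> ('n, 'a::semiring_1) tmat list \<Rightarrow> ('n, 'a) tmat" where
  "tprod k As = foldr (tmult k) As tid"

definition teq :: "nat \<Rightarrow> ('n, 'a) tmat \<Rightarrow> ('n, 'a) tmat \<Rightarrow> bool" where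
  "teq k A B \<longleftrightarrow> (\<forall>a\<in>idx k. \<forall>b\<in>idx k. A a b = B a b)"

definition flip :: "('n, 'a::zero_neq_one) tmat" where
  "flip = (\<lambda>a b. if a = rev b then 1 else 0)"

text \<open>Tensor factors are numbered from 1, list positions from 0.\<close>

definition at_site :: "nat \<Rightarrow> ('n \<Rightarrow> 'n \<Rightarrow> 'a::zero) \<Rightarrow> ('n, 'a) tmat" where
  "at_site i X = (\<lambda>a b. if take (i - 1) a = take (i - 1) b \<and> drop i a = drop i b
     then X (a ! (i - 1)) (b ! (i - 1)) else 0)"

text \<open>\<open>at_pair i A\<close> is \<open>A\<close> acting on the factors \<open>i\<close> and \<open>i + 1\<close>, e.g. \<open>R\<^sub>i\<close> for \<open>A = R\<close>.\<close>

definition at_pair :: "nat \<Rightarrow> 'n::finite rmat \<Rightarrow> ('n, complex) tmat" where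
  "at_pair i A = (\<lambda>a b. if take (i - 1) a = take (i - 1) b \<and> drop (i + 1) a = drop (i + 1) b
     then A $ (a ! (i - 1), a ! i) $ (b ! (i - 1), b ! i) else 0)"

text \<open>Partial trace over the \<open>i\<close>-th factor; the remaining factors keep their order.\<close>

definition ptrace :: "nat \<Rightarrow> ('n::finite, 'a::comm_monoid_add) tmat \<Rightarrow> ('n, 'a) tmat" where
  "ptrace i A = (\<lambda>a b. \<Sum>x\<in>UNIV.
     A (take (i - 1) a @ x # drop (i - 1) a) (take (i - 1) b @ x # drop (i - 1) b))"


section \<open>Hecke symmetries\<close>

definition braid_relation :: "'n::finite rmat \<Rightarrow> bool" where
  "braid_relation R \<longleftrightarrow>
     teq 3 (tprod 3 [at_pair 1 R, at_pair 2 R, at_pair 1 R])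
           (tprod 3 [at_pair 2 R, at_pair 1 R, at_pair 2 R])"

definition generic :: "complex \<Rightarrow> bool" where
  "generic q \<longleftrightarrow> q \<notin> {0, 1, -1} \<and> (\<forall>n>0. q ^ n \<noteq> 1)"

definition hecke_symmetry :: "complex \<Rightarrow> 'n::finite rmat \<Rightarrow> bool" where
  "hecke_symmetry q R \<longleftrightarrow> generic q \<and> braid_relation R \<and>
     (mat q - R) ** (mat (inverse q) + R) = 0"

definition involutive_symmetry :: "'n::finite rmat \<Rightarrow> bool" where
  "involutive_symmetry R \<longleftrightarrow> braid_relation R \<and> R ** R = mat 1"

text \<open>\<open>Tr\<^sub>2 R\<^sub>1\<^sub>2 \<Psi>\<^sub>2\<^sub>3 = Tr\<^sub>2 \<Psi>\<^sub>1\<^sub>2 R\<^sub>2\<^sub>3 = P\<^sub>1\<^sub>3\<close>\<close>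

definition skew_inverse :: "'n::finite rmat \<Rightarrow> 'n rmat \<Rightarrow> bool" where
  "skew_inverse R \<Psi> \<longleftrightarrow>
     teq 2 (ptrace 2 (tmult 3 (at_pair 1 R) (at_pair 2 \<Psi>))) flip \<and>
     teq 2 (ptrace 2 (tmult 3 (at_pair 1 \<Psi>) (at_pair 2 R))) flip"

definition skew_invertible :: "'n::finite rmat \<Rightarrow> bool" where
  "skew_invertible R \<longleftrightarrow> (\<exists>\<Psi>. skew_inverse R \<Psi>)"

text \<open>
  \<open>R\<close> is the member at \<open>q\<close> of a continuous family of Hecke symmetries, over a connected set of
  generic parameters accumulating at 1, that tends to an involutive symmetry.  Without connectedness
  and continuity the value at \<open>q\<close> would be unrelated to the limit.
\<close>

definition has_involutive_limit :: "complex \<Rightarrow> 'n::finite rmat \<Rightarrow> bool" where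
  "has_involutive_limit q R \<longleftrightarrow>
     (\<exists>U F R0. q \<in> U \<and> connected U \<and> 1 islimpt U \<and> F q = R \<and> continuous_on U F \<and>
        (\<forall>p\<in>U. hecke_symmetry p (F p)) \<and>
        (F \<longlongrightarrow> R0) (at 1 within U) \<and> involutive_symmetry R0)"


section \<open>Free algebras\<close>

datatype 'g word = Word (letters: "'g list")

instantiation word :: (type) monoid_add
begin

definition zero_word :: "'a word" where "zero_word = Word []"

definition plus_word :: "'a word \<Rightarrow> 'a word \<Rightarrow> 'a word" where
  "plus_word u v = Word (letters u @ letters v)"

instance
  by standard (auto simp: zero_word_def plus_word_def)

end

text \<open>
  Words form the free monoid (written additively), so \<open>'g word \<Rightarrow>\<^sub>0 complex\<close> with its convolution
  product is the free unital associative algebra on the letters \<open>'g\<close>.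
\<close>

type_synonym 'g falg = "'g word \<Rightarrow>\<^sub>0 complex"

definition fconst :: "complex \<Rightarrow> 'g falg" where
  "fconst c = Poly_Mapping.single 0 c"

definition fvar :: "'g \<Rightarrow> 'g falg" where
  "fvar g = Poly_Mapping.single (Word [g]) 1"

definition fscale :: "complex \<Rightarrow> 'g falg \<Rightarrow> 'g falg" where
  "fscale c x = fconst c * x"

interpretation falg: Vector_Spaces.vector_space "fscale :: complex \<Rightarrow> 'g falg \<Rightarrow> 'g falg"
  by standard
    (auto simp: fscale_def fconst_def algebra_simps mult_single single_add single_one
       simp flip: mult.assoc)

text \<open>\<open>nat falg\<close> also serves as the algebra of noncommutative polynomials \<open>Q\<close>; the letter \<open>i\<close>
  stands for \<open>R\<^sub>i\<close>.\<close>

definition fvars :: "'g falg \<Rightarrow> 'g set" where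
  "fvars Q = (\<Union>w\<in>Poly_Mapping.keys Q. set (letters w))"

definition eval_poly :: "'n::finite rmat \<Rightarrow> nat \<Rightarrow> nat falg \<Rightarrow> ('n, complex) tmat" where
  "eval_poly R k Q = (\<lambda>a b. \<Sum>w\<in>Poly_Mapping.keys Q.
     Poly_Mapping.lookup Q w * tprod k (map (\<lambda>i. at_pair i R) (letters w)) a b)"


section \<open>The quantum double\<close>

text \<open>\<open>Mgen i j\<close> stands for \<open>m\<^sub>i\<^sup>j\<close> and \<open>Dgen i j\<close> for \<open>\<partial>\<^sub>i\<^sup>j\<close>.\<close>

datatype 'n gen = Mgen 'n 'n | Dgen 'n 'n

definition Mmat :: "'n \<Rightarrow> 'n \<Rightarrow> 'n gen falg" where
  "Mmat i j = fvar (Mgen i j)"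

definition Dmat :: "'n \<Rightarrow> 'n \<Rightarrow> 'n gen falg" where
  "Dmat i j = fvar (Dgen i j)"

definition Lmat :: "'n::finite \<Rightarrow> 'n \<Rightarrow> 'n gen falg" where
  "Lmat i j = (\<Sum>k\<in>UNIV. Mmat i k * Dmat k j)"

definition scal :: "('n, complex) tmat \<Rightarrow> ('n, 'g falg) tmat" where
  "scal A = (\<lambda>a b. fconst (A a b))"

text \<open>All relations live on \<open>V \<otimes> V\<close>; a matrix relation \<open>A = B\<close> contributes the entries of \<open>A - B\<close>.\<close>

definition relators :: "('n, 'g falg) tmat list \<Rightarrow> ('n, 'g falg) tmat list \<Rightarrow> 'g falg set" where
  "relators As Bs = {tprod 2 As a b - tprod 2 Bs a b | a b. a \<in> idx 2 \<and> b \<in> idx 2}"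

definition M_relators :: "'n::finite rmat \<Rightarrow> 'n gen falg set" where
  "M_relators R = (let R1 = scal (at_pair 1 R); M1 = at_site 1 Mmat in
     relators [R1, M1, R1, M1] [M1, R1, M1, R1])"

definition D_relators :: "'n::finite rmat \<Rightarrow> 'n gen falg set" where
  "D_relators R = (let S1 = scal (at_pair 1 (matrix_inv R)); D1 = at_site 1 Dmat in
     relators [S1, D1, S1, D1] [D1, S1, D1, S1])"

text \<open>\<open>D\<^sub>1 R\<^sub>1 M\<^sub>1 R\<^sub>1 = R\<^sub>1 M\<^sub>1 R\<^sub>1\<^sup>-\<^sup>1 D\<^sub>1 + R\<^sub>1\<close>\<close>

definition permutation_relators :: "'n::finite rmat \<Rightarrow> 'n gen falg set" where
  "permutation_relators R =
     (let R1 = scal (at_pair 1 R); S1 = scal (at_pair 1 (matrix_inv R));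
          M1 = at_site 1 Mmat; D1 = at_site 1 Dmat in
      {tprod 2 [D1, R1, M1, R1] a b - (tprod 2 [R1, M1, S1, D1] a b + R1 a b) | a b.
         a \<in> idx 2 \<and> b \<in> idx 2})"

text \<open>\<open>D\<^sub>1 R\<^sub>1 M\<^sub>1 = R\<^sub>1 M\<^sub>1 R\<^sub>1\<^sup>-\<^sup>1 D\<^sub>1 R\<^sub>1\<^sup>-\<^sup>1\<close>\<close>

definition hom_permutation_relators :: "'n::finite rmat \<Rightarrow> 'n gen falg set" where
  "hom_permutation_relators R =
     (let R1 = scal (at_pair 1 R); S1 = scal (at_pair 1 (matrix_inv R));
          M1 = at_site 1 Mmat; D1 = at_site 1 Dmat in
      relators [D1, R1, M1] [R1, M1, S1, D1, S1])"

definition free_ring :: "'n gen falg ring" where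
  "free_ring = \<lparr>carrier = UNIV, monoid.mult = (*), one = 1, ring.zero = 0, add = (+)\<rparr>"

text \<open>Ideals of HOL-Algebra are two-sided.  Those below are also complex subspaces, because the free
  algebra contains the scalars.\<close>

definition double_ideal :: "'n::finite rmat \<Rightarrow> 'n gen falg set" where
  "double_ideal R = Idl\<^bsub>free_ring\<^esub> (M_relators R \<union> D_relators R \<union> permutation_relators R)"

definition quantum_double :: "'n::finite rmat \<Rightarrow> 'n gen falg set ring" where
  "quantum_double R = free_ring Quot (double_ideal R)"

definition cls :: "'n::finite rmat \<Rightarrow> 'n gen falg \<Rightarrow> 'n gen falg set" where
  "cls R x = double_ideal R +>\<^bsub>free_ring\<^esub> x"


section \<open>Casimir operators and the characteristic subalgebra\<close>

text \<open>\<open>bar R k X r\<close> is the matrix copy with overlined index \<open>r + 1\<close>, on \<open>V\<^sup>\<otimes>\<^sup>k\<close>.\<close>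

primrec bar :: "'n::finite rmat \<Rightarrow> nat \<Rightarrow> ('n \<Rightarrow> 'n \<Rightarrow> 'g falg) \<Rightarrow> nat \<Rightarrow> ('n, 'g falg) tmat" where
  "bar R k X 0 = at_site 1 X"
| "bar R k X (Suc r) =
     tprod k [scal (at_pair (Suc r) R), bar R k X r, scal (at_pair (Suc r) (matrix_inv R))]"

definition bar_prod :: "'n::finite rmat \<Rightarrow> nat \<Rightarrow> ('n \<Rightarrow> 'n \<Rightarrow> 'g falg) \<Rightarrow> ('n, 'g falg) tmat" where
  "bar_prod R k X = tprod k (map (bar R k X) [0..<k])"

definition Cmat :: "'n::finite rmat \<Rightarrow> 'n \<Rightarrow> 'n \<Rightarrow> complex" where
  "Cmat \<Psi> i j = (\<Sum>k\<in>UNIV. \<Psi> $ (i, k) $ (j, k))"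

definition Cprod :: "'n::finite rmat \<Rightarrow> nat \<Rightarrow> ('n, complex) tmat" where
  "Cprod \<Psi> k = tprod k (map (\<lambda>i. at_site i (Cmat \<Psi>)) [1..<Suc k])"

definition rtrace :: "'n::finite rmat \<Rightarrow> nat \<Rightarrow> ('n, 'g falg) tmat \<Rightarrow> 'g falg" where
  "rtrace \<Psi> k X = (\<Sum>a\<in>idx k. tmult k (scal (Cprod \<Psi> k)) X a a)"

definition casimir :: "'n::finite rmat \<Rightarrow> 'n rmat \<Rightarrow> nat \<Rightarrow> nat falg \<Rightarrow> 'n gen falg" where
  "casimir R \<Psi> k Q = rtrace \<Psi> k (tmult k (scal (eval_poly R k Q)) (bar_prod R k Lmat))"

text \<open>The spans of classes are computed upstairs, as images under the quotient map \<open>cls R\<close>.\<close>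

definition characteristic_subalgebra :: "'n::finite rmat \<Rightarrow> 'n rmat \<Rightarrow> 'n gen falg set set" where
  "characteristic_subalgebra R \<Psi> =
     cls R ` falg.span (insert 1 {casimir R \<Psi> k Q | k Q. 1 \<le> k \<and> fvars Q \<subseteq> {1..<k}})"

definition L_algebra :: "'n::finite rmat \<Rightarrow> 'n gen falg set set" where
  "L_algebra R = generate_ring (quantum_double R)
     (range (\<lambda>c. cls R (fconst c)) \<union> {cls R (Lmat i j) | i j. True})"

definition central_elements :: "('a, 'b) ring_scheme \<Rightarrow> 'a set \<Rightarrow> 'a set" where
  "central_elements A B = {x \<in> B. \<forall>y\<in>B. x \<otimes>\<^bsub>A\<^esub> y = y \<otimes>\<^bsub>A\<^esub> x}"


section \<open>Normal ordering\<close>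

definition hom_ideal :: "'n::finite rmat \<Rightarrow> 'n gen falg set" where
  "hom_ideal R = Idl\<^bsub>free_ring\<^esub> (M_relators R \<union> D_relators R \<union> hom_permutation_relators R)"

definition ordered :: "'n gen falg \<Rightarrow> bool" where
  "ordered x \<longleftrightarrow> (\<forall>w\<in>Poly_Mapping.keys x. \<exists>us vs.
     letters w = map (\<lambda>(i, j). Mgen i j) us @ map (\<lambda>(i, j). Dgen i j) vs)"

text \<open>
  \<open>:w:\<close> for an expression \<open>w\<close>, i.e. an element of the free algebra: rewrite \<open>w\<close> by the homogeneous
  relations into an ordered expression and take the class of the latter in the quantum double.
\<close>

definition normal_order :: "'n::finite rmat \<Rightarrow> 'n gen falg \<Rightarrow> 'n gen falg set" where
  "normal_order R w = (THE c. \<exists>x. ordered x \<and> w - x \<in> hom_ideal R \<and> c = cls R x)"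

text \<open>
  \<open>Tr (C\<^sub>1 \<dots> C\<^sub>k Q Y)\<close>, where \<open>Y\<close> is the entrywise normal ordering of the product of the overlined
  copies of \<open>L\<close>.  The entries of \<open>Y\<close> lie in the quantum double, so the trace is computed there.
\<close>

definition normal_ordered_casimir ::
  "'n::finite rmat \<Rightarrow> 'n rmat \<Rightarrow> nat \<Rightarrow> nat falg \<Rightarrow> 'n gen falg set" where
  "normal_ordered_casimir R \<Psi> k Q =
     finsum (quantum_double R)
       (\<lambda>(a, b). cls R (fconst (tmult k (Cprod \<Psi> k) (eval_poly R k Q) a b))
          \<otimes>\<^bsub>quantum_double R\<^esub> normal_order R (bar_prod R k Lmat b a))
       (idx k \<times> idx k)"

end

theory Submission
  imports Defs
begin

text \<open>
  All computations take place in the ring of row-finite matrices on \<open>V\<^sup>\<otimes>\<^sup>\<infinity>\<close>, whose sites are counted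
  from 0, so that \<open>r i\<close> is \<open>R\<^sub>i\<^sub>+\<^sub>1\<close>.  The permutation relations give for the normal ordering \<open>N\<^sub>k\<close> of
  \<open>L\<^sub>1 \<dots> L\<^sub>k\<close> (overlined copies) the recursion
  \<open>N\<^sub>k\<^sub>+\<^sub>1 = L G\<^sub>k N\<^sub>k G\<^sub>k\<^sup>-\<^sup>1 - Y\<^sub>k N\<^sub>k G\<^sub>k\<^sup>-\<^sup>1\<close>, where \<open>G\<^sub>k = R\<^sub>1 \<dots> R\<^sub>k\<close> and \<open>Y\<^sub>k\<close> lies in the
  Hecke algebra.  Since \<open>L G\<^sub>k (L\<^sub>1 \<dots> L\<^sub>j) G\<^sub>k\<^sup>-\<^sup>1 = L\<^sub>1 \<dots> L\<^sub>j\<^sub>+\<^sub>1\<close> for \<open>j \<le> k\<close>, by induction \<open>N\<^sub>k\<close> is a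
  combination of terms \<open>A L\<^sub>1 \<dots> L\<^sub>j B\<close> with \<open>j \<le> k\<close> and \<open>A\<close>, \<open>B\<close> in the Hecke algebra.  The R-trace is
  cyclic for the Hecke algebra, and its trace over the sites beyond \<open>j\<close> maps the Hecke algebra on \<open>k\<close>
  strands to that on \<open>j\<close> strands; hence the R-trace of \<open>Q N\<^sub>k\<close> is a combination of Casimir operators.

  For centrality, \<open>Z = L - 1 / (q - q\<^sup>-\<^sup>1)\<close> satisfies the reflection equation without linear terms, by
  which \<open>Z G (Z\<^sub>1 \<dots> Z\<^sub>k) G\<^sup>-\<^sup>1 = G' (Z\<^sub>1 \<dots> Z\<^sub>k) G'\<^sup>-\<^sup>1 Z\<close> with \<open>G' = R\<^sub>1\<^sup>-\<^sup>1 \<dots> R\<^sub>k\<^sup>-\<^sup>1\<close>.  Conjugation by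
  either \<open>G\<close> or \<open>G'\<close> turns the R-trace over the first \<open>k\<close> sites into that over the next \<open>k\<close> sites, so
  both sides have the same R-trace.

  That an element has only one ordered form modulo the relations of \<open>M(R)\<close> and \<open>D(R\<^sup>-\<^sup>1)\<close> follows from
  an action of the free algebra on itself: \<open>m\<close> multiplies, \<open>\<partial>\<close> first moves to the right of the leading
  letters \<open>m\<close>.  Modulo these relations the action is one of the homogeneous double, and an ordered \<open>x\<close>
  sends 1 to \<open>x\<close>.
\<close>


section \<open>Braid words and overlined copies\<close>

text \<open>With infinitely many sites, products for different \<open>k\<close> live in one ring. A
  partial trace is a sandwich by matrix units whose value acts as the identity on the traced site,
  and a full trace is multiplication by one element of the free algebra. Row-finiteness makes
  products of infinite matrices finite sums, so congruence of entries modulo an ideal respects them.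
  The term \<open>Y_k\<close> collects the constants split off while D crosses the copies of M. The
  crossing is computed once, for a permutation relation with constant term \<open>e\<close>: the
  value 0 identifies the normal ordering, the value 1 gives the recursion in the quantum double. The
  shift of L comes from the quadratic relation: the commutator of L with \<open>R^2\<close> is
  \<open>q - 1/q\<close> times that with \<open>R\<close>, so the shift by the inverse of this
  number cancels the linear terms. The skew inverse has three tasks: its contraction C has the
  properties of a trace weight, because exchange relations pass from R to \<Psi>; it solves the
  permutation relation for a product of two generators; and it strips braid generators off matrix
  identities when the action is checked against the reflection relations.\<close>

primrec asc :: "(nat \<Rightarrow> 't::monoid_mult) \<Rightarrow> nat \<Rightarrow> 't" where
  "asc r 0 = 1"
| "asc r (Suc k) = asc r k * r k"

text \<open>The \<open>G_k\<close> of the overview is \<open>asc r k\<close>, with inverse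
  \<open>desc s k\<close>; its \<open>G'\<close> is \<open>asc s k\<close>, with inverse
  \<open>desc r k\<close>.\<close>

primrec desc :: "(nat \<Rightarrow> 't::monoid_mult) \<Rightarrow> nat \<Rightarrow> 't" where
  "desc r 0 = 1"
| "desc r (Suc k) = r k * desc r k"

primrec copy :: "(nat \<Rightarrow> 't::monoid_mult) \<Rightarrow> (nat \<Rightarrow> 't) \<Rightarrow> 't \<Rightarrow> nat \<Rightarrow> 't" where
  "copy r s X 0 = X"
| "copy r s X (Suc k) = r k * copy r s X k * s k"

primrec copy_prod :: "(nat \<Rightarrow> 't::monoid_mult) \<Rightarrow> (nat \<Rightarrow> 't) \<Rightarrow> 't \<Rightarrow> nat \<Rightarrow> 't" where
  "copy_prod r s X 0 = 1"
| "copy_prod r s X (Suc k) = copy_prod r s X k * copy r s X k"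

text \<open>Multiply the exchange rule by \<open>s'\<close> on the left and by \<open>s\<close> on
  the right. Since the two inverse pairs may differ, the rule serves single generators as well as
  whole braid words.\<close>

lemma inverse_commute:
  fixes a b r s :: "'t::monoid_mult"
  assumes "r * s = 1" "s' * r' = 1" "r' * a = b * r"
  shows "a * s = s' * b"
proof -
  have "a * s = s' * (r' * a) * s" using assms(2) by (simp flip: mult.assoc)
  also have "\<dots> = s' * b * (r * s)" by (simp add: assms(3) mult.assoc)
  finally show ?thesis using assms(1) by simp
qed

locale braids =
  fixes r s :: "nat \<Rightarrow> 't::ring_1"
  assumes r_s: "r i * s i = 1" and s_r: "s i * r i = 1"
    and braid: "r i * r (Suc i) * r i = r (Suc i) * r i * r (Suc i)"
    and far: "Suc i < j \<Longrightarrow> r i * r j = r j * r i"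
begin

lemma r_s_assoc: "r i * (s i * x) = x" and s_r_assoc: "s i * (r i * x) = x"
  by (simp_all add: r_s s_r flip: mult.assoc)

lemmas cancel = r_s s_r r_s_assoc s_r_assoc

lemma move_s: "r j * a = b * r i \<Longrightarrow> a * s i = s j * b"
  by (rule inverse_commute[OF r_s s_r])

lemma move_r: "s j * a = b * s i \<Longrightarrow> a * r i = r j * b"
  by (rule inverse_commute[OF s_r r_s])

lemma far_rs: "Suc i < j \<Longrightarrow> r i * s j = s j * r i"
  by (rule move_s) (metis far)

lemma far_sr: "Suc i < j \<Longrightarrow> s i * r j = r j * s i"
  by (rule move_s[symmetric]) (metis far)

lemma far_ss: "Suc i < j \<Longrightarrow> s i * s j = s j * s i"
  by (rule move_s) (metis far_sr)

lemma braid_rrs: "r i * r (Suc i) * s i = s (Suc i) * (r i * r (Suc i))"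
  by (rule move_s) (use braid[of i] in \<open>simp add: mult.assoc\<close>)

lemma braid_srr: "s i * (r (Suc i) * r i) = r (Suc i) * r i * s (Suc i)"
  by (rule move_s[symmetric]) (use braid[of i] in \<open>simp add: mult.assoc\<close>)

lemma braid_ssr: "s i * s (Suc i) * r i = r (Suc i) * (s i * s (Suc i))"
proof (rule move_r)
  \<comment> \<open>The two inverse words are a left and a right inverse of the same braid element,
    hence equal.\<close>
  have "s i * s (Suc i) * s i * (r i * r (Suc i) * r i) = 1"
    by (simp add: mult.assoc cancel)
  moreover have "(r i * r (Suc i) * r i) * (s (Suc i) * s i * s (Suc i)) = 1"
    unfolding braid by (simp add: mult.assoc cancel)
  ultimately show "s (Suc i) * (s i * s (Suc i)) = s i * s (Suc i) * s i"
    by (metis mult.assoc mult_1 mult_1_right)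
qed

lemma braid_sss: "s i * s (Suc i) * s i = s (Suc i) * s i * s (Suc i)"
  using move_s[of "Suc i" "s i * s (Suc i)" "s i * s (Suc i)" i] braid_ssr[of i]
  by (simp add: mult.assoc)

lemma braid_rss: "s (Suc i) * s i * r (Suc i) = r i * (s (Suc i) * s i)"
  by (rule move_r) (use braid_sss[of i] in \<open>simp add: mult.assoc\<close>)

text \<open>Inversion preserves the braid relations, so each fact about words in \<open>r\<close> is
  available for words in \<open>s\<close>.\<close>

lemma swap: "braids s r"
  by unfold_locales (use r_s s_r braid_sss far_ss in auto)

lemma asc_desc: "asc r k * desc s k = 1"
  by (induction k) (simp_all add: mult.assoc cancel)

lemma desc_asc: "desc s k * asc r k = 1"
proof (induction k)
  case (Suc k)
  have "desc s (Suc k) * asc r (Suc k) = s k * (desc s k * asc r k) * r k" by (simp add: mult.assoc)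
  then show ?case using Suc s_r by simp
qed simp

lemma asc_far: "k < j \<Longrightarrow> r j * asc r k = asc r k * r j"
proof (induction k)
  case (Suc k)
  then have "r j * asc r (Suc k) = asc r k * (r j * r k)" by (simp flip: mult.assoc)
  also have "\<dots> = asc r k * (r k * r j)" using far[of k j] Suc by simp
  finally show ?case by (simp add: mult.assoc)
qed simp

text \<open>A letter of the word that is far from \<open>r i\<close> is passed freely. The braid
  relation is needed only when \<open>r i\<close> and \<open>r (Suc i)\<close> are the last two
  letters.\<close>

lemma asc_shift: "Suc i < k \<Longrightarrow> r (Suc i) * asc r k = asc r k * r i"
proof (induction k)
  case (Suc k)
  show ?case
  proof (cases "Suc i < k")
    case True
    then have "r (Suc i) * asc r (Suc k) = asc r k * (r i * r k)"
      using Suc by (simp flip: mult.assoc)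
    also have "\<dots> = asc r (Suc k) * r i" using far[OF True] by (simp add: mult.assoc)
    finally show ?thesis .
  next
    case False
    with Suc have k: "k = Suc i" by simp
    have "r (Suc i) * asc r (Suc k) = (r (Suc i) * asc r i) * r i * r (Suc i)"
      by (simp add: k mult.assoc)
    also have "\<dots> = asc r i * (r (Suc i) * r i * r (Suc i))"
      using asc_far[of i "Suc i"] by (simp add: mult.assoc)
    also have "\<dots> = asc r i * (r i * r (Suc i) * r i)" by (simp only: braid)
    also have "\<dots> = asc r (Suc k) * r i" by (simp add: k mult.assoc)
    finally show ?thesis .
  qed
qed simp

lemma asc_s_desc_r: "asc s k * desc r k = 1" "desc r k * asc s k = 1"
  using braids.asc_desc[OF swap] braids.desc_asc[OF swap] by auto

lemma asc_s_shift_s: "Suc i < k \<Longrightarrow> s (Suc i) * asc s k = asc s k * s i"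
  using braids.asc_shift[OF swap] .

text \<open>Mixed rule: the word consists of inverses while the shifted generator does not. It makes
  conjugation by \<open>asc s k\<close> shift a Hecke element to the same element as conjugation by
  \<open>asc r k\<close>.\<close>

lemma asc_s_shift: "Suc i < k \<Longrightarrow> r (Suc i) * asc s k = asc s k * r i"
  by (rule move_r[symmetric]) (rule asc_s_shift_s)

lemma asc_shift_s: "Suc i < k \<Longrightarrow> s (Suc i) * asc r k = asc r k * s i"
  by (rule move_s[symmetric]) (rule asc_shift)

text \<open>Abstract substitute for acting on the first site only: computations with overlined
  copies use no more than this commutation.\<close>

definition at_first :: "'t \<Rightarrow> bool" where
  "at_first X \<longleftrightarrow> (\<forall>i. r (Suc i) * X = X * r (Suc i))"

lemma at_first_r: "at_first X \<Longrightarrow> 0 < i \<Longrightarrow> r i * X = X * r i"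
  by (metis at_first_def Suc_pred')

lemma at_first_s: "at_first X \<Longrightarrow> 0 < i \<Longrightarrow> s i * X = X * s i"
  by (rule move_s[symmetric]) (rule at_first_r)

lemma copy_above:
  assumes X: "at_first X" shows "j < i \<Longrightarrow> r i * copy r s X j = copy r s X j * r i"
proof (induction j)
  case 0
  then show ?case using at_first_r[OF X] by simp
next
  case (Suc j)
  have "r i * copy r s X (Suc j) = (r i * r j) * copy r s X j * s j" by (simp add: mult.assoc)
  also have "\<dots> = r j * (r i * copy r s X j) * s j"
    using far[of j i, symmetric] Suc.prems by (simp flip: mult.assoc)
  also have "\<dots> = r j * copy r s X j * (r i * s j)" using Suc by (simp add: mult.assoc)
  also have "r i * s j = s j * r i" using far_sr[of j i] Suc by simp
  finally show ?case by (simp add: mult.assoc)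
qed

text \<open>In the critical case the braid relation turns \<open>r i\<close> into
  \<open>r (Suc i)\<close>, which passes the inner copy by \<open>copy_above\<close> and is turned
  back by the mixed relation \<open>braid_ssr\<close>.\<close>

lemma copy_below:
  assumes X: "at_first X" shows "Suc i < j \<Longrightarrow> r i * copy r s X j = copy r s X j * r i"
proof (induction j)
  case (Suc j)
  show ?case
  proof (cases "Suc i < j")
    case True
    have "r i * copy r s X (Suc j) = r j * (r i * copy r s X j) * s j"
      using far[OF True] by (simp flip: mult.assoc)
    also have "\<dots> = r j * copy r s X j * (r i * s j)" using Suc True by (simp add: mult.assoc)
    also have "r i * s j = s j * r i" using far_rs[OF True] .
    finally show ?thesis by (simp add: mult.assoc)
  next
    case False
    with Suc have j: "j = Suc i" by simp
    have "r i * copy r s X (Suc j) = (r i * r (Suc i) * r i) * copy r s X i * s i * s (Suc i)"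
      by (simp add: j mult.assoc)
    also have "\<dots> = (r (Suc i) * r i * r (Suc i)) * copy r s X i * s i * s (Suc i)"
      by (simp only: braid)
    also have "\<dots> = r (Suc i) * r i * (r (Suc i) * copy r s X i) * s i * s (Suc i)"
      by (simp add: mult.assoc)
    also have "\<dots> = r (Suc i) * r i * copy r s X i * (r (Suc i) * (s i * s (Suc i)))"
      by (simp add: copy_above[OF X] mult.assoc)
    also have "\<dots> = r (Suc i) * r i * copy r s X i * (s i * s (Suc i) * r i)"
      by (simp add: braid_ssr)
    finally show ?thesis by (simp add: j mult.assoc)
  qed
qed simp

lemma copy_prod_above:
  assumes X: "at_first X" shows "k \<le> i \<Longrightarrow> r i * copy_prod r s X k = copy_prod r s X k * r i"
proof (induction k)
  case (Suc k)
  then have "r i * copy_prod r s X (Suc k) = copy_prod r s X k * (r i * copy r s X k)"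
    by (simp flip: mult.assoc)
  also have "\<dots> = copy_prod r s X k * (copy r s X k * r i)" using copy_above[OF X] Suc by simp
  finally show ?case by (simp add: mult.assoc)
qed simp

lemma asc_copy:
  assumes X: "at_first X" shows "i < k \<Longrightarrow> asc r k * copy r s X i = copy r s X (Suc i) * asc r k"
proof (induction i)
  case 0
  then show ?case
  proof (induction k)
    case (Suc k)
    show ?case
    proof (cases k)
      case 0
      then show ?thesis by (simp add: mult.assoc cancel)
    next
      case (Suc k')
      have "asc r (Suc k) * X = asc r k * X * r k"
        using at_first_r[OF X, of k] Suc by (simp add: mult.assoc)
      also have "\<dots> = copy r s X (Suc 0) * asc r k * r k" using Suc.IH Suc by simp
      finally show ?thesis by (simp add: mult.assoc)
    qed
  qed simp
next
  case (Suc i)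
  have "asc r k * copy r s X (Suc i) = (asc r k * r i) * copy r s X i * s i" by (simp add: mult.assoc)
  also have "\<dots> = r (Suc i) * (asc r k * copy r s X i) * s i"
    using Suc by (simp add: mult.assoc flip: asc_shift)
  also have "\<dots> = r (Suc i) * copy r s X (Suc i) * (asc r k * s i)"
    using Suc by (simp add: mult.assoc)
  also have "asc r k * s i = s (Suc i) * asc r k" using asc_shift_s Suc by simp
  finally show ?case by (simp add: mult.assoc)
qed

lemma copy_prod_asc:
  assumes X: "at_first X"
  shows "m \<le> k \<Longrightarrow> X * asc r k * copy_prod r s X m = copy_prod r s X (Suc m) * asc r k"
proof (induction m)
  case (Suc m)
  have "X * asc r k * copy_prod r s X (Suc m) = copy_prod r s X (Suc m) * (asc r k * copy r s X m)"
    using Suc by (simp flip: mult.assoc)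
  also have "\<dots> = copy_prod r s X (Suc (Suc m)) * asc r k"
    using asc_copy[OF X] Suc by (simp add: mult.assoc)
  finally show ?case .
qed simp

lemma copy_prod_Suc:
  assumes X: "at_first X"
  shows "m \<le> k \<Longrightarrow> X * asc r k * copy_prod r s X m * desc s k = copy_prod r s X (Suc m)"
  using copy_prod_asc[OF X, of m k] by (simp add: mult.assoc asc_desc)

lemma copy_desc_asc: "copy r s X k = desc r k * X * asc s k"
  by (induction k) (simp_all add: mult.assoc)

end


section \<open>Congruence modulo an ideal\<close>

text \<open>Two-sided ideals of a type-class ring, used both for the free algebra and for the ring
  of operators over it.\<close>

locale ring_ideal =
  fixes J :: "'t::ring_1 set"
  assumes zero_mem: "0 \<in> J" and diff_mem: "a \<in> J \<Longrightarrow> b \<in> J \<Longrightarrow> a - b \<in> J"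
    and mult_left_mem: "a \<in> J \<Longrightarrow> x * a \<in> J" and mult_right_mem: "a \<in> J \<Longrightarrow> a * x \<in> J"
begin

definition ceq :: "'t \<Rightarrow> 't \<Rightarrow> bool" (infix "\<doteq>" 50) where
  "a \<doteq> b \<longleftrightarrow> a - b \<in> J"

lemma ceq_refl [simp, intro]: "a \<doteq> a"
  by (simp add: ceq_def zero_mem)

lemma minus_mem: "a \<in> J \<Longrightarrow> - a \<in> J"
  using diff_mem[OF zero_mem] by simp

lemma plus_mem: "a \<in> J \<Longrightarrow> b \<in> J \<Longrightarrow> a + b \<in> J"
  using diff_mem[OF _ minus_mem] by fastforce

lemma ceq_sym: "a \<doteq> b \<Longrightarrow> b \<doteq> a"
  unfolding ceq_def using minus_mem by fastforce

lemma ceq_trans [trans]: "a \<doteq> b \<Longrightarrow> b \<doteq> c \<Longrightarrow> a \<doteq> c"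
  unfolding ceq_def using plus_mem by fastforce

lemma ceq_add: "a \<doteq> b \<Longrightarrow> c \<doteq> d \<Longrightarrow> a + c \<doteq> b + d"
  unfolding ceq_def by (metis plus_mem add_diff_add)

lemma ceq_minus: "a \<doteq> b \<Longrightarrow> - a \<doteq> - b"
  unfolding ceq_def using minus_mem by fastforce

lemma ceq_diff: "a \<doteq> b \<Longrightarrow> c \<doteq> d \<Longrightarrow> a - c \<doteq> b - d"
  using ceq_add[OF _ ceq_minus, of a b c d] by simp

lemma ceq_ctx: "a \<doteq> b \<Longrightarrow> x * a * y \<doteq> x * b * y"
  unfolding ceq_def using mult_right_mem[OF mult_left_mem, of "a - b" x y] by (simp add: algebra_simps)

lemma ceq_left: "a \<doteq> b \<Longrightarrow> x * a \<doteq> x * b"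
  using ceq_ctx[of a b x 1] by simp

lemma ceq_right: "a \<doteq> b \<Longrightarrow> a * y \<doteq> b * y"
  using ceq_ctx[of a b 1 y] by simp

lemma ceq_sum: "(\<And>i. i \<in> A \<Longrightarrow> f i \<doteq> g i) \<Longrightarrow> sum f A \<doteq> sum g A"
  by (induction A rule: infinite_finite_induct) (auto intro: ceq_add)

lemma ceq_commute_inverse:
  assumes "r * s = 1" "s * r = 1" "r * a \<doteq> a * r" shows "s * a \<doteq> a * s"
  using ceq_sym[OF ceq_ctx[OF assms(3), of s s]] assms(1,2)
  by (simp add: mult.assoc) (simp flip: mult.assoc)

end

locale braids_ideal = braids r s + ring_ideal J
  for r s :: "nat \<Rightarrow> 't::ring_1" and J :: "'t set"
begin

text \<open>For \<open>i = 0\<close> and two factors this is the reflection equation, and later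
  copies commute with \<open>r 0\<close>. For other \<open>i\<close>, splitting off the first factor
  by \<open>copy_prod_Suc\<close> lowers the index of the generator by one.\<close>

lemma copy_prod_commute:
  assumes X: "at_first X" and RE: "r 0 * X * r 0 * X \<doteq> X * r 0 * X * r 0"
  shows "Suc i < k \<Longrightarrow> r i * copy_prod r s X k \<doteq> copy_prod r s X k * r i"
proof (induction i arbitrary: k)
  case 0
  then show ?case
  proof (induction k)
    case (Suc k)
    show ?case
    proof (cases "Suc 0 < k")
      case True
      have "r 0 * copy_prod r s X (Suc k) = (r 0 * copy_prod r s X k) * copy r s X k"
        by (simp add: mult.assoc)
      also have "\<dots> \<doteq> (copy_prod r s X k * r 0) * copy r s X k"
        using Suc.IH True by (intro ceq_right) simp
      also have "\<dots> = copy_prod r s X (Suc k) * r 0"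
        using copy_below[OF X True] by (simp add: mult.assoc)
      finally show ?thesis .
    next
      case False
      with Suc have k: "k = 1" by simp
      show ?thesis using ceq_right[OF RE, of "s 0"] by (simp add: k mult.assoc cancel)
    qed
  qed simp
next
  case (Suc i)
  obtain k' where k: "k = Suc k'" "Suc i < k'" using Suc.prems by (cases k) auto
  note P = copy_prod_Suc[OF X order_refl, symmetric]
  have "r (Suc i) * copy_prod r s X k = (r (Suc i) * X) * asc r k' * copy_prod r s X k' * desc s k'"
    by (simp only: k P mult.assoc)
  also have "\<dots> = X * (r (Suc i) * asc r k') * copy_prod r s X k' * desc s k'"
    using at_first_r[OF X, of "Suc i"] by (simp add: mult.assoc)
  also have "\<dots> = X * asc r k' * (r i * copy_prod r s X k') * desc s k'"
    using asc_shift[OF k(2)] by (simp add: mult.assoc)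
  also have "\<dots> \<doteq> X * asc r k' * (copy_prod r s X k' * r i) * desc s k'"
    using Suc.IH k by (intro ceq_ctx) simp
  also have "\<dots> = X * asc r k' * copy_prod r s X k' * (r i * desc s k')" by (simp add: mult.assoc)
  also have "r i * desc s k' = desc s k' * r (Suc i)"
    using inverse_commute[OF asc_desc desc_asc, of k' "r i" "r (Suc i)" k'] asc_shift[OF k(2)] by simp
  also have "X * asc r k' * copy_prod r s X k' * (desc s k' * r (Suc i)) = copy_prod r s X k * r (Suc i)"
    by (simp only: k P mult.assoc)
  finally show ?case .
qed

lemma copy_prod_commute_s:
  assumes "at_first X" and "r 0 * X * r 0 * X \<doteq> X * r 0 * X * r 0" and "Suc i < k"
  shows "s i * copy_prod r s X k \<doteq> copy_prod r s X k * s i"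
  using ceq_commute_inverse[OF r_s s_r copy_prod_commute[OF assms]] .

lemma asc_commute:
  assumes "\<And>i. i < m \<Longrightarrow> t i * a \<doteq> a * t i" shows "asc t m * a \<doteq> a * asc t m"
  using assms
proof (induction m)
  case (Suc m)
  have "asc t (Suc m) * a = asc t m * (t m * a)" by (simp add: mult.assoc)
  also have "\<dots> \<doteq> asc t m * (a * t m)" using Suc by (intro ceq_left) simp
  also have "\<dots> = (asc t m * a) * t m" by (simp add: mult.assoc)
  also have "\<dots> \<doteq> (a * asc t m) * t m" using Suc by (intro ceq_right) simp
  finally show ?case by (simp add: mult.assoc)
qed simp

lemma copy_prod_commute_asc:
  assumes "at_first X" and "r 0 * X * r 0 * X \<doteq> X * r 0 * X * r 0"
  shows "m < k \<Longrightarrow> asc s m * copy_prod r s X k \<doteq> copy_prod r s X k * asc s m"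
  by (intro asc_commute copy_prod_commute_s[OF assms]) auto

text \<open>The last copy is \<open>desc r k * X * asc s k\<close>, so the left side is the longer
  product conjugated by \<open>asc s k\<close>. The letters of that word commute with the product by
  the reflection equation.\<close>

lemma copy_prod_Suc_right:
  assumes X: "at_first X" and RE: "r 0 * X * r 0 * X \<doteq> X * r 0 * X * r 0"
  shows "asc s k * copy_prod r s X k * desc r k * X \<doteq> copy_prod r s X (Suc k)"
proof -
  have "asc s k * copy_prod r s X k * desc r k * X = (asc s k * copy_prod r s X (Suc k)) * desc r k"
    by (simp add: copy_desc_asc mult.assoc asc_s_desc_r)
  also have "\<dots> \<doteq> (copy_prod r s X (Suc k) * asc s k) * desc r k"
    using copy_prod_commute_asc[OF X RE, of k "Suc k"] by (intro ceq_right) simp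
  also have "\<dots> = copy_prod r s X (Suc k)" by (simp add: mult.assoc asc_s_desc_r)
  finally show ?thesis .
qed

end

section \<open>The Hecke algebra\<close>

text \<open>On \<open>k\<close> strands the generators run from \<open>r 0\<close> to
  \<open>r (k - 2)\<close>. Closure under subtraction comes from the scalar -1.\<close>

inductive_set hecke_algebra :: "(complex \<Rightarrow> 't::ring_1) \<Rightarrow> (nat \<Rightarrow> 't) \<Rightarrow> nat \<Rightarrow> 't set"
  for sc r k where
  scalar: "sc c \<in> hecke_algebra sc r k"
| gen: "Suc i < k \<Longrightarrow> r i \<in> hecke_algebra sc r k"
| add: "A \<in> hecke_algebra sc r k \<Longrightarrow> B \<in> hecke_algebra sc r k \<Longrightarrow> A + B \<in> hecke_algebra sc r k"
| mult: "A \<in> hecke_algebra sc r k \<Longrightarrow> B \<in> hecke_algebra sc r k \<Longrightarrow> A * B \<in> hecke_algebra sc r k"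

locale central_scalars =
  fixes sc :: "complex \<Rightarrow> 't::ring_1"
  assumes sc_add: "sc (c + d) = sc c + sc d" and sc_mult: "sc (c * d) = sc c * sc d"
    and sc_one: "sc 1 = 1" and sc_central: "sc c * x = x * sc c"
begin

lemma sc_zero: "sc 0 = 0"
  using sc_add[of 0 0] by simp

lemma sc_minus: "sc (- c) = - sc c"
  using sc_add[of c "- c"] by (metis add.right_inverse sc_zero minus_unique)

lemma sc_sum: "sc (sum f A) = (\<Sum>i\<in>A. sc (f i))"
  by (induction A rule: infinite_finite_induct) (simp_all add: sc_zero sc_add)

lemma sc_left_commute: "x * (sc c * y) = sc c * (x * y)"
  by (metis mult.assoc sc_central)

end

locale hecke = braids r s + central_scalars sc
  for r s :: "nat \<Rightarrow> 't::ring_1" and sc :: "complex \<Rightarrow> 't" +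
  fixes lam :: complex
  assumes quadratic: "r i * r i = sc lam * r i + 1"
begin

abbreviation H :: "nat \<Rightarrow> 't set" where
  "H k \<equiv> hecke_algebra sc r k"

lemma s_eq: "s i = r i - sc lam"
proof -
  have "r i = r i * (r i * s i)" by (simp add: r_s)
  also have "\<dots> = (sc lam * r i + 1) * s i" by (simp add: quadratic flip: mult.assoc)
  also have "\<dots> = sc lam + s i" by (simp add: distrib_right mult.assoc r_s)
  finally show ?thesis by simp
qed

lemma H_one: "1 \<in> H k"
  using hecke_algebra.scalar[of sc 1] by (simp add: sc_one)

lemma H_minus: "A \<in> H k \<Longrightarrow> - A \<in> H k"
  using hecke_algebra.mult[OF hecke_algebra.scalar[of sc "-1"]] by (force simp: sc_minus sc_one)

lemma H_diff: "A \<in> H k \<Longrightarrow> B \<in> H k \<Longrightarrow> A - B \<in> H k"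
  using hecke_algebra.add[OF _ H_minus] by fastforce

lemma H_s: "Suc i < k \<Longrightarrow> s i \<in> H k"
  unfolding s_eq by (intro H_diff hecke_algebra.gen hecke_algebra.scalar)

lemma H_mono: "k \<le> k' \<Longrightarrow> A \<in> H k \<Longrightarrow> A \<in> H k'"
  by (erule hecke_algebra.induct) (auto intro: hecke_algebra.intros)

lemma H_asc: "m < k \<Longrightarrow> asc r m \<in> H k" "m < k \<Longrightarrow> asc s m \<in> H k"
  by (induction m) (auto intro: hecke_algebra.intros H_one H_s)

text \<open>One \<open>A'\<close> serves both words; this is what makes the two traces in the
  centrality argument comparable. As a polynomial in the generators from \<open>r 1\<close> on, it
  commutes with everything on the first site.\<close>

lemma H_shift:
  assumes "A \<in> H k"
  shows "\<exists>A'\<in>H (Suc k). asc r k * A = A' * asc r k \<and> asc s k * A = A' * asc s k \<and>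
    (\<forall>X. at_first X \<longrightarrow> X * A' = A' * X)"
  using assms
proof induction
  case (scalar c)
  show ?case
    by (intro bexI[of _ "sc c"] hecke_algebra.scalar conjI allI impI) (simp_all only: sc_central)
next
  case (gen i)
  then show ?case
    by (intro bexI[of _ "r (Suc i)"] hecke_algebra.gen conjI allI impI)
      (simp_all add: asc_shift asc_s_shift at_first_def)
next
  case (add A B)
  then obtain A' B' where "A' \<in> H (Suc k)" "B' \<in> H (Suc k)"
    "asc r k * A = A' * asc r k" "asc s k * A = A' * asc s k"
    "asc r k * B = B' * asc r k" "asc s k * B = B' * asc s k"
    "\<forall>X. at_first X \<longrightarrow> X * A' = A' * X" "\<forall>X. at_first X \<longrightarrow> X * B' = B' * X" by blast
  then show ?case
    by (intro bexI[of _ "A' + B'"]) (auto intro: hecke_algebra.add simp: distrib_left distrib_right)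
next
  case (mult A B)
  then obtain A' B' where m: "A' \<in> H (Suc k)" "B' \<in> H (Suc k)"
    and A: "asc r k * A = A' * asc r k" "asc s k * A = A' * asc s k"
    and B: "asc r k * B = B' * asc r k" "asc s k * B = B' * asc s k"
    and X: "\<forall>X. at_first X \<longrightarrow> X * A' = A' * X" "\<forall>X. at_first X \<longrightarrow> X * B' = B' * X" by blast
  have "asc r k * (A * B) = A' * B' * asc r k"
    by (metis A(1) B(1) mult.assoc)
  moreover have "asc s k * (A * B) = A' * B' * asc s k"
    by (metis A(2) B(2) mult.assoc)
  moreover have "X * (A' * B') = A' * B' * X" if "at_first X" for X
    using X that by (metis mult.assoc)
  ultimately show ?case
    using hecke_algebra.mult[OF m] by (intro bexI[of _ "A' * B'"]) auto
qed

lemma desc_move: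
  assumes "asc r k * A = A' * asc r k" shows "A * desc s k = desc s k * A'"
  using inverse_commute[OF asc_desc desc_asc assms] .

lemma H_commute_above: "A \<in> H k \<Longrightarrow> k \<le> i \<Longrightarrow> r i * A = A * r i"
proof (induction rule: hecke_algebra.induct)
  case (scalar c)
  then show ?case by (simp only: sc_central)
next
  case (gen j)
  then show ?case using far[of j i] by simp
next
  case (add A B)
  then show ?case by (simp add: distrib_left distrib_right)
next
  case (mult A B)
  then show ?case by (metis mult.assoc)
qed

text \<open>In the Hecke algebra on \<open>k + 1\<close> strands the last generator need occur only once, which makes the
  partial trace over the last site computable.\<close>

inductive_set bruhat :: "nat \<Rightarrow> 't set" for k where
  small: "A \<in> H k \<Longrightarrow> A \<in> bruhat k"
| big: "A \<in> H k \<Longrightarrow> B \<in> H k \<Longrightarrow> A * r (k - 1) * B \<in> bruhat k"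
| add: "A \<in> bruhat k \<Longrightarrow> B \<in> bruhat k \<Longrightarrow> A + B \<in> bruhat k"

lemma bruhat_mult_H: "A \<in> H k \<Longrightarrow> B \<in> bruhat k \<Longrightarrow> A * B \<in> bruhat k"
proof (rotate_tac, induction rule: bruhat.induct)
  case (small A')
  then show ?case by (intro bruhat.small hecke_algebra.mult)
next
  case (big A' B)
  then show ?case using bruhat.big[OF hecke_algebra.mult, of A k A' B] by (simp add: mult.assoc)
next
  case (add A' B)
  then show ?case by (simp add: distrib_left bruhat.add)
qed

text \<open>If \<open>A\<close> commutes with \<open>r k\<close>, the quadratic relation removes one
  of the two factors \<open>r k\<close>. Otherwise \<open>A\<close> contains
  \<open>r (k - 1)\<close> once, and the braid relation trades two factors \<open>r k\<close> for
  one. The alternative \<open>k = 0\<close> avoids \<open>bruhat 0\<close>, where truncated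
  subtraction would make \<open>r 0\<close> the distinguished generator.\<close>

lemma bruhat_mult_gen:
  assumes sub: "A \<in> H (Suc k) \<Longrightarrow> k = 0 \<or> A \<in> bruhat k"
    and A: "A \<in> H (Suc k)" and B: "B \<in> H (Suc k)"
  shows "r k * A * r k * B \<in> bruhat (Suc k)"
proof -
  have commuting: "r k * A * r k * B \<in> bruhat (Suc k)" if "A \<in> H k" for A
  proof -
    have A': "A \<in> H (Suc k)" using H_mono[OF _ that] by simp
    have "r k * A * r k * B = A * (r k * r k) * B"
      using H_commute_above[OF that order_refl] by (simp add: mult.assoc)
    also have "\<dots> = (sc lam * A) * r (Suc k - 1) * B + A * B"
      by (simp add: quadratic distrib_left distrib_right sc_central mult.assoc)
    also have "\<dots> \<in> bruhat (Suc k)"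
      by (intro bruhat.add[OF bruhat.big bruhat.small] hecke_algebra.mult hecke_algebra.scalar A' B)
    finally show ?thesis .
  qed
  show ?thesis
  proof (cases k)
    case 0
    have "A \<in> H 0" using A unfolding 0 by induction (auto intro: hecke_algebra.intros)
    then show ?thesis using commuting 0 by simp
  next
    case (Suc j)
    then have "A \<in> bruhat (Suc j)" using sub A by simp
    then have "r (Suc j) * A * r (Suc j) * B \<in> bruhat (Suc (Suc j))"
    proof induction
      case (small A)
      then show ?case using commuting Suc by simp
    next
      case (big A' B')
      have c: "r (Suc j) * A' = A' * r (Suc j)" "r (Suc j) * B' = B' * r (Suc j)"
        using H_commute_above big by auto
      have "r (Suc j) * (A' * r (Suc j - 1) * B') * r (Suc j) * B
        = (r (Suc j) * A') * r j * (B' * r (Suc j)) * B" by (simp add: mult.assoc)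
      also have "\<dots> = A' * (r (Suc j) * r j * r (Suc j)) * B' * B"
        by (simp only: c(1) flip: c(2)) (simp only: mult.assoc)
      also have "\<dots> = A' * (r j * r (Suc j) * r j) * B' * B" by (simp only: braid)
      also have "\<dots> = (A' * r j) * r (Suc (Suc j) - 1) * (r j * B' * B)" by (simp add: mult.assoc)
      also have "\<dots> \<in> bruhat (Suc (Suc j))"
        using big B Suc H_mono[of "Suc j" "Suc (Suc j)"]
        by (intro bruhat.big hecke_algebra.mult hecke_algebra.gen) auto
      finally show ?case .
    next
      case (add A B')
      then show ?case by (simp add: distrib_left distrib_right bruhat.add)
    qed
    then show ?thesis using Suc by simp
  qed
qed

text \<open>The set \<open>bruhat (Suc k)\<close> contains 1 and is stable under left multiplication
  by the Hecke algebra. Stability under the last generator is \<open>bruhat_mult_gen\<close>, fed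
  with the decomposition on one strand fewer.\<close>

lemma H_Suc_bruhat: "A \<in> H (Suc (Suc k)) \<Longrightarrow> A \<in> bruhat (Suc k)"
proof (induction k arbitrary: A)
  have closed: "A * B \<in> bruhat (Suc k)"
    if sub: "\<And>A. A \<in> H (Suc k) \<Longrightarrow> k = 0 \<or> A \<in> bruhat k"
      and A: "A \<in> H (Suc (Suc k))" and B: "B \<in> bruhat (Suc k)" for A B k
    using A B
  proof (induction arbitrary: B)
    case (scalar c)
    then show ?case by (intro bruhat_mult_H hecke_algebra.scalar)
  next
    case (gen i)
    show ?case
    proof (cases "Suc i < Suc k")
      case True
      then show ?thesis using gen by (intro bruhat_mult_H hecke_algebra.gen)
    next
      case False
      with gen have i: "i = k" by simp
      from gen(2) show ?thesis unfolding i
      proof induction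
        case (small A)
        then show ?case using bruhat.big[OF H_one, of A "Suc k"] by simp
      next
        case (big A B)
        then show ?case using bruhat_mult_gen[OF sub big] by (simp add: mult.assoc)
      next
        case (add A B)
        then show ?case by (simp add: distrib_left bruhat.add)
      qed
    qed
  next
    case (add A A')
    then show ?case by (simp add: distrib_right bruhat.add)
  next
    case (mult A A')
    then show ?case by (simp add: mult.assoc)
  qed
  note mem = closed[OF _ _ bruhat.small[OF H_one], unfolded mult_1_right]
  {
    case 0
    then show ?case by (intro mem) auto
  next
    case (Suc k)
    then show ?case by (intro mem) auto
  }
qed

end

locale hecke_ideal = hecke r s sc lam + ring_ideal J
  for r s :: "nat \<Rightarrow> 't::ring_1" and sc :: "complex \<Rightarrow> 't" and lam :: complex and J :: "'t set"

sublocale hecke_ideal \<subseteq> braids_ideal ..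

section \<open>Hecke combinations of products of copies, and the passage of D through the copies of
  M\<close>

context hecke_ideal
begin

inductive_set copy_span :: "'t \<Rightarrow> nat \<Rightarrow> 't set" for Z k where
  base: "j \<le> k \<Longrightarrow> A \<in> H k \<Longrightarrow> B \<in> H k \<Longrightarrow> A * copy_prod r s Z j * B \<in> copy_span Z k"
| add: "X \<in> copy_span Z k \<Longrightarrow> Y \<in> copy_span Z k \<Longrightarrow> X + Y \<in> copy_span Z k"

lemma copy_span_mult:
  assumes "X \<in> copy_span Z k" "A \<in> H k" "B \<in> H k" shows "A * X * B \<in> copy_span Z k"
  using assms
proof (induction rule: copy_span.induct)
  case (base j A' B')
  have "(A * A') * copy_prod r s Z j * (B' * B) \<in> copy_span Z k"
    using base by (intro copy_span.base hecke_algebra.mult)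
  then show ?case by (simp add: mult.assoc)
next
  case (add X Y)
  then show ?case by (simp add: distrib_left distrib_right copy_span.add)
qed

lemma copy_span_mono: "X \<in> copy_span Z k \<Longrightarrow> k \<le> k' \<Longrightarrow> X \<in> copy_span Z k'"
  by (induction rule: copy_span.induct) (auto intro: copy_span.intros H_mono)

lemma copy_span_shift:
  assumes Z: "at_first Z" and X: "X \<in> copy_span Z k"
  shows "Z * asc r k * X * desc s k \<in> copy_span Z (Suc k)"
  using X
proof (induction rule: copy_span.induct)
  case (base j A B)
  obtain A' where A': "A' \<in> H (Suc k)" "asc r k * A = A' * asc r k" "Z * A' = A' * Z"
    using H_shift[OF base(2)] Z by blast
  obtain B' where B': "B' \<in> H (Suc k)" "asc r k * B = B' * asc r k"
    using H_shift[OF base(3)] by blast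
  have "Z * asc r k * (A * copy_prod r s Z j * B) * desc s k
    = Z * (asc r k * A) * copy_prod r s Z j * (B * desc s k)" by (simp add: mult.assoc)
  also have "\<dots> = (Z * A') * asc r k * copy_prod r s Z j * (desc s k * B')"
    by (simp only: A'(2) desc_move[OF B'(2)] mult.assoc)
  also have "\<dots> = A' * (Z * asc r k * copy_prod r s Z j * desc s k) * B'"
    by (simp only: A'(3) mult.assoc)
  also have "\<dots> = A' * copy_prod r s Z (Suc j) * B'"
    using copy_prod_Suc[OF Z base(1)] by simp
  finally show ?case using base A'(1) B'(1) copy_span.base[of "Suc j" "Suc k" A' B' Z] by simp
next
  case (add X Y)
  then show ?case by (simp add: distrib_left distrib_right copy_span.add)
qed

text \<open>Stated for an arbitrary sequence \<open>P\<close>, since it is used twice: for the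
  normal ordered products in terms of L, and for the products of copies of L in terms of the shifted
  matrix.\<close>

lemma copy_span_recursion:
  assumes Z: "at_first Z" and P0: "P 0 = 1"
    and rec: "\<And>k. P (Suc k) \<doteq> Z * asc r k * P k * desc s k + Y k * P k * desc s k"
    and Y: "\<And>k. Y k \<in> H (Suc k)"
  shows "\<exists>X\<in>copy_span Z k. P k \<doteq> X"
proof (induction k)
  case 0
  have "1 * copy_prod r s Z 0 * 1 \<in> copy_span Z 0" by (intro copy_span.base H_one) simp
  then show ?case using P0 by auto
next
  case (Suc k)
  then obtain X where X: "X \<in> copy_span Z k" "P k \<doteq> X" by blast
  have d: "desc s k \<in> H (Suc k)"
    by (induction k) (auto intro!: hecke_algebra.mult H_one H_s intro: H_mono[OF le_SucI[OF order_refl]])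
  have "P (Suc k) \<doteq> Z * asc r k * X * desc s k + Y k * X * desc s k"
    by (rule ceq_trans[OF rec ceq_add[OF ceq_ctx[OF X(2)] ceq_ctx[OF X(2)]]])
  moreover have "Z * asc r k * X * desc s k + Y k * X * desc s k \<in> copy_span Z (Suc k)"
    using X copy_span_shift[OF Z] copy_span_mult[OF copy_span_mono[of X Z k "Suc k"] Y d]
    by (intro copy_span.add) auto
  ultimately show ?case by blast
qed

text \<open>The matrix \<open>D\<close> and its translates, ordered so that \<open>copy_prod M k * dual_prod D k\<close> is the
  normal ordering of \<open>copy_prod (M * D) k\<close>.\<close>

primrec dual_prod :: "'t \<Rightarrow> nat \<Rightarrow> 't" where
  "dual_prod D 0 = 1"
| "dual_prod D (Suc k) = D * asc s k * dual_prod D k * desc s k"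

text \<open>This is the \<open>Y_k\<close> of the overview: each further copy that D crosses
  multiplies the earlier constants by \<open>r k\<close> and adds a new one,
  \<open>asc s k\<close>.\<close>

primrec const_part :: "nat \<Rightarrow> 't" where
  "const_part 0 = 0"
| "const_part (Suc k) = const_part k * r k + asc s k"

lemma const_part_H: "const_part k \<in> H (Suc k)"
proof (induction k)
  case 0
  show ?case using hecke_algebra.scalar[of sc 0] by (simp add: sc_zero)
next
  case (Suc k)
  then show ?case
    by (auto intro!: hecke_algebra.add hecke_algebra.mult hecke_algebra.gen H_asc intro: H_mono[of "Suc k"])
qed

text \<open>The hypothesis \<open>perm\<close> is the permutation relation multiplied by
  \<open>s 0\<close> on the right. The scalar \<open>e\<close> covers the homogeneous relations and
  those of the double at once.\<close>

context
  fixes M D :: 't and e :: complex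
  assumes M: "at_first M" and D: "at_first D"
    and perm: "D * r 0 * M \<doteq> r 0 * M * s 0 * D * s 0 + sc e"
begin

text \<open>The case 0 is the permutation relation times \<open>s 0\<close>; its homogeneous part is
  the rule for \<open>D_1\<close> and the second copy of M with factor \<open>R^(-2)\<close>. The
  next generator commutes with D, so conjugation by it gives the next copy, and the braid factors
  follow by \<open>V\<close> and \<open>W\<close>.\<close>

lemma D_copy:
  "D * copy r s M (Suc k) \<doteq>
    copy r s M (Suc k) * D * (asc s k * s k * s k * desc r k) + sc e * (asc s k * s k * desc r k)"
proof (induction k)
  case 0
  show ?case using ceq_right[OF perm, of "s 0"] by (simp add: mult.assoc distrib_right)
next
  case (Suc k)
  let ?r = "r (Suc k)" and ?s = "s (Suc k)" and ?c = "copy r s M (Suc k)"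
  let ?a = "asc s k" and ?d = "desc r k"
  have rD: "?r * D = D * ?r" and sD: "?s * D = D * ?s"
    using at_first_r[OF D] at_first_s[OF D] by auto
  have a: "?a * ?r = ?r * ?a" and d: "?d * ?s = ?s * ?d"
  proof -
    have "?s * ?a = ?a * ?s" using braids.asc_far[OF swap] by simp
    then show a: "?a * ?r = ?r * ?a" by (rule move_r)
    have "?r * ?d = ?d * ?r" using inverse_commute[OF asc_s_desc_r, of k ?r ?r k] a by simp
    then show "?d * ?s = ?s * ?d" by (rule move_s)
  qed
  have v: "?r * s k * ?s = s k * ?s * r k" using braid_ssr[of k] by (simp add: mult.assoc)
  have w: "?r * s k * s k * ?s = s k * ?s * ?s * r k"
  proof -
    \<comment> \<open>Inserting \<open>?s * ?r = 1\<close> between the two factors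
      \<open>s k\<close> reduces \<open>w\<close> to two applications of \<open>v\<close>.\<close>
    have "?r * s k * s k * ?s = (?r * s k * ?s) * (?r * s k * ?s)" by (simp add: mult.assoc cancel)
    then show ?thesis unfolding v by (simp add: mult.assoc cancel)
  qed
  have V: "?r * (?a * s k * ?d) * ?s = asc s (Suc k) * ?s * desc r (Suc k)"
  proof -
    have "?r * (?a * s k * ?d) * ?s = (?r * ?a) * s k * (?d * ?s)" by (simp add: mult.assoc)
    also have "\<dots> = ?a * (?r * s k * ?s) * ?d" by (simp only: d mult.assoc flip: a)
    also have "\<dots> = ?a * (s k * ?s * r k) * ?d" by (simp only: v)
    finally show ?thesis by (simp add: mult.assoc)
  qed
  have W: "?r * (?a * s k * s k * ?d) * ?s = asc s (Suc k) * ?s * ?s * desc r (Suc k)"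
  proof -
    have "?r * (?a * s k * s k * ?d) * ?s = (?r * ?a) * s k * s k * (?d * ?s)" by (simp add: mult.assoc)
    also have "\<dots> = ?a * (?r * s k * s k * ?s) * ?d" by (simp only: d mult.assoc flip: a)
    also have "\<dots> = ?a * (s k * ?s * ?s * r k) * ?d" by (simp only: w)
    finally show ?thesis by (simp add: mult.assoc)
  qed
  have "D * copy r s M (Suc (Suc k)) = (D * ?r) * ?c * ?s" by (simp add: mult.assoc)
  also have "\<dots> = ?r * (D * ?c) * ?s" by (simp only: flip: rD) (simp only: mult.assoc)
  also have "\<dots> \<doteq> ?r * (?c * D * (?a * s k * s k * ?d) + sc e * (?a * s k * ?d)) * ?s"
    by (rule ceq_ctx[OF Suc])
  also have "\<dots> = ?r * ?c * ?s * (?r * D) * (?a * s k * s k * ?d) * ?s + sc e * (?r * (?a * s k * ?d) * ?s)"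
    by (simp add: distrib_left distrib_right mult.assoc cancel sc_left_commute)
  also have "\<dots> = ?r * ?c * ?s * D * (?r * (?a * s k * s k * ?d) * ?s) + sc e * (?r * (?a * s k * ?d) * ?s)"
    unfolding rD by (simp only: mult.assoc)
  finally show ?case unfolding V W by simp
qed

text \<open>D crosses the factors one at a time; \<open>r k\<close> turns the last of them into the
  copy to which \<open>D_copy\<close> applies. The new constant leaves \<open>asc s k\<close> to the
  right of the product, and the reflection equation brings it to the left, where it joins
  \<open>const_part\<close>.\<close>

lemma pass_through:
  assumes RE: "r 0 * M * r 0 * M \<doteq> M * r 0 * M * r 0"
  shows "M * D * asc r k * copy_prod r s M k
    \<doteq> copy_prod r s M (Suc k) * D * asc s k + sc e * const_part k * copy_prod r s M k"
proof (induction k)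
  case 0
  show ?case by simp
next
  case (Suc k)
  let ?P = "copy_prod r s M" and ?c = "copy r s M"
  have rc: "r k * ?c k = ?c (Suc k) * r k" by (simp add: mult.assoc cancel)
  have Pr: "?P k * r k = r k * ?P k" using copy_prod_above[OF M, of k k] by simp
  have ac: "asc s k * ?c (Suc k) = ?c (Suc k) * asc s k"
  proof -
    have "m \<le> k \<Longrightarrow> asc s m * ?c (Suc k) = ?c (Suc k) * asc s m" for m
    proof (induction m)
      case (Suc m)
      have "r m * ?c (Suc k) = ?c (Suc k) * r m" using copy_below[OF M, of m "Suc k"] Suc by simp
      then have "?c (Suc k) * s m = s m * ?c (Suc k)" by (rule move_s)
      then show ?case using Suc by (metis Suc_leD asc.simps(2) mult.assoc)
    qed simp
    then show ?thesis by simp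
  qed
  have "M * D * asc r (Suc k) * ?P (Suc k) = M * D * asc r k * (r k * ?P k) * ?c k"
    by (simp add: mult.assoc)
  also have "\<dots> = (M * D * asc r k * ?P k) * (r k * ?c k)" by (simp add: mult.assoc flip: Pr)
  also have "\<dots> \<doteq> (?P (Suc k) * D * asc s k + sc e * const_part k * ?P k) * (r k * ?c k)"
    by (rule ceq_right[OF Suc])
  also have "\<dots> = ?P (Suc k) * D * (asc s k * ?c (Suc k)) * r k + sc e * const_part k * (?P k * r k) * ?c k"
    unfolding distrib_right by (simp only: mult.assoc flip: rc)
  also have "\<dots> = ?P (Suc k) * (D * ?c (Suc k)) * (asc s k * r k) + sc e * const_part k * r k * ?P (Suc k)"
    unfolding ac Pr by (simp add: mult.assoc)
  also have "\<dots> \<doteq> ?P (Suc k) * (?c (Suc k) * D * (asc s k * s k * s k * desc r k)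
      + sc e * (asc s k * s k * desc r k)) * (asc s k * r k) + sc e * const_part k * r k * ?P (Suc k)"
    by (intro ceq_add ceq_ctx D_copy ceq_refl)
  also have "\<dots> = ?P (Suc k) * ?c (Suc k) * D * (asc s k * s k * s k * (desc r k * asc s k) * r k)
      + sc e * (?P (Suc k) * (asc s k * s k * (desc r k * asc s k) * r k))
      + sc e * const_part k * r k * ?P (Suc k)"
    by (simp add: distrib_left distrib_right mult.assoc sc_left_commute)
  also have "\<dots> = ?P (Suc (Suc k)) * D * asc s (Suc k) + sc e * (?P (Suc k) * asc s k)
      + sc e * const_part k * r k * ?P (Suc k)"
    by (simp add: asc_s_desc_r mult.assoc cancel)
  also have "\<dots> \<doteq> ?P (Suc (Suc k)) * D * asc s (Suc k) + sc e * (asc s k * ?P (Suc k))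
      + sc e * const_part k * r k * ?P (Suc k)"
    by (intro ceq_add ceq_left ceq_sym[OF copy_prod_commute_asc[OF M RE]] ceq_refl) simp
  finally show ?case by (simp add: distrib_left distrib_right mult.assoc add_ac)
qed

lemma normal_ordered_recursion:
  assumes RE: "r 0 * M * r 0 * M \<doteq> M * r 0 * M * r 0"
  shows "M * D * asc r k * (copy_prod r s M k * dual_prod D k) * desc s k
    \<doteq> copy_prod r s M (Suc k) * dual_prod D (Suc k)
      + sc e * const_part k * (copy_prod r s M k * dual_prod D k) * desc s k"
  using ceq_right[OF pass_through[OF RE, of k], of "dual_prod D k * desc s k"]
  by (simp add: distrib_right mult.assoc)

text \<open>Normal ordering both quadratic terms gives the same ordered expression, by the
  reflection equation of M for the first term and that of D for the second. Only the constants of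
  the permutation relation survive.\<close>

lemma linear_reflection_equation:
  assumes RE: "r 0 * M * r 0 * M \<doteq> M * r 0 * M * r 0" and DD: "s 0 * D * s 0 * D \<doteq> D * s 0 * D * s 0"
  shows "r 0 * (M * D) * r 0 * (M * D) - (M * D) * r 0 * (M * D) * r 0
    \<doteq> sc e * (r 0 * (M * D) - (M * D) * r 0)"
proof -
  let ?r = "r 0" and ?s = "s 0"
  have LrL: "M * D * ?r * M * D \<doteq> M * ?r * M * ?s * D * ?s * D + sc e * (M * D)"
    using ceq_ctx[OF perm, of M D] by (simp add: distrib_left distrib_right mult.assoc sc_left_commute)
  have "?r * (M * D * ?r * M * D) \<doteq> ?r * (M * ?r * M * ?s * D * ?s * D + sc e * (M * D))"
    by (rule ceq_left[OF LrL])
  also have "\<dots> = (?r * M * ?r * M) * (?s * D * ?s * D) + sc e * (?r * M * D)"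
    by (simp add: distrib_left mult.assoc sc_left_commute)
  also have "\<dots> \<doteq> (M * ?r * M * ?r) * (?s * D * ?s * D) + sc e * (?r * M * D)"
    by (intro ceq_add ceq_right RE ceq_refl)
  finally have 1: "?r * (M * D * ?r * M * D) \<doteq> M * ?r * M * D * ?s * D + sc e * (?r * M * D)"
    by (simp add: mult.assoc cancel)
  have "M * D * ?r * M * D * ?r \<doteq> (M * ?r * M * ?s * D * ?s * D + sc e * (M * D)) * ?r"
    by (rule ceq_right[OF LrL])
  also have "\<dots> = (M * ?r * M) * (?s * D * ?s * D) * ?r + sc e * (M * D * ?r)"
    by (simp add: distrib_right mult.assoc)
  also have "\<dots> \<doteq> (M * ?r * M) * (D * ?s * D * ?s) * ?r + sc e * (M * D * ?r)"
    by (intro ceq_add ceq_ctx DD ceq_refl)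
  finally have 2: "M * D * ?r * M * D * ?r \<doteq> M * ?r * M * D * ?s * D + sc e * (M * D * ?r)"
    by (simp add: mult.assoc cancel)
  show ?thesis using ceq_diff[OF 1 2] by (simp add: right_diff_distrib mult.assoc)
qed

end

text \<open>The shift enters only through the commutator of L with the square of \<open>r 0\<close>,
  which is \<open>lam\<close> times the commutator with \<open>r 0\<close>. Division by
  \<open>lam\<close> therefore cancels the linear terms exactly.\<close>

lemma shifted_reflection_equation:
  assumes L: "r 0 * L * r 0 * L - L * r 0 * L * r 0 \<doteq> r 0 * L - L * r 0" and lam: "lam \<noteq> 0"
  defines "Z \<equiv> L - sc (inverse lam)"
  shows "r 0 * Z * r 0 * Z \<doteq> Z * r 0 * Z * r 0"
proof -
  let ?r = "r 0" and ?c = "sc (inverse lam)"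
  have cl: "?c * (sc lam * x) = x" for x
    using lam by (simp add: sc_one flip: mult.assoc sc_mult)
  have c: "L * (?c * y) = ?c * (L * y)" "?r * (?c * y) = ?c * (?r * y)" "L * ?c = ?c * L" "?r * ?c = ?c * ?r" for y
    by (rule sc_left_commute sc_central[symmetric])+
  have "?r * Z * ?r * Z - Z * ?r * Z * ?r = ?r * L * ?r * L - L * ?r * L * ?r
    - ?c * ((?r * ?r) * L - L * (?r * ?r))"
    by (simp add: Z_def left_diff_distrib right_diff_distrib mult.assoc c)
  also have "(?r * ?r) * L - L * (?r * ?r) = sc lam * (?r * L - L * ?r)"
    by (simp add: quadratic distrib_left distrib_right mult.assoc sc_left_commute[of L lam] right_diff_distrib)
  also have "?c * (sc lam * (?r * L - L * ?r)) = ?r * L - L * ?r" by (rule cl)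
  finally show ?thesis using L unfolding ceq_def by (simp only:)
qed

end

section \<open>Matrix units and partial traces\<close>

lemma sum_UNIV_prod: "(\<Sum>P\<in>UNIV. g P) = (\<Sum>a\<in>UNIV. \<Sum>b\<in>UNIV. g (a, b))"
  for g :: "'a::finite \<times> 'b::finite \<Rightarrow> 'c::comm_monoid_add"
  by (simp add: sum.cartesian_product)

text \<open>A system of matrix units with central scalars. It is instantiated at single sites and at
  pairs of neighbouring sites.\<close>

locale unit_system = central_scalars sc for sc :: "complex \<Rightarrow> 't::ring_1" +
  fixes f :: "'p::finite \<Rightarrow> 'p \<Rightarrow> 't"
  assumes unit_mult: "f a b * f c d = (if b = c then f a d else 0)"
    and unit_sum: "(\<Sum>a\<in>UNIV. f a a) = 1"
begin

definition mx :: "('p \<Rightarrow> 'p \<Rightarrow> complex) \<Rightarrow> 't" where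
  "mx \<alpha> = (\<Sum>a\<in>UNIV. \<Sum>b\<in>UNIV. sc (\<alpha> a b) * f a b)"

text \<open>The trace over the tensor factor of the matrix units, multiplied by the identity there,
  so that it stays in the same ring.\<close>

definition flat :: "'t \<Rightarrow> 't" where
  "flat X = (\<Sum>a\<in>UNIV. \<Sum>b\<in>UNIV. f b a * X * f a b)"

lemma unit_mult_assoc: "f a b * (f c d * x) = (if b = c then f a d * x else 0)"
  by (simp add: unit_mult flip: mult.assoc)

lemma unit_sc: "f a b * (sc c * x) = sc c * (f a b * x)"
  by (rule sc_left_commute)

lemma sc_sc: "sc c * (sc d * x) = sc (c * d) * x"
  by (simp add: sc_mult mult.assoc)

lemma unit_mx: "f a b * mx \<alpha> = (\<Sum>c\<in>UNIV. sc (\<alpha> b c) * f a c)"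
proof -
  have "f a b * mx \<alpha> = (\<Sum>x\<in>UNIV. \<Sum>c\<in>UNIV. if b = x then sc (\<alpha> x c) * f a c else 0)"
    unfolding mx_def sum_distrib_left by (intro sum.cong refl) (simp add: unit_sc unit_mult)
  then show ?thesis by (subst (asm) sum.swap) simp
qed

lemma mx_mult: "mx \<alpha> * mx \<beta> = mx (\<lambda>a b. \<Sum>c\<in>UNIV. \<alpha> a c * \<beta> c b)"
proof -
  have "mx \<alpha> * mx \<beta> = (\<Sum>a\<in>UNIV. \<Sum>b\<in>UNIV. sc (\<alpha> a b) * (f a b * mx \<beta>))"
    by (subst mx_def) (simp add: sum_distrib_right mult.assoc)
  also have "\<dots> = (\<Sum>a\<in>UNIV. \<Sum>b\<in>UNIV. \<Sum>c\<in>UNIV. sc (\<alpha> a b * \<beta> b c) * f a c)"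
    by (simp add: unit_mx sum_distrib_left sc_mult mult.assoc)
  also have "\<dots> = (\<Sum>a\<in>UNIV. \<Sum>c\<in>UNIV. \<Sum>b\<in>UNIV. sc (\<alpha> a b * \<beta> b c) * f a c)"
    by (intro sum.cong refl sum.swap)
  finally show ?thesis by (simp add: mx_def sc_sum sum_distrib_right)
qed

lemma mx_one: "mx (\<lambda>a b. if a = b then 1 else 0) = 1"
proof -
  have "mx (\<lambda>a b. if a = b then 1 else 0) = (\<Sum>a\<in>UNIV. \<Sum>b\<in>UNIV. if a = b then f a b else 0)"
    unfolding mx_def by (intro sum.cong refl) (simp add: sc_one sc_zero)
  then show ?thesis by (simp add: unit_sum)
qed

text \<open>Everything scalar is collected in one coefficient, where contraction identities can be
  applied, while \<open>X\<close> remains untouched between the units.\<close>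

lemma mx_sandwich:
  "(\<Sum>w\<in>W. sc (\<gamma> w) * (mx (\<alpha> w) * X * mx (\<beta> w))) =
    (\<Sum>a\<in>UNIV. \<Sum>b\<in>UNIV. \<Sum>c\<in>UNIV. \<Sum>d\<in>UNIV.
      sc (\<Sum>w\<in>W. \<gamma> w * \<alpha> w a b * \<beta> w c d) * (f a b * X * f c d))"
proof -
  have 1: "mx \<alpha> * X * mx \<beta> = (\<Sum>a\<in>UNIV. \<Sum>b\<in>UNIV. \<Sum>c\<in>UNIV. \<Sum>d\<in>UNIV.
      sc (\<alpha> a b * \<beta> c d) * (f a b * X * f c d))" for \<alpha> \<beta>
  proof -
    have "mx \<alpha> * X * mx \<beta> = (\<Sum>a\<in>UNIV. \<Sum>b\<in>UNIV. sc (\<alpha> a b) * (f a b * X * mx \<beta>))"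
      by (subst mx_def) (simp add: sum_distrib_right mult.assoc)
    moreover have "sc (\<alpha> a b) * (f a b * X * mx \<beta>) = (\<Sum>c\<in>UNIV. \<Sum>d\<in>UNIV.
      sc (\<alpha> a b * \<beta> c d) * (f a b * X * f c d))" for a b
      unfolding mx_def sum_distrib_left
      by (intro sum.cong refl) (simp add: sc_left_commute[of "f a b * X"] sc_sc)
    ultimately show ?thesis by simp
  qed
  have "(\<Sum>w\<in>W. sc (\<gamma> w) * (mx (\<alpha> w) * X * mx (\<beta> w))) =
    (\<Sum>w\<in>W. \<Sum>a\<in>UNIV. \<Sum>b\<in>UNIV. \<Sum>c\<in>UNIV. \<Sum>d\<in>UNIV.
      sc (\<gamma> w * \<alpha> w a b * \<beta> w c d) * (f a b * X * f c d))"
    unfolding 1 sum_distrib_left by (intro sum.cong refl) (simp only: sc_sc mult.assoc)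
  also have "\<dots> = (\<Sum>a\<in>UNIV. \<Sum>b\<in>UNIV. \<Sum>c\<in>UNIV. \<Sum>d\<in>UNIV. \<Sum>w\<in>W.
      sc (\<gamma> w * \<alpha> w a b * \<beta> w c d) * (f a b * X * f c d))"
    by (subst sum.swap, intro sum.cong refl)+
  finally show ?thesis by (simp add: sc_sum sum_distrib_right)
qed

lemma flat_cyclic_unit: "flat (f c d * X) = flat (X * f c d)"
proof -
  have "flat (f c d * X) = (\<Sum>a\<in>UNIV. \<Sum>b\<in>UNIV. if a = c then f b d * X * f c b else 0)"
    unfolding flat_def by (intro sum.cong refl) (simp add: unit_mult_assoc mult.assoc)
  also have "\<dots> = (\<Sum>b\<in>UNIV. f b d * X * f c b)"
    by (subst sum.swap) simp
  also have "\<dots> = (\<Sum>a\<in>UNIV. \<Sum>b\<in>UNIV. if d = a then f b d * X * f c b else 0)"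
    by (subst sum.swap) simp
  also have "\<dots> = flat (X * f c d)"
    unfolding flat_def by (intro sum.cong refl) (simp add: unit_mult mult.assoc)
  finally show ?thesis .
qed

lemma flat_add: "flat (X + Y) = flat X + flat Y"
  by (simp add: flat_def distrib_left distrib_right sum.distrib)

lemma flat_bimodule:
  assumes "\<And>a b. f a b * A = A * f a b" "\<And>a b. f a b * B = B * f a b"
  shows "flat (A * X * B) = A * flat X * B"
proof -
  have "f b a * (A * X * B) * f a b = A * (f b a * X * f a b) * B" for a b
  proof -
    have "f b a * (A * X * B) * f a b = (f b a * A) * X * (B * f a b)" by (simp add: mult.assoc)
    also have "\<dots> = A * f b a * X * (f a b * B)" by (simp only: assms)
    finally show ?thesis by (simp add: mult.assoc)
  qed
  then show ?thesis by (simp add: flat_def sum_distrib_left sum_distrib_right)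
qed

lemma flat_sc: "flat (sc c * X) = sc c * flat X"
  using flat_bimodule[of "sc c" 1 X] by (simp add: sc_central[of c])

lemma flat_zero: "flat 0 = 0"
  by (simp add: flat_def)

lemma flat_sum: "flat (sum g A) = (\<Sum>i\<in>A. flat (g i))"
  by (induction A rule: infinite_finite_induct) (simp_all add: flat_zero flat_add)

text \<open>Cyclicity needs one factor with scalar entries; the entries of \<open>X\<close> need not
  commute with each other.\<close>

lemma flat_cyclic: "flat (mx \<alpha> * X) = flat (X * mx \<alpha>)"
  by (simp add: mx_def sum_distrib_left sum_distrib_right flat_sum mult.assoc sc_left_commute[of X]
      flat_sc flat_cyclic_unit)

lemma unit_flat: "f a b * flat X = flat X * f a b"
proof -
  have "f a b * flat X = (\<Sum>c\<in>UNIV. \<Sum>d\<in>UNIV. if b = d then f a c * X * f c b else 0)"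
    unfolding flat_def sum_distrib_left by (intro sum.cong refl) (simp add: unit_mult_assoc mult.assoc)
  also have "\<dots> = (\<Sum>c\<in>UNIV. f a c * X * f c b)" by simp
  also have "\<dots> = (\<Sum>c\<in>UNIV. \<Sum>d\<in>UNIV. if d = a then f a c * X * f c b else 0)" by simp
  also have "\<dots> = flat X * f a b"
    unfolding flat_def sum_distrib_right by (intro sum.cong refl) (simp add: unit_mult mult.assoc)
  finally show ?thesis .
qed

end

text \<open>The conditions on \<open>C\<close> are coordinate forms of
  \<open>Tr_2(C_2 R X_1 R^-1) = Tr(C X)\<close>, the same with \<open>R\<close> and its inverse
  exchanged, \<open>C_1 C_2 R = R C_1 C_2\<close>, and \<open>Tr_2(R C_2) = 1\<close>.\<close>

locale traced = hecke r s sc lam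
  for r s :: "nat \<Rightarrow> 't::ring_1" and sc :: "complex \<Rightarrow> 't" and lam :: complex +
  fixes e :: "nat \<Rightarrow> 'n::finite \<Rightarrow> 'n \<Rightarrow> 't"
    and \<rho> \<sigma> :: "'n \<times> 'n \<Rightarrow> 'n \<times> 'n \<Rightarrow> complex" and C :: "'n \<Rightarrow> 'n \<Rightarrow> complex"
  assumes e_mult: "e j a b * e j c d = (if b = c then e j a d else 0)"
    and e_sum: "(\<Sum>a\<in>UNIV. e j a a) = 1"
    and e_commute: "i \<noteq> j \<Longrightarrow> e i a b * e j c d = e j c d * e i a b"
    and r_eq: "r i = (\<Sum>P\<in>UNIV. \<Sum>Q\<in>UNIV. sc (\<rho> P Q) * (e i (fst P) (fst Q) * e (Suc i) (snd P) (snd Q)))"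
    and s_eq': "s i = (\<Sum>P\<in>UNIV. \<Sum>Q\<in>UNIV. sc (\<sigma> P Q) * (e i (fst P) (fst Q) * e (Suc i) (snd P) (snd Q)))"
    and C_conj: "(\<Sum>(a, j, l)\<in>UNIV. C a j * \<rho> (h, j) (k, l) * \<sigma> (m, l) (n, a)) = (if h = n then C m k else 0)"
    and C_conj': "(\<Sum>(a, j, l)\<in>UNIV. C a j * \<sigma> (h, j) (k, l) * \<rho> (m, l) (n, a)) = (if h = n then C m k else 0)"
    and C_commute: "(\<Sum>U\<in>UNIV. C (fst P) (fst U) * C (snd P) (snd U) * \<rho> U Q)
       = (\<Sum>U\<in>UNIV. \<rho> P U * (C (fst U) (fst Q) * C (snd U) (snd Q)))"
    and C_trace: "(\<Sum>(j, a)\<in>UNIV. \<rho> (h, j) (k, a) * C a j) = (if h = k then 1 else 0)"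

sublocale traced \<subseteq> site: unit_system sc "e j" for j
  by unfold_locales (simp_all add: e_mult e_sum)

context traced
begin

definition pair :: "nat \<Rightarrow> 'n \<times> 'n \<Rightarrow> 'n \<times> 'n \<Rightarrow> 't" where
  "pair i P Q = e i (fst P) (fst Q) * e (Suc i) (snd P) (snd Q)"

lemma pair_mult: "pair i P Q * pair i U V = (if Q = U then pair i P V else 0)"
proof -
  have "pair i P Q * pair i U V = e i (fst P) (fst Q) * (e (Suc i) (snd P) (snd Q) * e i (fst U) (fst V))
    * e (Suc i) (snd U) (snd V)" by (simp add: pair_def mult.assoc)
  also have "\<dots> = (e i (fst P) (fst Q) * e i (fst U) (fst V)) * (e (Suc i) (snd P) (snd Q) * e (Suc i) (snd U) (snd V))"
    by (subst e_commute) (simp_all add: mult.assoc)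
  finally show ?thesis by (auto simp: e_mult pair_def prod_eq_iff)
qed

lemma pair_sum: "(\<Sum>P\<in>UNIV. pair i P P) = 1"
  by (simp add: sum_UNIV_prod pair_def e_sum flip: sum_distrib_left)

end

sublocale traced \<subseteq> pair: unit_system sc "pair i" for i
  by unfold_locales (simp_all add: pair_mult pair_sum)

section \<open>The weighted partial trace over a single site\<close>

context traced
begin

lemma r_mx: "r i = pair.mx i \<rho>" and s_mx: "s i = pair.mx i \<sigma>"
  by (simp_all add: r_eq s_eq' pair.mx_def pair_def)

text \<open>The algebraic form of acting as the identity on site \<open>j\<close>.\<close>

definition triv :: "nat \<Rightarrow> 't \<Rightarrow> bool" where
  "triv j A \<longleftrightarrow> (\<forall>a b. e j a b * A = A * e j a b)"

lemma triv_sc: "triv j (sc c)" and triv_one: "triv j 1"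
  by (simp_all add: triv_def sc_central)

lemma triv_add: "triv j A \<Longrightarrow> triv j B \<Longrightarrow> triv j (A + B)"
  by (simp add: triv_def distrib_left distrib_right)

lemma triv_mult: "triv j A \<Longrightarrow> triv j B \<Longrightarrow> triv j (A * B)"
  unfolding triv_def by (metis mult.assoc)

lemma triv_sum: "(\<And>i. i \<in> I \<Longrightarrow> triv j (g i)) \<Longrightarrow> triv j (sum g I)"
  by (simp add: triv_def sum_distrib_left sum_distrib_right)

lemma triv_e: "i \<noteq> j \<Longrightarrow> triv j (e i a b)"
  by (simp add: triv_def e_commute)

lemma triv_r: "j \<noteq> i \<Longrightarrow> j \<noteq> Suc i \<Longrightarrow> triv j (r i)"
  and triv_s: "j \<noteq> i \<Longrightarrow> j \<noteq> Suc i \<Longrightarrow> triv j (s i)"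
  unfolding r_eq s_eq' by (intro triv_sum triv_mult triv_sc triv_e; simp)+

lemmas triv_intros = triv_sc triv_one triv_add triv_mult triv_sum triv_e triv_r triv_s

definition Cm :: "nat \<Rightarrow> 't" where "Cm j = site.mx j C"

text \<open>The R-trace over one site, left inside the operator ring; its values act as the identity
  on that site.\<close>

definition E :: "nat \<Rightarrow> 't \<Rightarrow> 't" where "E j X = site.flat j (Cm j * X)"

lemma triv_Cm: "i \<noteq> j \<Longrightarrow> triv i (Cm j)"
  unfolding Cm_def site.mx_def by (intro triv_intros) auto

lemma triv_commute_mx: "triv j A \<Longrightarrow> site.mx j \<alpha> * A = A * site.mx j \<alpha>"
  by (simp add: site.mx_def triv_def sum_distrib_left sum_distrib_right mult.assoc sc_left_commute[of A])

lemma E_bimodule: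
  assumes "triv j A" "triv j B" shows "E j (A * X * B) = A * E j X * B"
proof -
  have "Cm j * (A * X * B) = A * (Cm j * X) * B"
    using triv_commute_mx[OF assms(1), of C] by (simp add: Cm_def flip: mult.assoc)
  then show ?thesis using assms by (simp add: E_def site.flat_bimodule triv_def)
qed

lemma E_left: "triv j A \<Longrightarrow> E j (A * X) = A * E j X"
  using E_bimodule[of j A 1 X] by (simp add: triv_one)

lemma E_right: "triv j B \<Longrightarrow> E j (X * B) = E j X * B"
  using E_bimodule[of j 1 B X] by (simp add: triv_one)

lemma E_add: "E j (X + Y) = E j X + E j Y"
  by (simp add: E_def distrib_left site.flat_add)

lemma triv_E: "triv j (E j X)"
  by (simp add: triv_def E_def site.unit_flat)

lemma triv_E_other: "triv i X \<Longrightarrow> triv i (E j X)"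
proof (cases "i = j")
  case False
  assume "triv i X"
  then show ?thesis
    unfolding E_def site.flat_def using False by (intro triv_sum triv_mult triv_e triv_Cm) auto
qed (simp add: triv_E)

lemma E_eq: "E j X = (\<Sum>a\<in>UNIV. \<Sum>b\<in>UNIV. \<Sum>x\<in>UNIV. sc (C a x) * (e j b x * X * e j a b))"
proof -
  have "e j b a * (Cm j * X) * e j a b = (\<Sum>x\<in>UNIV. sc (C a x) * (e j b x * X * e j a b))" for a b
  proof -
    have "e j b a * (Cm j * X) * e j a b = (e j b a * site.mx j C) * X * e j a b"
      by (simp add: Cm_def mult.assoc)
    then show ?thesis by (simp add: site.unit_mx sum_distrib_right mult.assoc)
  qed
  then show ?thesis by (simp add: E_def site.flat_def)
qed

end

section \<open>Contractions over two neighbouring sites and the iterated trace\<close>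

context traced
begin

text \<open>Fixing the indices of the second site views a matrix on two sites as a matrix on the
  second whose entries act on the first.\<close>

definition slice :: "nat \<Rightarrow> ('n \<times> 'n \<Rightarrow> 'n \<times> 'n \<Rightarrow> complex) \<Rightarrow> 'n \<Rightarrow> 'n \<Rightarrow> 't" where
  "slice i \<alpha> b d = site.mx i (\<lambda>a c. \<alpha> (a, b) (c, d))"

lemma pair_mx_slice: "pair.mx i \<alpha> = (\<Sum>b\<in>UNIV. \<Sum>d\<in>UNIV. slice i \<alpha> b d * e (Suc i) b d)"
proof -
  have "pair.mx i \<alpha> = (\<Sum>a\<in>UNIV. \<Sum>b\<in>UNIV. \<Sum>c\<in>UNIV. \<Sum>d\<in>UNIV.
      sc (\<alpha> (a, b) (c, d)) * (e i a c * e (Suc i) b d))"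
    by (simp add: pair.mx_def sum_UNIV_prod pair_def)
  also have "\<dots> = (\<Sum>b\<in>UNIV. \<Sum>a\<in>UNIV. \<Sum>d\<in>UNIV. \<Sum>c\<in>UNIV.
      sc (\<alpha> (a, b) (c, d)) * (e i a c * e (Suc i) b d))"
    by (subst sum.swap) (intro sum.cong refl sum.swap)
  also have "\<dots> = (\<Sum>b\<in>UNIV. \<Sum>d\<in>UNIV. \<Sum>a\<in>UNIV. \<Sum>c\<in>UNIV.
      sc (\<alpha> (a, b) (c, d)) * (e i a c * e (Suc i) b d))"
    by (intro sum.cong refl sum.swap)
  finally show ?thesis by (simp add: slice_def site.mx_def sum_distrib_right mult.assoc)
qed

lemma triv_slice: "triv (Suc i) (slice i \<alpha> b d)"
  unfolding slice_def site.mx_def by (intro triv_sum triv_mult triv_sc triv_e) auto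

lemma unit_slice: "e (Suc i) x y * slice i \<alpha> b d = slice i \<alpha> b d * e (Suc i) x y"
  using triv_slice by (simp add: triv_def)

lemma unit_pair_mx: "e (Suc i) x y * pair.mx i \<alpha> = (\<Sum>d\<in>UNIV. slice i \<alpha> y d * e (Suc i) x d)"
proof -
  have "e (Suc i) x y * pair.mx i \<alpha> = (\<Sum>b\<in>UNIV. \<Sum>d\<in>UNIV. if y = b then slice i \<alpha> b d * e (Suc i) x d else 0)"
    unfolding pair_mx_slice sum_distrib_left
  proof (intro sum.cong refl)
    fix b d
    have "e (Suc i) x y * (slice i \<alpha> b d * e (Suc i) b d) = slice i \<alpha> b d * (e (Suc i) x y * e (Suc i) b d)"
      by (simp add: unit_slice flip: mult.assoc)
    then show "e (Suc i) x y * (slice i \<alpha> b d * e (Suc i) b d)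
      = (if y = b then slice i \<alpha> b d * e (Suc i) x d else 0)" by (simp add: e_mult)
  qed
  then show ?thesis by (subst (asm) sum.swap) simp
qed

lemma pair_mx_unit: "pair.mx i \<alpha> * e (Suc i) x y = (\<Sum>b\<in>UNIV. slice i \<alpha> b x * e (Suc i) b y)"
proof -
  have "pair.mx i \<alpha> * e (Suc i) x y = (\<Sum>b\<in>UNIV. \<Sum>d\<in>UNIV. if d = x then slice i \<alpha> b d * e (Suc i) b y else 0)"
    unfolding pair_mx_slice sum_distrib_right by (intro sum.cong refl) (simp add: mult.assoc e_mult)
  then show ?thesis by simp
qed

text \<open>\<open>X\<close> acts trivially on the second site, so the matrix units there pass it
  and contract with each other; slices on the first site remain around \<open>X\<close>.\<close>

lemma E_sandwich:
  assumes X: "triv (Suc i) X"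
  shows "E (Suc i) (pair.mx i \<alpha> * X * pair.mx i \<beta>)
    = (\<Sum>(a, j, l)\<in>UNIV. sc (C a j) * (slice i \<alpha> j l * X * slice i \<beta> l a))"
proof -
  have inner: "e (Suc i) b x * (pair.mx i \<alpha> * X * pair.mx i \<beta>) * e (Suc i) a b
    = (\<Sum>q\<in>UNIV. slice i \<alpha> x q * X * slice i \<beta> q a) * e (Suc i) b b" for a b x
  proof -
    have "e (Suc i) b x * (pair.mx i \<alpha> * X * pair.mx i \<beta>) * e (Suc i) a b
      = (e (Suc i) b x * pair.mx i \<alpha>) * X * (pair.mx i \<beta> * e (Suc i) a b)" by (simp add: mult.assoc)
    also have "\<dots> = (\<Sum>q\<in>UNIV. \<Sum>p\<in>UNIV. (slice i \<alpha> x q * e (Suc i) b q) * X * (slice i \<beta> p a * e (Suc i) p b))"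
      by (simp add: unit_pair_mx pair_mx_unit sum_distrib_left sum_distrib_right) (rule sum.swap)
    also have "\<dots> = (\<Sum>q\<in>UNIV. \<Sum>p\<in>UNIV. if q = p then slice i \<alpha> x q * X * slice i \<beta> p a * e (Suc i) b b else 0)"
    proof (intro sum.cong refl)
      fix q p
      have "(slice i \<alpha> x q * e (Suc i) b q) * X * (slice i \<beta> p a * e (Suc i) p b)
        = slice i \<alpha> x q * (e (Suc i) b q * X) * slice i \<beta> p a * e (Suc i) p b" by (simp add: mult.assoc)
      also have "e (Suc i) b q * X = X * e (Suc i) b q" using X by (simp add: triv_def)
      also have "slice i \<alpha> x q * (X * e (Suc i) b q) * slice i \<beta> p a * e (Suc i) p b
        = slice i \<alpha> x q * X * (e (Suc i) b q * slice i \<beta> p a) * e (Suc i) p b" by (simp add: mult.assoc)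
      also have "\<dots> = slice i \<alpha> x q * X * slice i \<beta> p a * (e (Suc i) b q * e (Suc i) p b)"
        by (simp add: unit_slice mult.assoc)
      finally show "(slice i \<alpha> x q * e (Suc i) b q) * X * (slice i \<beta> p a * e (Suc i) p b)
        = (if q = p then slice i \<alpha> x q * X * slice i \<beta> p a * e (Suc i) b b else 0)"
        by (simp add: e_mult)
    qed
    finally show ?thesis by (simp add: sum_distrib_right)
  qed
  have "E (Suc i) (pair.mx i \<alpha> * X * pair.mx i \<beta>)
    = (\<Sum>a\<in>UNIV. \<Sum>b\<in>UNIV. \<Sum>x\<in>UNIV. sc (C a x) * (\<Sum>q\<in>UNIV. slice i \<alpha> x q * X * slice i \<beta> q a) * e (Suc i) b b)"
    unfolding E_eq inner by (simp only: mult.assoc)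
  also have "\<dots> = (\<Sum>a\<in>UNIV. (\<Sum>x\<in>UNIV. sc (C a x) * (\<Sum>q\<in>UNIV. slice i \<alpha> x q * X * slice i \<beta> q a)) * (\<Sum>b\<in>UNIV. e (Suc i) b b))"
    unfolding sum_distrib_left sum_distrib_right by (intro sum.cong refl)
  also have "\<dots> = (\<Sum>a\<in>UNIV. \<Sum>x\<in>UNIV. \<Sum>q\<in>UNIV. sc (C a x) * (slice i \<alpha> x q * X * slice i \<beta> q a))"
    by (simp add: e_sum sum_distrib_left)
  finally show ?thesis by (simp add: sum.cartesian_product)
qed

text \<open>After the slices are expanded in matrix units of the first site, the assumed identity
  evaluates the coefficients to those of \<open>E i X\<close>. The pair of matrices is left general,
  so that either of \<open>r\<close> and \<open>s\<close> may come first.\<close>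

lemma E_conj_general:
  assumes X: "triv (Suc i) X"
    and ab: "\<And>h k m n. (\<Sum>(a, j, l)\<in>UNIV. C a j * \<alpha> (h, j) (k, l) * \<beta> (m, l) (n, a)) = (if h = n then C m k else 0)"
  shows "E (Suc i) (pair.mx i \<alpha> * X * pair.mx i \<beta>) = E i X"
proof -
  \<comment> \<open>The power of 1 has value 1; mentioning \<open>l\<close> there gives the third
    component its type.\<close>
  define \<gamma> where "\<gamma> = (\<lambda>(a, j, l). C a (j :: 'n) * (1 :: complex) ^ (if l = (l :: 'n) then 0 else 0))"
  have "E (Suc i) (pair.mx i \<alpha> * X * pair.mx i \<beta>)
    = (\<Sum>w\<in>UNIV. sc (\<gamma> w) * (site.mx i ((\<lambda>(a, j, l) h k. \<alpha> (h, j) (k, l)) w) * X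
        * site.mx i ((\<lambda>(a, j, l) m n. \<beta> (m, l) (n, a)) w)))"
    unfolding E_sandwich[OF X] \<gamma>_def slice_def by (intro sum.cong refl) (simp add: case_prod_unfold)
  also have "\<dots> = (\<Sum>h\<in>UNIV. \<Sum>k\<in>UNIV. \<Sum>m\<in>UNIV. \<Sum>n\<in>UNIV.
      sc (if h = n then C m k else 0) * (e i h k * X * e i m n))"
    unfolding site.mx_sandwich ab[symmetric] \<gamma>_def by (simp add: case_prod_unfold)
  also have "\<dots> = (\<Sum>h\<in>UNIV. \<Sum>k\<in>UNIV. \<Sum>m\<in>UNIV. \<Sum>n\<in>UNIV.
      if h = n then sc (C m k) * (e i h k * X * e i m n) else 0)"
    by (intro sum.cong refl) (simp add: sc_zero)
  also have "\<dots> = (\<Sum>h\<in>UNIV. \<Sum>k\<in>UNIV. \<Sum>m\<in>UNIV. sc (C m k) * (e i h k * X * e i m h))"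
    by simp
  also have "\<dots> = (\<Sum>h\<in>UNIV. \<Sum>m\<in>UNIV. \<Sum>k\<in>UNIV. sc (C m k) * (e i h k * X * e i m h))"
    by (intro sum.cong refl sum.swap)
  also have "\<dots> = E i X" unfolding E_eq by (rule sum.swap)
  finally show ?thesis .
qed

lemma E_conj: "triv (Suc i) X \<Longrightarrow> E (Suc i) (r i * X * s i) = E i X"
  and E_conj': "triv (Suc i) X \<Longrightarrow> E (Suc i) (s i * X * r i) = E i X"
  by (simp_all only: r_mx s_mx E_conj_general C_conj C_conj')

lemma E_one: "E j 1 = sc (\<Sum>a\<in>UNIV. C a a)"
proof -
  have "E j 1 = (\<Sum>a\<in>UNIV. \<Sum>b\<in>UNIV. \<Sum>x\<in>UNIV. if x = a then sc (C a x) * e j b b else 0)"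
    unfolding E_eq by (intro sum.cong refl) (simp add: e_mult)
  then show ?thesis by (simp add: e_sum sc_sum flip: sum_distrib_left)
qed

lemma E_r: "E (Suc i) (r i) = 1"
proof -
  have one: "slice i (\<lambda>P Q. if P = Q then 1 else 0) l a = (if l = a then 1 else 0)" for l a
    using site.mx_one[of i] by (auto simp: slice_def site.mx_def sc_zero)
  \<comment> \<open>The unit matrix as second factor makes this a sandwich of
    \<open>X = 1\<close>.\<close>
  have "E (Suc i) (r i) = E (Suc i) (pair.mx i \<rho> * 1 * pair.mx i (\<lambda>P Q. if P = Q then 1 else 0))"
    by (simp add: pair.mx_one r_mx)
  also have "\<dots> = (\<Sum>(a, j, l)\<in>UNIV. if l = a then sc (C a j) * slice i \<rho> j l else 0)"
    unfolding E_sandwich[OF triv_one] one by (intro sum.cong refl) (auto simp: case_prod_unfold)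
  also have "\<dots> = (\<Sum>a\<in>UNIV. \<Sum>j\<in>UNIV. sc (C a j) * slice i \<rho> j a)"
    by (simp add: sum_UNIV_prod)
  also have "\<dots> = (\<Sum>a\<in>UNIV. \<Sum>j\<in>UNIV. \<Sum>h\<in>UNIV. \<Sum>k\<in>UNIV. sc (\<rho> (h, j) (k, a) * C a j) * e i h k)"
    unfolding slice_def site.mx_def sum_distrib_left
    by (intro sum.cong refl) (simp add: site.sc_sc mult.commute)
  also have "\<dots> = (\<Sum>a\<in>UNIV. \<Sum>h\<in>UNIV. \<Sum>k\<in>UNIV. \<Sum>j\<in>UNIV. sc (\<rho> (h, j) (k, a) * C a j) * e i h k)"
    by (rule sum.cong[OF refl], subst sum.swap, intro sum.cong refl sum.swap)
  also have "\<dots> = (\<Sum>h\<in>UNIV. \<Sum>k\<in>UNIV. \<Sum>a\<in>UNIV. \<Sum>j\<in>UNIV. sc (\<rho> (h, j) (k, a) * C a j) * e i h k)"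
    by (subst sum.swap, intro sum.cong refl sum.swap)
  also have "\<dots> = (\<Sum>h\<in>UNIV. \<Sum>k\<in>UNIV. sc (\<Sum>(j, a)\<in>UNIV. \<rho> (h, j) (k, a) * C a j) * e i h k)"
    by (intro sum.cong refl) (subst sum.swap, simp add: sum_UNIV_prod sc_sum sum_distrib_right)
  also have "\<dots> = 1" unfolding C_trace using site.mx_one[of i] by (simp add: site.mx_def)
  finally show ?thesis .
qed

definition CC :: "nat \<Rightarrow> 't" where
  "CC i = pair.mx i (\<lambda>P Q. C (fst P) (fst Q) * C (snd P) (snd Q))"

lemma CC_eq: "Cm i * Cm (Suc i) = CC i"
proof -
  have "Cm i * Cm (Suc i) = (\<Sum>a\<in>UNIV. \<Sum>c\<in>UNIV. \<Sum>b\<in>UNIV. \<Sum>d\<in>UNIV.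
      (sc (C a c) * e i a c) * (sc (C b d) * e (Suc i) b d))"
    unfolding Cm_def site.mx_def sum_distrib_right by (simp add: sum_distrib_left)
  also have "\<dots> = (\<Sum>a\<in>UNIV. \<Sum>b\<in>UNIV. \<Sum>c\<in>UNIV. \<Sum>d\<in>UNIV.
      (sc (C a c) * e i a c) * (sc (C b d) * e (Suc i) b d))"
    by (intro sum.cong refl sum.swap)
  also have "\<dots> = (\<Sum>a\<in>UNIV. \<Sum>b\<in>UNIV. \<Sum>c\<in>UNIV. \<Sum>d\<in>UNIV.
      sc (C a c * C b d) * (e i a c * e (Suc i) b d))"
    by (intro sum.cong refl) (simp add: mult.assoc site.unit_sc site.sc_sc)
  finally show ?thesis by (simp add: CC_def pair.mx_def sum_UNIV_prod pair_def)
qed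

lemma CC_r: "CC i * r i = r i * CC i"
  unfolding CC_def r_mx pair.mx_mult C_commute ..

text \<open>The weight of the first site passes the trace over the second. The two traces thus
  become one over the pair, for which \<open>flat_cyclic\<close> is available.\<close>

lemma E_E: "E i (E (Suc i) X) = pair.flat i (CC i * X)"
proof -
  have "E i (E (Suc i) X) = site.flat i (site.flat (Suc i) (Cm i * (Cm (Suc i) * X)))"
    using site.flat_bimodule[of "Suc i" "Cm i" 1 "Cm (Suc i) * X"] triv_Cm[of "Suc i" i]
    by (simp add: E_def triv_def)
  also have "Cm i * (Cm (Suc i) * X) = CC i * X" by (simp flip: CC_eq mult.assoc)
  also have "site.flat i (site.flat (Suc i) Y) = pair.flat i Y" for Y
  proof -
    have "site.flat i (site.flat (Suc i) Y) = (\<Sum>a\<in>UNIV. \<Sum>c\<in>UNIV. \<Sum>b\<in>UNIV. \<Sum>d\<in>UNIV.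
        e i c a * (e (Suc i) d b * Y * e (Suc i) b d) * e i a c)"
      by (simp add: site.flat_def sum_distrib_left sum_distrib_right)
    also have "\<dots> = (\<Sum>a\<in>UNIV. \<Sum>b\<in>UNIV. \<Sum>c\<in>UNIV. \<Sum>d\<in>UNIV.
        e i c a * (e (Suc i) d b * Y * e (Suc i) b d) * e i a c)"
      by (intro sum.cong refl sum.swap)
    also have "\<dots> = (\<Sum>a\<in>UNIV. \<Sum>b\<in>UNIV. \<Sum>c\<in>UNIV. \<Sum>d\<in>UNIV.
        (e i c a * e (Suc i) d b) * Y * (e i a c * e (Suc i) b d))"
      by (intro sum.cong refl) (simp add: mult.assoc e_commute[of "Suc i" i])
    finally show ?thesis by (simp add: pair.flat_def sum_UNIV_prod pair_def)
  qed
  finally show ?thesis .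
qed

lemma E_E_cyclic: "E i (E (Suc i) (r i * A)) = E i (E (Suc i) (A * r i))"
proof -
  have "CC i * (r i * A) = r i * (CC i * A)" by (simp add: CC_r flip: mult.assoc)
  moreover have "CC i * (A * r i) = CC i * A * r i" by (simp add: mult.assoc)
  ultimately show ?thesis by (simp only: E_E r_mx pair.flat_cyclic)
qed

text \<open>\<open>traces o n\<close> traces out the sites \<open>o, \<dots>, o + n - 1\<close>.\<close>

primrec traces :: "nat \<Rightarrow> nat \<Rightarrow> 't \<Rightarrow> 't" where
  "traces o' 0 X = X"
| "traces o' (Suc n) X = traces o' n (E (o' + n) X)"

lemma traces_bimodule:
  assumes "\<And>j. o' \<le> j \<Longrightarrow> j < o' + n \<Longrightarrow> triv j A" "\<And>j. o' \<le> j \<Longrightarrow> j < o' + n \<Longrightarrow> triv j B"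
  shows "traces o' n (A * X * B) = A * traces o' n X * B"
  using assms by (induction n arbitrary: X) (simp_all add: E_bimodule)

lemma traces_add: "traces o' n (X + Y) = traces o' n X + traces o' n Y"
  by (induction n arbitrary: X Y) (simp_all add: E_add)

lemma triv_asc: "k < j \<Longrightarrow> triv j (asc r k)" "k < j \<Longrightarrow> triv j (asc s k)"
  "k < j \<Longrightarrow> triv j (desc r k)" "k < j \<Longrightarrow> triv j (desc s k)"
  by (induction k) (auto intro!: triv_intros)

text \<open>The top site is treated first: the last letter of the word conjugates \<open>X\<close>,
  and \<open>E_conj\<close> replaces the trace over site \<open>Suc k\<close> by that over site
  \<open>k\<close>. The shorter word and the induction hypothesis do the rest.\<close>

lemma traces_conj:
  assumes "\<And>j. k \<le> j \<Longrightarrow> triv j X"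
  shows "traces 1 k (asc r k * X * desc s k) = traces 0 k X \<and>
    traces 1 k (asc s k * X * desc r k) = traces 0 k X"
  using assms
proof (induction k arbitrary: X)
  case (Suc k)
  have X: "triv (Suc k) X" using Suc.prems by simp
  have EX: "triv j (E k X)" if "k \<le> j" for j
    using that Suc.prems[of j] by (cases "j = k") (simp_all add: triv_E triv_E_other)
  have 1: "asc r (Suc k) * X * desc s (Suc k) = asc r k * (r k * X * s k) * desc s k"
    and 2: "asc s (Suc k) * X * desc r (Suc k) = asc s k * (s k * X * r k) * desc r k"
    by (simp_all add: mult.assoc)
  have "traces 1 (Suc k) (asc r (Suc k) * X * desc s (Suc k)) = traces 1 k (asc r k * E k X * desc s k)"
    unfolding 1 using X by (simp only: traces.simps plus_1_eq_Suc) (simp add: E_bimodule triv_asc E_conj)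
  moreover have "traces 1 (Suc k) (asc s (Suc k) * X * desc r (Suc k)) = traces 1 k (asc s k * E k X * desc r k)"
    unfolding 2 using X by (simp only: traces.simps plus_1_eq_Suc) (simp add: E_bimodule triv_asc E_conj')
  ultimately show ?case using Suc.IH[OF EX] by simp
qed simp

lemma triv_H: "A \<in> H k \<Longrightarrow> k \<le> j \<Longrightarrow> triv j A"
  by (induction rule: hecke_algebra.induct) (auto intro: triv_intros)

text \<open>For a generator \<open>r i\<close>, the traces over the sites above \<open>Suc i\<close>
  ignore it, and the traces over the remaining top two sites are cyclic for it by
  \<open>E_E_cyclic\<close>.\<close>

lemma traces_cyclic:
  assumes "A \<in> H k" shows "traces 0 k (A * X) = traces 0 k (X * A)"
  using assms
proof (induction arbitrary: X)
  case (scalar c)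
  then show ?case by (simp only: sc_central)
next
  case (gen i)
  then show ?case
  proof (induction k arbitrary: X)
    case (Suc k)
    show ?case
    proof (cases "Suc i < k")
      case True
      then have "triv k (r i)" by (intro triv_r) auto
      then show ?thesis using Suc.IH[OF True] by (simp add: E_left E_right)
    next
      case False
      with Suc have "k = Suc i" by simp
      then show ?thesis by (simp add: E_E_cyclic)
    qed
  qed simp
next
  case (add A B)
  then show ?case by (simp add: distrib_left distrib_right traces_add)
next
  case (mult A B)
  have "traces 0 k (A * B * X) = traces 0 k (B * X * A)" using mult.IH(1) by (simp add: mult.assoc)
  also have "\<dots> = traces 0 k (X * A * B)" using mult.IH(2)[of "X * A"] by (simp add: mult.assoc)
  finally show ?case by (simp add: mult.assoc)
qed

text \<open>In the form given by \<open>H_Suc_bruhat\<close> the last generator occurs at most once.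
  Where it occurs, its trace is 1; where it does not, the trace multiplies by the scalar trace of
  \<open>C\<close>.\<close>

lemma E_H: "A \<in> H (Suc k) \<Longrightarrow> E k A \<in> H k"
proof -
  have small: "E k A \<in> H k" if "A \<in> H k" for A
    using E_left[OF triv_H[OF that order_refl], of 1] that
    by (auto simp: E_one intro: hecke_algebra.intros)
  assume A: "A \<in> H (Suc k)"
  show ?thesis
  proof (cases k)
    case 0
    have "A \<in> H 0" using A unfolding 0 by induction (auto intro: hecke_algebra.intros)
    then show ?thesis using small 0 by simp
  next
    case (Suc j)
    from H_Suc_bruhat[OF A[unfolded Suc]] have "E (Suc j) A \<in> H (Suc j)"
    proof induction
      case (small A)
      then show ?case using \<open>\<And>A. A \<in> H k \<Longrightarrow> E k A \<in> H k\<close> Suc by simp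
    next
      case (big A B)
      then have "E (Suc j) (A * r j * B) = A * B" by (simp add: E_bimodule triv_H E_r)
      then show ?case using big by (simp add: hecke_algebra.mult)
    next
      case (add A B)
      then show ?case by (simp add: E_add hecke_algebra.add)
    qed
    then show ?thesis using Suc by simp
  qed
qed

lemma traces_reduce:
  assumes "j \<le> k" "A \<in> H k" "\<And>i. j \<le> i \<Longrightarrow> triv i X"
  shows "\<exists>A'\<in>H j. traces 0 k (A * X) = traces 0 j (A' * X)"
  using assms
proof (induction k arbitrary: A)
  case (Suc k)
  show ?case
  proof (cases "j = Suc k")
    case False
    then show ?thesis
      using Suc.IH[OF _ E_H[OF Suc.prems(2)]] Suc.prems by (simp add: E_right)
  qed (use Suc in auto)
qed auto

lemma at_first_triv: "(\<And>j. 0 < j \<Longrightarrow> triv j Z) \<Longrightarrow> at_first Z"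
proof -
  assume Z: "\<And>j. 0 < j \<Longrightarrow> triv j Z"
  have "pair (Suc i) P Q * Z = Z * pair (Suc i) P Q" for i P Q
    using Z[of "Suc i"] Z[of "Suc (Suc i)"] unfolding triv_def pair_def by (simp add: mult.assoc) (simp flip: mult.assoc)
  then show "at_first Z"
    by (simp add: at_first_def r_mx pair.mx_def sum_distrib_left sum_distrib_right mult.assoc sc_left_commute[of Z])
qed

lemma triv_copy: "(\<And>j. 0 < j \<Longrightarrow> triv j Z) \<Longrightarrow> k < j \<Longrightarrow> triv j (copy r s Z k)"
  by (induction k) (auto intro!: triv_intros)

lemma triv_copy_prod: "(\<And>j. 0 < j \<Longrightarrow> triv j Z) \<Longrightarrow> k \<le> j \<Longrightarrow> triv j (copy_prod r s Z k)"
  by (induction k) (auto intro!: triv_intros triv_copy)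

end

section \<open>Traces modulo an ideal\<close>

locale traced_ideal = traced r s sc lam e \<rho> \<sigma> C + ring_ideal J
  for r s :: "nat \<Rightarrow> 't::ring_1" and sc :: "complex \<Rightarrow> 't" and lam :: complex
    and e :: "nat \<Rightarrow> 'n::finite \<Rightarrow> 'n \<Rightarrow> 't" and \<rho> \<sigma> C and J :: "'t set"

sublocale traced_ideal \<subseteq> hecke_ideal ..

context traced_ideal
begin

lemma E_ceq: "X \<doteq> Y \<Longrightarrow> E j X \<doteq> E j Y"
  unfolding E_def site.flat_def by (intro ceq_sum ceq_ctx ceq_left)

lemma traces_ceq: "X \<doteq> Y \<Longrightarrow> traces o' n X \<doteq> traces o' n Y"
  by (induction n arbitrary: X Y) (simp_all add: E_ceq)

text \<open>Cyclicity moves the right coefficient to the left, and \<open>traces_reduce\<close> cuts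
  the trace down to the sites of the product. The set \<open>W\<close> is the Casimir span in one
  application and, in the other, what commutes with the shifted matrix modulo the ideal.\<close>

lemma traces_copy_span:
  assumes Z: "\<And>j. 0 < j \<Longrightarrow> triv j Z"
    and W_add: "\<And>x y. x \<in> W \<Longrightarrow> y \<in> W \<Longrightarrow> x + y \<in> W"
    and W: "\<And>j A. A \<in> H j \<Longrightarrow> traces 0 j (A * copy_prod r s Z j) \<in> W"
    and B: "B \<in> H k"
  shows "X \<in> copy_span Z k \<Longrightarrow> traces 0 k (B * X) \<in> W"
proof (induction rule: copy_span.induct)
  case (base j A B')
  let ?P = "copy_prod r s Z j"
  have "traces 0 k (B * (A * ?P * B')) = traces 0 k ((B * A * ?P) * B')" by (simp add: mult.assoc)
  also have "\<dots> = traces 0 k (B' * (B * A * ?P))" by (rule traces_cyclic[OF base(3), symmetric])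
  also have "\<dots> = traces 0 k ((B' * B * A) * ?P)" by (simp add: mult.assoc)
  finally have "traces 0 k (B * (A * ?P * B')) = traces 0 k ((B' * B * A) * ?P)" .
  moreover obtain A' where "A' \<in> H j" "traces 0 k ((B' * B * A) * ?P) = traces 0 j (A' * ?P)"
    using traces_reduce[OF base(1), of "B' * B * A" ?P] triv_copy_prod[OF Z, of j] base B
    by (auto intro: hecke_algebra.mult)
  ultimately show ?case using W[of A' j] by simp
next
  case (add X Y)
  then show ?case by (simp add: distrib_left traces_add W_add)
qed

text \<open>The trace over the sites from 1 to \<open>k\<close> does not touch site 0, where
  \<open>Z\<close> acts. With the common \<open>A'\<close>, multiplying by \<open>Z\<close> on the
  left of one conjugate and on the right of the other gives
  \<open>A' * copy_prod r s Z (Suc k)\<close> both times, up to congruence.\<close>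

lemma traces_central:
  assumes Z: "\<And>j. 0 < j \<Longrightarrow> triv j Z" and RE: "r 0 * Z * r 0 * Z \<doteq> Z * r 0 * Z * r 0"
    and A: "A \<in> H k"
  shows "Z * traces 0 k (A * copy_prod r s Z k) \<doteq> traces 0 k (A * copy_prod r s Z k) * Z"
proof -
  let ?P = "copy_prod r s Z"
  have Z0: "at_first Z" by (rule at_first_triv[OF Z])
  obtain A' where A': "asc r k * A = A' * asc r k" "asc s k * A = A' * asc s k" "Z * A' = A' * Z"
    using H_shift[OF A] Z0 by blast
  have conj: "traces 1 k (asc r k * (A * ?P k) * desc s k) = traces 0 k (A * ?P k)"
    "traces 1 k (asc s k * (A * ?P k) * desc r k) = traces 0 k (A * ?P k)"
    using traces_conj[of k "A * ?P k"] triv_mult[OF triv_H[OF A] triv_copy_prod[OF Z]] by auto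
  have bim: "traces 1 k (Z * X) = Z * traces 1 k X" "traces 1 k (X * Z) = traces 1 k X * Z" for X
    using traces_bimodule[of 1 k Z 1 X] traces_bimodule[of 1 k 1 Z X] Z triv_one by auto
  have 1: "Z * (asc r k * (A * ?P k) * desc s k) = A' * ?P (Suc k)"
  proof -
    have "Z * (asc r k * (A * ?P k) * desc s k) = Z * (asc r k * A) * ?P k * desc s k" by (simp add: mult.assoc)
    also have "\<dots> = (Z * A') * asc r k * ?P k * desc s k" by (simp only: A'(1) mult.assoc)
    also have "\<dots> = A' * (Z * asc r k * ?P k * desc s k)" by (simp only: A'(3) mult.assoc)
    finally show ?thesis by (simp only: copy_prod_Suc[OF Z0 order_refl])
  qed
  have "asc s k * (A * ?P k) * desc r k * Z = (asc s k * A) * ?P k * desc r k * Z" by (simp add: mult.assoc)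
  also have "\<dots> = A' * (asc s k * ?P k * desc r k * Z)" by (simp only: A'(2) mult.assoc)
  also have "\<dots> \<doteq> A' * ?P (Suc k)" by (intro ceq_left copy_prod_Suc_right Z0 RE)
  finally have "traces 1 k (asc s k * (A * ?P k) * desc r k * Z) \<doteq> traces 1 k (A' * ?P (Suc k))"
    by (rule traces_ceq)
  then have "traces 0 k (A * ?P k) * Z \<doteq> Z * traces 0 k (A * ?P k)"
    unfolding bim conj 1[symmetric] .
  then show ?thesis by (rule ceq_sym)
qed

end

section \<open>Row-finite operators\<close>

text \<open>Row-finite matrices over a noncommutative ring, represented by their action on column
  vectors, which is right linear.\<close>

typedef (overloaded) ('x, 'a::ring_1) op = "{F :: ('x \<Rightarrow> 'a) \<Rightarrow> 'x \<Rightarrow> 'a.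
    (\<forall>v w. F (\<lambda>x. v x + w x) = (\<lambda>x. F v x + F w x)) \<and>
    (\<forall>v c. F (\<lambda>x. v x * c) = (\<lambda>x. F v x * c)) \<and>
    (\<forall>x. \<exists>S. finite S \<and> (\<forall>v. (\<forall>y\<in>S. v y = 0) \<longrightarrow> F v x = 0))}"
  morphisms app Op
  by (rule exI[of _ "\<lambda>_ _. 0"]) auto

setup_lifting type_definition_op

lemma app_add: "app F (\<lambda>x. v x + w x) = (\<lambda>x. app F v x + app F w x)"
  and app_mult: "app F (\<lambda>x. v x * c) = (\<lambda>x. app F v x * c)"
  and app_row_finite: "\<exists>S. finite S \<and> (\<forall>v. (\<forall>y\<in>S. v y = 0) \<longrightarrow> app F v x = 0)"
  using app[of F] by blast+

lemma op_eqI: "(\<And>v x. app F v x = app G v x) \<Longrightarrow> F = G"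
  by (rule app_inject[THEN iffD1]) (intro ext)

instantiation op :: (type, ring_1) ring_1
begin

lift_definition zero_op :: "('a, 'b) op" is "\<lambda>_ _. 0" by auto

lift_definition one_op :: "('a, 'b) op" is "\<lambda>v. v"
  by (auto intro!: exI[of _ "{_}"])

lift_definition plus_op :: "('a, 'b) op \<Rightarrow> ('a, 'b) op \<Rightarrow> ('a, 'b) op" is "\<lambda>F G v x. F v x + G v x"
proof (intro conjI allI)
  fix F G :: "('a \<Rightarrow> 'b) \<Rightarrow> 'a \<Rightarrow> 'b" and x
  assume "(\<forall>v w. F (\<lambda>x. v x + w x) = (\<lambda>x. F v x + F w x)) \<and> (\<forall>v c. F (\<lambda>x. v x * c) = (\<lambda>x. F v x * c)) \<and>
      (\<forall>x. \<exists>S. finite S \<and> (\<forall>v. (\<forall>y\<in>S. v y = 0) \<longrightarrow> F v x = 0))"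
    and "(\<forall>v w. G (\<lambda>x. v x + w x) = (\<lambda>x. G v x + G w x)) \<and> (\<forall>v c. G (\<lambda>x. v x * c) = (\<lambda>x. G v x * c)) \<and>
      (\<forall>x. \<exists>S. finite S \<and> (\<forall>v. (\<forall>y\<in>S. v y = 0) \<longrightarrow> G v x = 0))"
  then obtain S T where "finite S" "\<forall>v. (\<forall>y\<in>S. v y = 0) \<longrightarrow> F v x = 0"
    "finite T" "\<forall>v. (\<forall>y\<in>T. v y = 0) \<longrightarrow> G v x = 0" by metis
  then show "\<exists>S. finite S \<and> (\<forall>v. (\<forall>y\<in>S. v y = 0) \<longrightarrow> F v x + G v x = 0)"
    by (intro exI[of _ "S \<union> T"]) auto
qed (auto simp: fun_eq_iff distrib_right)

lift_definition uminus_op :: "('a, 'b) op \<Rightarrow> ('a, 'b) op" is "\<lambda>F v x. - F v x"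
  by (auto simp: fun_eq_iff)

lift_definition minus_op :: "('a, 'b) op \<Rightarrow> ('a, 'b) op \<Rightarrow> ('a, 'b) op" is "\<lambda>F G v x. F v x - G v x"
proof (intro conjI allI)
  fix F G :: "('a \<Rightarrow> 'b) \<Rightarrow> 'a \<Rightarrow> 'b" and x
  assume "(\<forall>v w. F (\<lambda>x. v x + w x) = (\<lambda>x. F v x + F w x)) \<and> (\<forall>v c. F (\<lambda>x. v x * c) = (\<lambda>x. F v x * c)) \<and>
      (\<forall>x. \<exists>S. finite S \<and> (\<forall>v. (\<forall>y\<in>S. v y = 0) \<longrightarrow> F v x = 0))"
    and "(\<forall>v w. G (\<lambda>x. v x + w x) = (\<lambda>x. G v x + G w x)) \<and> (\<forall>v c. G (\<lambda>x. v x * c) = (\<lambda>x. G v x * c)) \<and>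
      (\<forall>x. \<exists>S. finite S \<and> (\<forall>v. (\<forall>y\<in>S. v y = 0) \<longrightarrow> G v x = 0))"
  then obtain S T where "finite S" "\<forall>v. (\<forall>y\<in>S. v y = 0) \<longrightarrow> F v x = 0"
    "finite T" "\<forall>v. (\<forall>y\<in>T. v y = 0) \<longrightarrow> G v x = 0" by metis
  then show "\<exists>S. finite S \<and> (\<forall>v. (\<forall>y\<in>S. v y = 0) \<longrightarrow> F v x - G v x = 0)"
    by (intro exI[of _ "S \<union> T"]) auto
qed (auto simp: fun_eq_iff left_diff_distrib)

lift_definition times_op :: "('a, 'b) op \<Rightarrow> ('a, 'b) op \<Rightarrow> ('a, 'b) op" is "\<lambda>F G v. F (G v)"
proof (intro conjI allI)
  fix F G :: "('a \<Rightarrow> 'b) \<Rightarrow> 'a \<Rightarrow> 'b" and x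
  assume F: "(\<forall>v w. F (\<lambda>x. v x + w x) = (\<lambda>x. F v x + F w x)) \<and> (\<forall>v c. F (\<lambda>x. v x * c) = (\<lambda>x. F v x * c)) \<and>
      (\<forall>x. \<exists>S. finite S \<and> (\<forall>v. (\<forall>y\<in>S. v y = 0) \<longrightarrow> F v x = 0))"
    and G: "(\<forall>v w. G (\<lambda>x. v x + w x) = (\<lambda>x. G v x + G w x)) \<and> (\<forall>v c. G (\<lambda>x. v x * c) = (\<lambda>x. G v x * c)) \<and>
      (\<forall>x. \<exists>S. finite S \<and> (\<forall>v. (\<forall>y\<in>S. v y = 0) \<longrightarrow> G v x = 0))"
  obtain S where S: "finite S" "\<And>v. (\<forall>y\<in>S. v y = 0) \<Longrightarrow> F v x = 0" using F by metis
  obtain T where T: "\<And>x. finite (T x)" "\<And>x v. (\<forall>y\<in>T x. v y = 0) \<Longrightarrow> G v x = 0" using G by metis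
  show "\<exists>S. finite S \<and> (\<forall>v. (\<forall>y\<in>S. v y = 0) \<longrightarrow> F (G v) x = 0)"
    using S T by (intro exI[of _ "\<Union>y\<in>S. T y"]) auto
qed auto

instance
proof
  fix a b c :: "('a, 'b) op"
  show "a * b * c = a * (b * c)" by transfer simp
  show "a + b + c = a + (b + c)" by transfer (simp add: add.assoc)
  show "a + b = b + a" by transfer (simp add: add.commute)
  show "0 + a = a" by transfer simp
  show "- a + a = 0" by transfer simp
  show "a - b = a + - b" by transfer simp
  show "1 * a = a" by transfer simp
  show "a * 1 = a" by transfer simp
  show "(a + b) * c = a * c + b * c" by transfer simp
  show "a * (b + c) = a * b + a * c" by transfer simp
  show "(0 :: ('a, 'b) op) \<noteq> 1"
  proof transfer
    show "(\<lambda>_ _. 0) \<noteq> (\<lambda>v :: 'a \<Rightarrow> 'b. v)" by (metis zero_neq_one)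
  qed
qed

end

lemma app_simps [simp]:
  "app 0 v x = 0" "app 1 v = v" "app (F + G) v x = app F v x + app G v x"
  "app (- F) v x = - app F v x" "app (F - G) v x = app F v x - app G v x"
  "app (F * G) v = app F (app G v)"
  by (transfer; simp)+

lemma app_sum: "app (sum F A) v x = (\<Sum>i\<in>A. app (F i) v x)"
  by (induction A rule: infinite_finite_induct) auto

lemma app_zero: "app F (\<lambda>_. 0) = (\<lambda>_. 0)"
  using app_mult[of F "\<lambda>_. 0" 0] by simp

lemma app_fun_sum: "app F (\<lambda>x. \<Sum>i\<in>A. v i x) = (\<lambda>x. \<Sum>i\<in>A. app F (v i) x)"
  by (induction A rule: infinite_finite_induct) (auto simp: app_zero app_add)

definition delta :: "'x \<Rightarrow> 'x \<Rightarrow> 'a::ring_1" where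
  "delta y x = (if x = y then 1 else 0)"

definition ent :: "('x, 'a::ring_1) op \<Rightarrow> 'x \<Rightarrow> 'x \<Rightarrow> 'a" where
  "ent F x y = app F (delta y) x"

lemma app_expand: "\<exists>S. finite S \<and> (\<forall>v. app F v x = (\<Sum>y\<in>S. ent F x y * v y))"
proof -
  obtain S where S: "finite S" "\<And>v. (\<forall>y\<in>S. v y = 0) \<Longrightarrow> app F v x = 0"
    using app_row_finite by metis
  have "app F v x = (\<Sum>y\<in>S. ent F x y * v y)" for v
  proof -
    \<comment> \<open>The part of \<open>v\<close> that row \<open>x\<close> sees; the remainder
      vanishes on \<open>S\<close> and contributes nothing.\<close>
    define w where "w = (\<lambda>x. \<Sum>y\<in>S. delta y x * v y)"
    have w: "w y = v y" if "y \<in> S" for y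
    proof -
      have "w y = (\<Sum>z\<in>S. if z = y then v z else 0)"
        unfolding w_def by (intro sum.cong refl) (auto simp: delta_def)
      then show ?thesis using that S(1) by simp
    qed
    have "v = (\<lambda>x. w x + (v x - w x))" by simp
    then have "app F v x = app F w x + app F (\<lambda>x. v x - w x) x"
      using app_add[of F w "\<lambda>x. v x - w x"] by metis
    also have "app F (\<lambda>x. v x - w x) x = 0" using S(2) w by simp
    finally show ?thesis by (simp add: w_def app_fun_sum app_mult ent_def)
  qed
  then show ?thesis using S(1) by blast
qed

text \<open>The finite index set is read off from row \<open>x\<close> of \<open>F\<close> alone,
  hence is uniform in \<open>G\<close> and in the column.\<close>

lemma ent_mult: "\<exists>S. finite S \<and> (\<forall>G y. ent (F * G) x y = (\<Sum>z\<in>S. ent F x z * ent G z y))"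
  using app_expand[of F x] by (auto simp: ent_def)

lemma ent_simps:
  "ent 0 x y = 0" "ent 1 x y = delta y x" "ent (F + G) x y = ent F x y + ent G x y"
  "ent (F - G) x y = ent F x y - ent G x y"
  by (simp_all add: ent_def)

lemma ent_sum: "ent (sum F A) x y = (\<Sum>i\<in>A. ent (F i) x y)"
  by (simp add: ent_def app_sum)

lift_definition lmul :: "'a::ring_1 \<Rightarrow> ('x, 'a) op" is "\<lambda>c v x. c * v x"
proof (intro conjI allI)
  fix c :: 'a and x :: 'x
  show "\<exists>S. finite S \<and> (\<forall>v. (\<forall>y\<in>S. v y = 0) \<longrightarrow> c * v x = 0)" by (rule exI[of _ "{x}"]) simp
qed (simp_all add: distrib_left mult.assoc)

lemma app_lmul [simp]: "app (lmul c) v x = c * v x"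
  by transfer simp

lemma lmul_add: "lmul (c + d) = lmul c + lmul d" and lmul_mult: "lmul (c * d) = lmul c * lmul d"
  and lmul_one: "lmul 1 = 1" and lmul_diff: "lmul (c - d) = lmul c - lmul d"
  by (rule op_eqI; simp add: distrib_right mult.assoc left_diff_distrib)+

lemma ent_lmul: "ent (lmul c) x x = c"
  by (simp add: ent_def delta_def)

definition entries_in :: "'a::ring_1 set \<Rightarrow> ('x, 'a) op set" where
  "entries_in S = {F. \<forall>x y. ent F x y \<in> S}"

text \<open>An entry of a product is a finite sum, since rows are finite, so membership of the
  entries survives multiplication on either side.\<close>

lemma entries_in_ideal:
  assumes "ring_ideal S" shows "ring_ideal (entries_in S :: ('x, 'a::ring_1) op set)"
proof -
  interpret ring_ideal S by (rule assms)
  have sum_mem: "sum g A \<in> S" if "\<And>i. i \<in> A \<Longrightarrow> g i \<in> S" for g :: "'x \<Rightarrow> 'a" and A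
    using that by (induction A rule: infinite_finite_induct) (auto simp: zero_mem plus_mem)
  show ?thesis
  proof
    show "(0 :: ('x, 'a) op) \<in> entries_in S" by (simp add: entries_in_def ent_simps zero_mem)
  next
    fix a b x :: "('x, 'a) op"
    assume a: "a \<in> entries_in S"
    show "a - b \<in> entries_in S" if "b \<in> entries_in S"
      using a that by (simp add: entries_in_def ent_simps diff_mem)
    show "x * a \<in> entries_in S"
      unfolding entries_in_def
    proof safe
      fix u v
      obtain T where "\<forall>G y. ent (x * G) u y = (\<Sum>z\<in>T. ent x u z * ent G z y)" using ent_mult[of x u] by blast
      then show "ent (x * a) u v \<in> S" using a by (auto simp: entries_in_def intro!: sum_mem mult_left_mem)
    qed
    show "a * x \<in> entries_in S"
      unfolding entries_in_def
    proof safe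
      fix u v
      obtain T where "\<forall>G y. ent (a * G) u y = (\<Sum>z\<in>T. ent a u z * ent G z y)" using ent_mult[of a u] by blast
      then show "ent (a * x) u v \<in> S" using a by (auto simp: entries_in_def intro!: sum_mem mult_right_mem)
    qed
  qed
qed

section \<open>Operators on tensor powers\<close>

lemma fconst_simps:
  "fconst (c + d) = fconst c + fconst d" "fconst (c * d) = fconst c * fconst d" "fconst 1 = 1"
  "fconst 0 = 0" "fconst (c - d) = fconst c - fconst d" "fconst (- c) = - fconst c"
  by (simp_all add: fconst_def single_add mult_single single_diff single_uminus)

lemma poly_mapping_sum_single:
  fixes x :: "'a \<Rightarrow>\<^sub>0 'b::comm_monoid_add"
  shows "x = (\<Sum>w\<in>Poly_Mapping.keys x. Poly_Mapping.single w (Poly_Mapping.lookup x w))"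
proof (rule poly_mapping_eqI)
  fix u
  have "Poly_Mapping.lookup (\<Sum>w\<in>Poly_Mapping.keys x. Poly_Mapping.single w (Poly_Mapping.lookup x w)) u
    = (\<Sum>w\<in>Poly_Mapping.keys x. if w = u then Poly_Mapping.lookup x u else 0)"
    unfolding lookup_sum by (intro sum.cong refl) (auto simp: lookup_single when_def)
  also have "\<dots> = Poly_Mapping.lookup x u"
    by (simp add: in_keys_iff)
  finally show "Poly_Mapping.lookup x u
    = Poly_Mapping.lookup (\<Sum>w\<in>Poly_Mapping.keys x. Poly_Mapping.single w (Poly_Mapping.lookup x w)) u" by simp
qed

lemma poly_mapping_additive_induct:
  fixes x :: "'a \<Rightarrow>\<^sub>0 'b::comm_monoid_add"
  assumes "\<And>w c. P (Poly_Mapping.single w c)" "\<And>x y. P x \<Longrightarrow> P y \<Longrightarrow> P (x + y)"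
  shows "P x"
proof -
  have "P (\<Sum>w\<in>A. Poly_Mapping.single w (Poly_Mapping.lookup x w))" for A
    using assms(1)[of _ 0] by (induction A rule: infinite_finite_induct) (auto intro: assms)
  then show ?thesis by (subst poly_mapping_sum_single)
qed

lemma fconst_commute: "fconst c * x = x * fconst c"
  by (induction x rule: poly_mapping_additive_induct)
    (simp_all add: fconst_def mult_single mult.commute distrib_left distrib_right)

type_synonym ('n, 'g) tensor_op = "(nat \<Rightarrow> 'n, 'g falg) op"

definition sc :: "complex \<Rightarrow> ('x, 'g falg) op" where
  "sc c = lmul (fconst c)"

lemma app_sc [simp]: "app (sc c) v x = fconst c * v x"
  by (simp add: sc_def)

interpretation op: central_scalars "sc :: complex \<Rightarrow> ('x, 'g falg) op"
proof
  fix c d and F :: "('x, 'g falg) op"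
  show "sc (c + d) = (sc c + sc d :: ('x, 'g falg) op)" "sc (c * d) = (sc c * sc d :: ('x, 'g falg) op)"
    "sc 1 = (1 :: ('x, 'g falg) op)"
    by (simp_all add: sc_def fconst_simps lmul_add lmul_mult lmul_one)
  show "sc c * F = F * sc c"
  proof (rule op_eqI)
    fix v :: "'x \<Rightarrow> 'g falg" and x
    \<comment> \<open>A constant commutes with the free algebra, so it may be moved to the right,
      where operators are linear.\<close>
    have e: "app (sc c) v = (\<lambda>x. v x * fconst c)"
      by (rule ext) (simp only: app_sc fconst_commute)
    have "app (sc c * F) v x = app F v x * fconst c"
      by (simp only: app_simps app_sc fconst_commute)
    also have "\<dots> = app (F * sc c) v x" by (simp only: app_simps e app_mult)
    finally show "app (sc c * F) v x = app (F * sc c) v x" .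
  qed
qed

lift_definition tunit :: "nat \<Rightarrow> 'n \<Rightarrow> 'n \<Rightarrow> (nat \<Rightarrow> 'n, 'a::ring_1) op" is
  "\<lambda>j a b v x. if x j = a then v (x(j := b)) else 0"
proof (intro conjI allI)
  fix j :: nat and a b :: 'n and x :: "nat \<Rightarrow> 'n"
  show "\<exists>S. finite S \<and> (\<forall>v. (\<forall>y\<in>S. v y = 0) \<longrightarrow> (if x j = a then v (x(j := b)) else 0) = (0 :: 'a))"
    by (rule exI[of _ "{x(j := b)}"]) simp
qed (auto simp: fun_eq_iff)

lemma app_tunit [simp]: "app (tunit j a b) v x = (if x j = a then v (x(j := b)) else 0)"
  by transfer simp

lemma tunit_mult: "tunit j a b * tunit j c d = (if b = c then tunit j a d else 0)"
  by (rule op_eqI) auto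

lemma tunit_sum: "(\<Sum>a\<in>UNIV. tunit j a a) = (1 :: (nat \<Rightarrow> 'n::finite, 'a::ring_1) op)"
proof (rule op_eqI)
  fix v :: "(nat \<Rightarrow> 'n) \<Rightarrow> 'a" and x
  have "app (\<Sum>a\<in>UNIV. tunit j a a) v x = (\<Sum>a\<in>UNIV. if a = x j then v (x(j := a)) else 0)"
    unfolding app_sum by (intro sum.cong refl) auto
  then show "app (\<Sum>a\<in>UNIV. tunit j a a) v x = app 1 v x" by simp
qed

lemma tunit_commute: "i \<noteq> j \<Longrightarrow> tunit i a b * tunit j c d = tunit j c d * tunit i a b"
  by (rule op_eqI) (auto simp: fun_upd_twist)

lemma tunit_lmul: "tunit j a b * lmul c = lmul c * tunit j a b"
  by (rule op_eqI) auto

section \<open>Finite matrices acting on consecutive sites\<close>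

definition get_slice :: "(nat \<Rightarrow> 'n) \<Rightarrow> nat \<Rightarrow> nat \<Rightarrow> 'n list" where
  "get_slice x m k = map x [m..<m + k]"

definition put_slice :: "(nat \<Rightarrow> 'n) \<Rightarrow> nat \<Rightarrow> 'n list \<Rightarrow> nat \<Rightarrow> 'n" where
  "put_slice x m b = (\<lambda>i. if m \<le> i \<and> i < m + length b then b ! (i - m) else x i)"

lemma slice_idx [simp]: "get_slice x m k \<in> idx k"
  by (simp add: get_slice_def idx_def)

lemma slice_nth: "i < k \<Longrightarrow> get_slice x m k ! i = x (m + i)"
  by (simp add: get_slice_def)

lemma slice_splice [simp]: "b \<in> idx k \<Longrightarrow> get_slice (put_slice x m b) m k = b"
  by (rule nth_equalityI) (auto simp: get_slice_def put_slice_def idx_def)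

lemma splice_slice [simp]: "put_slice x m (get_slice x m k) = x"
  by (auto simp: get_slice_def put_slice_def fun_eq_iff)

lemma splice_splice [simp]: "b \<in> idx k \<Longrightarrow> c \<in> idx k \<Longrightarrow> put_slice (put_slice x m b) m c = put_slice x m c"
  by (auto simp: put_slice_def fun_eq_iff idx_def)

lemma finite_idx [simp]: "finite (idx k :: 'n::finite list set)"
  using finite_lists_length_eq[of "UNIV :: 'n set" k] by (simp add: idx_def)

text \<open>The algebra homomorphism that lets a matrix on \<open>k\<close> factors act on the sites
  from \<open>m\<close> to \<open>m + k - 1\<close>. It sees only lists of length \<open>k\<close>,
  so equality in the sense of \<open>teq\<close> is enough.\<close>

lift_definition emb :: "nat \<Rightarrow> nat \<Rightarrow> ('n::finite, 'a::ring_1) tmat \<Rightarrow> (nat \<Rightarrow> 'n, 'a) op" is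
  "\<lambda>m k X v x. \<Sum>b\<in>idx k. X (get_slice x m k) b * v (put_slice x m b)"
proof (intro conjI allI)
  fix m k :: nat and X :: "('n, 'a) tmat" and x :: "nat \<Rightarrow> 'n"
  show "\<exists>S. finite S \<and> (\<forall>v. (\<forall>y\<in>S. v y = 0) \<longrightarrow>
      (\<Sum>b\<in>idx k. X (get_slice x m k) b * v (put_slice x m b)) = (0 :: 'a))"
    by (rule exI[of _ "put_slice x m ` idx k"]) auto
qed (auto simp: fun_eq_iff distrib_left sum.distrib sum_distrib_right mult.assoc)

lemma app_emb: "app (emb m k X) v x = (\<Sum>b\<in>idx k. X (get_slice x m k) b * v (put_slice x m b))"
  by transfer simp

lemma emb_mult: "emb m k (tmult k X Y) = emb m k X * emb m k Y"
proof (rule op_eqI)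
  fix v x
  have "app (emb m k (tmult k X Y)) v x
    = (\<Sum>b\<in>idx k. \<Sum>c\<in>idx k. X (get_slice x m k) c * (Y c b * v (put_slice x m b)))"
    by (simp add: app_emb tmult_def sum_distrib_right mult.assoc)
  also have "\<dots> = (\<Sum>c\<in>idx k. \<Sum>b\<in>idx k. X (get_slice x m k) c * (Y c b * v (put_slice x m b)))"
    by (rule sum.swap)
  also have "\<dots> = app (emb m k X * emb m k Y) v x"
    by (simp add: app_emb sum_distrib_left)
  finally show "app (emb m k (tmult k X Y)) v x = app (emb m k X * emb m k Y) v x" .
qed

lemma emb_tid: "emb m k tid = 1"
proof (rule op_eqI)
  fix v x
  have "app (emb m k tid) v x = (\<Sum>b\<in>idx k. if get_slice x m k = b then v (put_slice x m b) else 0)"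
    unfolding app_emb tid_def by (intro sum.cong refl) simp
  then show "app (emb m k tid) v x = app 1 v x" by simp
qed

lemma emb_tprod: "emb m k (tprod k As) = prod_list (map (emb m k) As)"
  by (induction As) (simp_all add: tprod_def emb_tid emb_mult)

lemma emb_cong: "teq k X Y \<Longrightarrow> emb m k X = emb m k Y"
  by (rule op_eqI) (simp add: app_emb teq_def)

lemma emb_add: "emb m k (\<lambda>a b. X a b + Y a b) = emb m k X + emb m k Y"
  by (rule op_eqI) (simp add: app_emb distrib_right sum.distrib)

lemma emb_diff: "emb m k (\<lambda>a b. X a b - Y a b) = emb m k X - emb m k Y"
  by (rule op_eqI) (simp add: app_emb left_diff_distrib sum_subtractf)

lemma emb_scale: "emb m k (\<lambda>a b. c * X a b) = lmul c * emb m k X"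
  by (rule op_eqI) (simp add: app_emb mult.assoc sum_distrib_left)

lemma ent_emb: "ent (emb m k X) x y = (if put_slice x m (get_slice y m k) = y then X (get_slice x m k) (get_slice y m k) else 0)"
proof -
  have "ent (emb m k X) x y = (\<Sum>b\<in>idx k. if get_slice y m k = b
      then (if put_slice x m (get_slice y m k) = y then X (get_slice x m k) (get_slice y m k) else 0) else 0)"
    unfolding ent_def app_emb by (intro sum.cong refl) (auto simp: delta_def)
  then show ?thesis by simp
qed

definition at1 :: "nat \<Rightarrow> ('n::finite \<Rightarrow> 'n \<Rightarrow> 'a::ring_1) \<Rightarrow> (nat \<Rightarrow> 'n, 'a) op" where
  "at1 j X = (\<Sum>a\<in>UNIV. \<Sum>b\<in>UNIV. lmul (X a b) * tunit j a b)"

definition at2 :: "nat \<Rightarrow> 'n::finite rmat \<Rightarrow> ('n, 'g) tensor_op" where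
  "at2 i A = (\<Sum>P\<in>UNIV. \<Sum>Q\<in>UNIV. sc (A $ P $ Q) * (tunit i (fst P) (fst Q) * tunit (Suc i) (snd P) (snd Q)))"

lemma app_at1: "app (at1 j X) v x = (\<Sum>b\<in>UNIV. X (x j) b * v (x(j := b)))"
proof -
  have "app (at1 j X) v x = (\<Sum>a\<in>UNIV. \<Sum>b\<in>UNIV. if x j = a then X a b * v (x(j := b)) else 0)"
    unfolding at1_def app_sum by (intro sum.cong refl) simp
  then show ?thesis by (subst (asm) sum.swap) simp
qed

lemma app_at2: "app (at2 i A) v x = (\<Sum>Q\<in>UNIV. fconst (A $ (x i, x (Suc i)) $ Q) * v (x(i := fst Q, Suc i := snd Q)))"
proof -
  have "app (at2 i A) v x = (\<Sum>P\<in>UNIV. \<Sum>Q\<in>UNIV.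
      if P = (x i, x (Suc i)) then fconst (A $ P $ Q) * v (x(i := fst Q, Suc i := snd Q)) else 0)"
    unfolding at2_def app_sum by (intro sum.cong refl) (auto simp: prod_eq_iff)
  then show ?thesis by (subst (asm) sum.swap) simp
qed

lemma splice_slice_update: "i < k \<Longrightarrow> put_slice x m ((get_slice x m k)[i := c]) = x(m + i := c)"
  by (auto simp: put_slice_def get_slice_def fun_eq_iff nth_list_update)

lemma splice_slice_update2:
  "Suc i < k \<Longrightarrow> put_slice x m ((get_slice x m k)[i := c, Suc i := d]) = x(m + i := c, Suc (m + i) := d)"
  by (auto simp: put_slice_def get_slice_def fun_eq_iff nth_list_update)

lemma take_drop_eq_update:
  "i < length a \<Longrightarrow> length b = length a \<Longrightarrow> take i a = take i b \<and> drop (Suc i) a = drop (Suc i) b \<longleftrightarrow> b = a[i := b ! i]"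
  by (metis id_take_nth_drop length_list_update nth_list_update_eq upd_conv_take_nth_drop
      take_update_cancel drop_update_cancel lessI order_refl)

lemma take_drop_eq_update2:
  assumes "Suc i < length a" "length b = length a"
  shows "take i a = take i b \<and> drop (Suc (Suc i)) a = drop (Suc (Suc i)) b \<longleftrightarrow> b = a[i := b ! i, Suc i := b ! Suc i]"
proof
  assume *: "take i a = take i b \<and> drop (Suc (Suc i)) a = drop (Suc (Suc i)) b"
  show "b = a[i := b ! i, Suc i := b ! Suc i]"
  proof (rule nth_equalityI)
    fix j assume j: "j < length b"
    consider "j < i" | "j = i" | "j = Suc i" | "Suc (Suc i) \<le> j" by linarith
    then show "b ! j = a[i := b ! i, Suc i := b ! Suc i] ! j"
    proof cases
      case 1
      then show ?thesis using * by (metis nth_take nth_list_update_neq less_SucI nat_neq_iff)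
    next
      case 4
      then have "drop (Suc (Suc i)) a ! (j - Suc (Suc i)) = drop (Suc (Suc i)) b ! (j - Suc (Suc i))" using * by simp
      moreover have "Suc (Suc (j - 2)) = j" using 4 by simp
      ultimately show ?thesis using 4 j assms by simp
    qed (use assms in simp_all)
  qed (use assms in simp)
next
  assume *: "b = a[i := b ! i, Suc i := b ! Suc i]"
  show "take i a = take i b \<and> drop (Suc (Suc i)) a = drop (Suc (Suc i)) b"
    by (subst (1 2) *) simp
qed

text \<open>Tensor factors count from 1 and sites from 0, hence the subtraction of 1.\<close>

lemma emb_at_site:
  fixes X :: "'n::finite \<Rightarrow> 'n \<Rightarrow> 'a::ring_1"
  assumes "1 \<le> i" "i \<le> k" shows "emb m k (at_site i X) = at1 (m + i - 1) X"
proof (rule op_eqI)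
  fix v and x :: "nat \<Rightarrow> 'n"
  let ?a = "get_slice x m k"
  obtain i' where i: "i = Suc i'" "i' < k" using assms by (cases i) auto
  have len: "length ?a = k" by (simp add: get_slice_def)
  have "app (emb m k (at_site i X)) v x
    = (\<Sum>b\<in>idx k. if b = ?a[i' := b ! i'] then X (?a ! i') (b ! i') * v (put_slice x m b) else 0)"
    unfolding app_emb at_site_def
    by (intro sum.cong refl) (use i len in \<open>simp add: take_drop_eq_update idx_def\<close>)
  also have "\<dots> = (\<Sum>b\<in>{b \<in> idx k. b = ?a[i' := b ! i']}. X (?a ! i') (b ! i') * v (put_slice x m b))"
    by (simp add: sum.If_cases Int_def)
  also have "\<dots> = (\<Sum>c\<in>UNIV. X (?a ! i') c * v (put_slice x m (?a[i' := c])))"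
    by (rule sum.reindex_bij_witness[of _ "\<lambda>c. ?a[i' := c]" "\<lambda>b. b ! i'"])
      (use i len in \<open>auto simp: idx_def\<close>)
  also have "\<dots> = app (at1 (m + i - 1) X) v x"
    using i by (simp add: app_at1 slice_nth splice_slice_update)
  finally show "app (emb m k (at_site i X)) v x = app (at1 (m + i - 1) X) v x" .
qed

lemma emb_at_pair:
  fixes A :: "'n::finite rmat"
  assumes "1 \<le> i" "i < k" shows "emb m k (scal (at_pair i A)) = at2 (m + i - 1) A"
proof (rule op_eqI)
  fix v and x :: "nat \<Rightarrow> 'n"
  let ?a = "get_slice x m k"
  obtain i' where i: "i = Suc i'" "Suc i' < k" using assms by (cases i) auto
  have len: "length ?a = k" by (simp add: get_slice_def)
  have "app (emb m k (scal (at_pair i A))) v x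
    = (\<Sum>b\<in>idx k. if b = ?a[i' := b ! i', Suc i' := b ! Suc i']
        then fconst (A $ (?a ! i', ?a ! Suc i') $ (b ! i', b ! Suc i')) * v (put_slice x m b) else 0)"
    unfolding app_emb at_pair_def scal_def
    by (intro sum.cong refl) (use i len in \<open>simp add: take_drop_eq_update2 idx_def fconst_simps\<close>)
  also have "\<dots> = (\<Sum>b\<in>{b \<in> idx k. b = ?a[i' := b ! i', Suc i' := b ! Suc i']}.
      fconst (A $ (?a ! i', ?a ! Suc i') $ (b ! i', b ! Suc i')) * v (put_slice x m b))"
    by (simp add: sum.If_cases Int_def)
  also have "\<dots> = (\<Sum>Q\<in>UNIV. fconst (A $ (?a ! i', ?a ! Suc i') $ Q) * v (put_slice x m (?a[i' := fst Q, Suc i' := snd Q])))"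
    by (rule sum.reindex_bij_witness[of _ "\<lambda>Q. ?a[i' := fst Q, Suc i' := snd Q]" "\<lambda>b. (b ! i', b ! Suc i')"])
      (use i len in \<open>auto simp: idx_def\<close>)
  also have "\<dots> = app (at2 (m + i - 1) A) v x"
    using i by (simp add: app_at2 slice_nth splice_slice_update2)
  finally show "app (emb m k (scal (at_pair i A))) v x = app (at2 (m + i - 1) A) v x" .
qed

section \<open>The skew inverse and the trace weights\<close>

lemma sum_swap22:
  "(\<Sum>a\<in>A. \<Sum>b\<in>B. \<Sum>c\<in>C. \<Sum>d\<in>D. g a b c d) = (\<Sum>c\<in>C. \<Sum>d\<in>D. \<Sum>a\<in>A. \<Sum>b\<in>B. g a b c d)"
proof -
  have "(\<Sum>a\<in>A. \<Sum>b\<in>B. \<Sum>c\<in>C. \<Sum>d\<in>D. g a b c d) = (\<Sum>a\<in>A. \<Sum>c\<in>C. \<Sum>d\<in>D. \<Sum>b\<in>B. g a b c d)"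
    by (rule sum.cong[OF refl], subst sum.swap, intro sum.cong refl sum.swap)
  also have "\<dots> = (\<Sum>c\<in>C. \<Sum>d\<in>D. \<Sum>a\<in>A. \<Sum>b\<in>B. g a b c d)"
    by (subst sum.swap, intro sum.cong refl sum.swap)
  finally show ?thesis .
qed

text \<open>An exchange relation \<open>S T T = T T S\<close> passes to the skew inverse \<open>U\<close> of \<open>T\<close>, with the
  factors reversed.\<close>

lemma exchange_skew_inverse:
  fixes T U :: "'n::finite \<Rightarrow> 'n \<Rightarrow> 'a::ring_1" and S :: "'n \<Rightarrow> 'n \<Rightarrow> 'n \<Rightarrow> 'n \<Rightarrow> 'a"
  assumes exchange: "\<And>x y c d. (\<Sum>a\<in>UNIV. \<Sum>b\<in>UNIV. S x y a b * (T a c * T b d)) =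
      (\<Sum>a\<in>UNIV. \<Sum>b\<in>UNIV. S a b c d * (T x a * T y b))"
    and central: "\<And>x y a b z. z * S x y a b = S x y a b * z"
    and TU: "\<And>x y. (\<Sum>t\<in>UNIV. T t y * U x t) = (if x = y then 1 else 0)"
    and UT: "\<And>x y. (\<Sum>t\<in>UNIV. U t y * T x t) = (if x = y then 1 else 0)"
  shows "(\<Sum>x\<in>UNIV. \<Sum>y\<in>UNIV. S x y c d * (U b y * U a x)) =
      (\<Sum>x\<in>UNIV. \<Sum>y\<in>UNIV. S a b x y * (U y d * U x c))"
proof -
  have cent: "z * (S x y a b * w) = S x y a b * (z * w)" for x y a b z w
    by (metis central mult.assoc)
  \<comment> \<open>The plan is to evaluate this expression in two ways: by contracting each
    \<open>T\<close> with a \<open>U\<close>, which leaves \<open>S\<close>, and by the exchange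
    relation followed by contraction with two more factors \<open>U\<close> from the left.\<close>
  define L where "L y1 y2 = (\<Sum>x\<in>UNIV. \<Sum>y\<in>UNIV. (\<Sum>u\<in>UNIV. \<Sum>v\<in>UNIV. S u v y1 y2 * (T x u * T y v)) * (U b y * U a x))" for y1 y2
  have A: "L y1 y2 = S a b y1 y2" for y1 y2
  proof -
    have "L y1 y2 = (\<Sum>x\<in>UNIV. \<Sum>y\<in>UNIV. \<Sum>u\<in>UNIV. \<Sum>v\<in>UNIV. S u v y1 y2 * (T x u * (T y v * U b y) * U a x))"
      unfolding L_def by (simp add: sum_distrib_right mult.assoc)
    also have "\<dots> = (\<Sum>u\<in>UNIV. \<Sum>v\<in>UNIV. \<Sum>x\<in>UNIV. \<Sum>y\<in>UNIV. S u v y1 y2 * (T x u * (T y v * U b y) * U a x))"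
      by (rule sum_swap22)
    also have "\<dots> = (\<Sum>u\<in>UNIV. \<Sum>v\<in>UNIV. S u v y1 y2 * (\<Sum>x\<in>UNIV. T x u * (\<Sum>y\<in>UNIV. T y v * U b y) * U a x))"
      by (simp add: sum_distrib_left sum_distrib_right)
    also have "\<dots> = (\<Sum>u\<in>UNIV. \<Sum>v\<in>UNIV. if v = b then S u v y1 y2 * (\<Sum>x\<in>UNIV. T x u * U a x) else 0)"
      by (intro sum.cong refl) (auto simp: TU)
    also have "\<dots> = (\<Sum>u\<in>UNIV. S u b y1 y2 * (\<Sum>x\<in>UNIV. T x u * U a x))" by simp
    also have "\<dots> = (\<Sum>u\<in>UNIV. if u = a then S u b y1 y2 else 0)"
      by (intro sum.cong refl) (auto simp: TU)
    finally show ?thesis by simp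
  qed
  have "(\<Sum>x\<in>UNIV. \<Sum>y\<in>UNIV. S a b x y * (U y d * U x c)) = (\<Sum>x\<in>UNIV. \<Sum>y\<in>UNIV. U y d * U x c * L x y)"
    unfolding A central[of "_ * _"] ..
  also have "\<dots> = (\<Sum>y1\<in>UNIV. \<Sum>y2\<in>UNIV. \<Sum>x\<in>UNIV. \<Sum>y\<in>UNIV. \<Sum>u\<in>UNIV. \<Sum>v\<in>UNIV.
      S x y u v * (U y2 d * (U y1 c * T u y1) * T v y2 * (U b y * U a x)))"
    unfolding L_def exchange[symmetric] sum_distrib_left sum_distrib_right
    by (intro sum.cong refl) (simp add: cent[of "U _ _"] mult.assoc)
  also have "\<dots> = (\<Sum>x\<in>UNIV. \<Sum>y\<in>UNIV. \<Sum>y1\<in>UNIV. \<Sum>y2\<in>UNIV. \<Sum>u\<in>UNIV. \<Sum>v\<in>UNIV.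
      S x y u v * (U y2 d * (U y1 c * T u y1) * T v y2 * (U b y * U a x)))"
    by (rule sum_swap22)
  also have "\<dots> = (\<Sum>x\<in>UNIV. \<Sum>y\<in>UNIV. \<Sum>u\<in>UNIV. \<Sum>v\<in>UNIV. \<Sum>y2\<in>UNIV. \<Sum>y1\<in>UNIV.
      S x y u v * (U y2 d * (U y1 c * T u y1) * T v y2 * (U b y * U a x)))"
  proof (rule sum.cong[OF refl], rule sum.cong[OF refl])
    fix x y
    show "(\<Sum>y1\<in>UNIV. \<Sum>y2\<in>UNIV. \<Sum>u\<in>UNIV. \<Sum>v\<in>UNIV. S x y u v * (U y2 d * (U y1 c * T u y1) * T v y2 * (U b y * U a x)))
      = (\<Sum>u\<in>UNIV. \<Sum>v\<in>UNIV. \<Sum>y2\<in>UNIV. \<Sum>y1\<in>UNIV. S x y u v * (U y2 d * (U y1 c * T u y1) * T v y2 * (U b y * U a x)))"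
      by (subst sum.swap) (rule sum_swap22)
  qed
  also have "\<dots> = (\<Sum>x\<in>UNIV. \<Sum>y\<in>UNIV. \<Sum>u\<in>UNIV. \<Sum>v\<in>UNIV.
      S x y u v * ((\<Sum>y2\<in>UNIV. U y2 d * (\<Sum>y1\<in>UNIV. U y1 c * T u y1) * T v y2) * (U b y * U a x)))"
    unfolding sum_distrib_left sum_distrib_right ..
  also have "\<dots> = (\<Sum>x\<in>UNIV. \<Sum>y\<in>UNIV. \<Sum>u\<in>UNIV. \<Sum>v\<in>UNIV.
      if u = c then S x y u v * ((\<Sum>y2\<in>UNIV. U y2 d * T v y2) * (U b y * U a x)) else 0)"
    by (intro sum.cong refl) (auto simp: UT)
  also have "\<dots> = (\<Sum>x\<in>UNIV. \<Sum>y\<in>UNIV. \<Sum>v\<in>UNIV. \<Sum>u\<in>UNIV.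
      if u = c then S x y u v * ((\<Sum>y2\<in>UNIV. U y2 d * T v y2) * (U b y * U a x)) else 0)"
    by (rule sum.cong[OF refl], rule sum.cong[OF refl], rule sum.swap)
  also have "\<dots> = (\<Sum>x\<in>UNIV. \<Sum>y\<in>UNIV. \<Sum>v\<in>UNIV. S x y c v * ((\<Sum>y2\<in>UNIV. U y2 d * T v y2) * (U b y * U a x)))"
    by simp
  also have "\<dots> = (\<Sum>x\<in>UNIV. \<Sum>y\<in>UNIV. \<Sum>v\<in>UNIV. if v = d then S x y c v * (U b y * U a x) else 0)"
    by (intro sum.cong refl) (auto simp: UT)
  finally show ?thesis by simp
qed

text \<open>Complex matrices as elements of a \<open>ring_1\<close>. The two indices of a braiding
  that do not take part in an exchange can so be hidden in the coefficient ring.\<close>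

lift_definition mop :: "('x::finite \<Rightarrow> 'x \<Rightarrow> complex) \<Rightarrow> ('x, complex) op" is
  "\<lambda>f v x. \<Sum>y\<in>UNIV. f x y * v y"
proof (intro conjI allI)
  fix f :: "'x \<Rightarrow> 'x \<Rightarrow> complex" and x
  show "\<exists>S. finite S \<and> (\<forall>v. (\<forall>y\<in>S. v y = 0) \<longrightarrow> (\<Sum>y\<in>UNIV. f x y * v y) = 0)"
    by (rule exI[of _ UNIV]) simp
qed (simp_all add: fun_eq_iff distrib_left sum.distrib sum_distrib_right mult.assoc)

lemma app_mop: "app (mop f) v x = (\<Sum>y\<in>UNIV. f x y * v y)"
  by transfer simp

lemma mop_mult: "mop f * mop g = mop (\<lambda>x y. \<Sum>z\<in>UNIV. f x z * g z y)"
proof (rule op_eqI)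
  fix v x
  have "app (mop f * mop g) v x = (\<Sum>z\<in>UNIV. \<Sum>y\<in>UNIV. f x z * g z y * v y)"
    by (simp add: app_mop sum_distrib_left mult.assoc)
  also have "\<dots> = (\<Sum>y\<in>UNIV. \<Sum>z\<in>UNIV. f x z * g z y * v y)" by (rule sum.swap)
  finally show "app (mop f * mop g) v x = app (mop (\<lambda>x y. \<Sum>z\<in>UNIV. f x z * g z y)) v x"
    by (simp add: app_mop sum_distrib_right)
qed

lemma mop_sum: "(\<Sum>i\<in>I. mop (f i)) = mop (\<lambda>x y. \<Sum>i\<in>I. f i x y)"
proof (rule op_eqI)
  fix v x
  show "app (\<Sum>i\<in>I. mop (f i)) v x = app (mop (\<lambda>x y. \<Sum>i\<in>I. f i x y)) v x"
    unfolding app_sum app_mop sum_distrib_right by (rule sum.swap)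
qed

lemma lmul_mop: "lmul c * mop f = mop (\<lambda>x y. c * f x y)"
  by (rule op_eqI) (simp add: app_mop sum_distrib_left mult.assoc)

lemma mop_inject: "mop f = mop g \<Longrightarrow> f x y = g x y"
proof -
  have "app (mop f) (delta y) x = f x y" for f
    unfolding app_mop delta_def by (simp add: if_distrib[of "(*) _"] cong: if_cong)
  then show "mop f = mop g \<Longrightarrow> f x y = g x y" by metis
qed

lemma mop_one: "mop (\<lambda>x y. if x = y then 1 else 0) = 1"
  by (rule op_eqI) (simp add: app_mop if_distrib[of "\<lambda>t. t * _"] cong: if_cong)

lemma mop_zero: "mop (\<lambda>x y. 0) = 0"
  by (rule op_eqI) (simp add: app_mop)

lemma lmul_complex_central: "F * lmul c = lmul c * F" for c :: complex and F :: "('x, complex) op"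
proof (rule op_eqI)
  fix v :: "'x \<Rightarrow> complex" and x
  have "app (lmul c) v = (\<lambda>x. v x * c)" by (rule ext) (simp add: mult.commute)
  then have "app (F * lmul c) v x = app F v x * c" by (simp add: app_mult)
  then show "app (F * lmul c) v x = app (lmul c * F) v x" by (simp add: mult.commute)
qed

text \<open>The \<open>exchange\<close> hypotheses are the two ways of moving one factor \<open>\<sigma>\<close> of the braid relation to
  the other side.\<close>

locale skew_braiding =
  fixes \<rho> \<sigma> \<psi> :: "'n::finite \<times> 'n \<Rightarrow> 'n \<times> 'n \<Rightarrow> complex"
  assumes \<rho>\<sigma>: "(\<Sum>U\<in>UNIV. \<rho> P U * \<sigma> U Q) = (if P = Q then 1 else 0)"
    and \<sigma>\<rho>: "(\<Sum>U\<in>UNIV. \<sigma> P U * \<rho> U Q) = (if P = Q then 1 else 0)"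
    and skew1: "(\<Sum>t\<in>UNIV. \<Sum>z\<in>UNIV. \<rho> (x, t) (y, z) * \<psi> (z, u) (t, w)) = (if x = w \<and> u = y then 1 else 0)"
    and skew2: "(\<Sum>t\<in>UNIV. \<Sum>z\<in>UNIV. \<psi> (x, t) (y, z) * \<rho> (z, u) (t, w)) = (if x = w \<and> u = y then 1 else 0)"
    and exchange1: "(\<Sum>a\<in>UNIV. \<Sum>b\<in>UNIV. \<Sum>c\<in>UNIV. \<sigma> (x2, x3) (a, b) * (\<rho> (x1, a) (y1, c) * \<rho> (c, b) (y2, y3))) =
      (\<Sum>a\<in>UNIV. \<Sum>b\<in>UNIV. \<Sum>c\<in>UNIV. \<rho> (x1, x2) (a, b) * (\<rho> (b, x3) (c, y3) * \<sigma> (a, c) (y1, y2)))"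
    and exchange2: "(\<Sum>a\<in>UNIV. \<Sum>b\<in>UNIV. \<Sum>c\<in>UNIV. \<sigma> (x1, x2) (a, b) * (\<rho> (b, x3) (c, y3) * \<rho> (a, c) (y1, y2))) =
      (\<Sum>a\<in>UNIV. \<Sum>b\<in>UNIV. \<Sum>c\<in>UNIV. \<rho> (x2, x3) (a, b) * (\<rho> (x1, a) (y1, c) * \<sigma> (c, b) (y2, y3)))"
begin

definition C :: "'n \<Rightarrow> 'n \<Rightarrow> complex" where
  "C i j = (\<Sum>k\<in>UNIV. \<psi> (i, k) (j, k))"

text \<open>View \<rho> as an array over its second lower and first upper index, with matrices as
  entries. The skew relations then say that the array of \<psi> is inverse to it in the sense of
  \<open>exchange_skew_inverse\<close>.\<close>

lemma exchange1_skew: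
  "(\<Sum>x\<in>UNIV. \<Sum>y\<in>UNIV. \<sigma> (x, y) (c, d) * (\<Sum>\<beta>\<in>UNIV. \<psi> (\<alpha>, b) (y, \<beta>) * \<psi> (\<beta>, a) (x, \<gamma>))) =
   (\<Sum>x\<in>UNIV. \<Sum>y\<in>UNIV. \<sigma> (a, b) (x, y) * (\<Sum>\<beta>\<in>UNIV. \<psi> (\<alpha>, y) (d, \<beta>) * \<psi> (\<beta>, x) (c, \<gamma>)))"
proof -
  define T where "T a b = mop (\<lambda>x c. \<rho> (x, a) (b, c))" for a b
  define U where "U x t = mop (\<lambda>z y. \<psi> (z, x) (t, y))" for x t
  have TU: "(\<Sum>t\<in>UNIV. T t y * U x t) = (if x = y then 1 else 0)" for x y
    unfolding T_def U_def mop_mult mop_sum skew1 by (simp add: mop_one mop_zero)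
  have UT: "(\<Sum>t\<in>UNIV. U t y * T x t) = (if x = y then 1 else 0)" for x y
    unfolding T_def U_def mop_mult mop_sum skew2 by (simp add: mop_one mop_zero)
  have ex: "(\<Sum>a\<in>UNIV. \<Sum>b\<in>UNIV. lmul (\<sigma> (x, y) (a, b)) * (T a c * T b d)) =
      (\<Sum>a\<in>UNIV. \<Sum>b\<in>UNIV. lmul (\<sigma> (a, b) (c, d)) * (T x a * T y b))" for x y c d
  proof -
    have "(\<Sum>a\<in>UNIV. \<Sum>b\<in>UNIV. \<Sum>e\<in>UNIV. \<rho> (u, x) (a, e) * (\<rho> (e, y) (b, v) * \<sigma> (a, b) (c, d)))
      = (\<Sum>a\<in>UNIV. \<Sum>e\<in>UNIV. \<Sum>b\<in>UNIV. \<rho> (u, x) (a, e) * (\<rho> (e, y) (b, v) * \<sigma> (a, b) (c, d)))" for u v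
      by (rule sum.cong[OF refl], rule sum.swap)
    then show ?thesis
      unfolding T_def mop_mult lmul_mop mop_sum sum_distrib_left exchange1
      by (simp add: ac_simps)
  qed
  have "(\<Sum>x\<in>UNIV. \<Sum>y\<in>UNIV. lmul (\<sigma> (x, y) (c, d)) * (U b y * U a x)) =
      (\<Sum>x\<in>UNIV. \<Sum>y\<in>UNIV. lmul (\<sigma> (a, b) (x, y)) * (U y d * U x c))"
    by (rule exchange_skew_inverse[OF ex lmul_complex_central TU UT])
  from this[unfolded U_def mop_mult lmul_mop mop_sum, THEN mop_inject, of \<alpha> \<gamma>] show ?thesis .
qed

text \<open>The mirror image: the array runs over the first lower and second upper index, and the
  two skew relations exchange their roles.\<close>

lemma exchange2_skew:
  "(\<Sum>x\<in>UNIV. \<Sum>y\<in>UNIV. \<sigma> (y, x) (d, c) * (\<Sum>\<beta>\<in>UNIV. \<psi> (b, \<alpha>) (\<beta>, y) * \<psi> (a, \<beta>) (\<gamma>, x))) =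
   (\<Sum>x\<in>UNIV. \<Sum>y\<in>UNIV. \<sigma> (b, a) (y, x) * (\<Sum>\<beta>\<in>UNIV. \<psi> (y, \<alpha>) (\<beta>, d) * \<psi> (x, \<beta>) (\<gamma>, c)))"
proof -
  define T where "T a b = mop (\<lambda>x c. \<rho> (a, x) (c, b))" for a b
  define U where "U x t = mop (\<lambda>z y. \<psi> (x, z) (y, t))" for x t
  have TU: "(\<Sum>t\<in>UNIV. T t y * U x t) = (if x = y then 1 else 0)" for x y
  proof -
    have "(\<Sum>t\<in>UNIV. \<Sum>z\<in>UNIV. \<rho> (t, u) (z, y) * \<psi> (x, z) (v, t)) = (if x = y \<and> u = v then 1 else 0)" for u v
      using skew2[of x v u y] by (subst sum.swap) (simp add: mult.commute)
    then show ?thesis unfolding T_def U_def mop_mult mop_sum by (simp add: mop_one mop_zero)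
  qed
  have UT: "(\<Sum>t\<in>UNIV. U t y * T x t) = (if x = y then 1 else 0)" for x y
  proof -
    have "(\<Sum>t\<in>UNIV. \<Sum>z\<in>UNIV. \<psi> (t, u) (z, y) * \<rho> (x, z) (v, t)) = (if x = y \<and> u = v then 1 else 0)" for u v
      using skew1[of x v u y] by (subst sum.swap) (simp add: mult.commute)
    then show ?thesis unfolding T_def U_def mop_mult mop_sum by (simp add: mop_one mop_zero)
  qed
  have ex: "(\<Sum>a\<in>UNIV. \<Sum>b\<in>UNIV. lmul (\<sigma> (y, x) (b, a)) * (T a c * T b d)) =
      (\<Sum>a\<in>UNIV. \<Sum>b\<in>UNIV. lmul (\<sigma> (b, a) (d, c)) * (T x a * T y b))" for x y c d
  proof -
    have "(\<Sum>a\<in>UNIV. \<Sum>b\<in>UNIV. \<sigma> (y, x) (b, a) * (\<Sum>e\<in>UNIV. \<rho> (a, u) (e, c) * \<rho> (b, e) (v, d)))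
      = (\<Sum>b\<in>UNIV. \<Sum>a\<in>UNIV. \<Sum>e\<in>UNIV. \<sigma> (y, x) (b, a) * (\<rho> (a, u) (e, c) * \<rho> (b, e) (v, d)))" for u v
      unfolding sum_distrib_left by (rule sum.swap)
    moreover have "(\<Sum>a\<in>UNIV. \<Sum>b\<in>UNIV. \<Sum>e\<in>UNIV. \<rho> (x, u) (a, b) * (\<rho> (y, a) (v, e) * \<sigma> (e, b) (d, c)))
      = (\<Sum>a\<in>UNIV. \<Sum>b\<in>UNIV. \<sigma> (b, a) (d, c) * (\<Sum>e\<in>UNIV. \<rho> (x, u) (e, a) * \<rho> (y, e) (v, b)))" for u v
    proof -
      have "(\<Sum>a\<in>UNIV. \<Sum>b\<in>UNIV. \<Sum>e\<in>UNIV. \<rho> (x, u) (a, b) * (\<rho> (y, a) (v, e) * \<sigma> (e, b) (d, c)))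
        = (\<Sum>b\<in>UNIV. \<Sum>e\<in>UNIV. \<Sum>a\<in>UNIV. \<rho> (x, u) (a, b) * (\<rho> (y, a) (v, e) * \<sigma> (e, b) (d, c)))"
        by (subst sum.swap, intro sum.cong refl sum.swap)
      then show ?thesis by (simp add: sum_distrib_left ac_simps)
    qed
    ultimately show ?thesis
      unfolding T_def mop_mult lmul_mop mop_sum by (simp only: exchange2)
  qed
  have "(\<Sum>x\<in>UNIV. \<Sum>y\<in>UNIV. lmul (\<sigma> (y, x) (d, c)) * (U b y * U a x)) =
      (\<Sum>x\<in>UNIV. \<Sum>y\<in>UNIV. lmul (\<sigma> (b, a) (y, x)) * (U y d * U x c))"
    using exchange_skew_inverse[where S = "\<lambda>x y a b. lmul (\<sigma> (y, x) (b, a))", OF ex lmul_complex_central TU UT] .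
  from this[unfolded U_def mop_mult lmul_mop mop_sum, THEN mop_inject, of \<alpha> \<gamma>] show ?thesis .
qed

end

lemma sum_swap23:
  "(\<Sum>a\<in>A. \<Sum>b\<in>B. \<Sum>c\<in>C. \<Sum>d\<in>D. \<Sum>e\<in>E. g a b c d e) =
   (\<Sum>c\<in>C. \<Sum>d\<in>D. \<Sum>e\<in>E. \<Sum>a\<in>A. \<Sum>b\<in>B. g a b c d e)"
proof -
  have "(\<Sum>a\<in>A. \<Sum>b\<in>B. \<Sum>c\<in>C. \<Sum>d\<in>D. \<Sum>e\<in>E. g a b c d e) =
    (\<Sum>c\<in>C. \<Sum>d\<in>D. \<Sum>a\<in>A. \<Sum>b\<in>B. \<Sum>e\<in>E. g a b c d e)" by (rule sum_swap22)
  also have "\<dots> = (\<Sum>c\<in>C. \<Sum>d\<in>D. \<Sum>a\<in>A. \<Sum>e\<in>E. \<Sum>b\<in>B. g a b c d e)"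
    by (rule sum.cong[OF refl], rule sum.cong[OF refl], rule sum.cong[OF refl], rule sum.swap)
  also have "\<dots> = (\<Sum>c\<in>C. \<Sum>d\<in>D. \<Sum>e\<in>E. \<Sum>a\<in>A. \<Sum>b\<in>B. g a b c d e)"
    by (rule sum.cong[OF refl], rule sum.cong[OF refl], rule sum.swap)
  finally show ?thesis .
qed

section \<open>Contraction identities for the trace weight C\<close>

context skew_braiding
begin

lemma mop_\<rho>\<sigma>: "mop \<rho> * mop \<sigma> = 1" "mop \<sigma> * mop \<rho> = 1"
  by (simp_all add: mop_mult \<rho>\<sigma> \<sigma>\<rho> mop_one)

lemma right_inverse:
  assumes "\<And>Q. (\<Sum>P\<in>UNIV. \<sigma> P Q * \<theta> P) = g Q"
  shows "\<theta> P = (\<Sum>Q\<in>UNIV. g Q * \<rho> Q P)"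
proof -
  have "(\<Sum>Q\<in>UNIV. g Q * \<rho> Q P) = (\<Sum>Q\<in>UNIV. \<Sum>P'\<in>UNIV. \<theta> P' * (\<sigma> P' Q * \<rho> Q P))"
    unfolding assms[symmetric] by (simp add: sum_distrib_left sum_distrib_right ac_simps)
  also have "\<dots> = (\<Sum>P'\<in>UNIV. \<theta> P' * (\<Sum>Q\<in>UNIV. \<sigma> P' Q * \<rho> Q P))"
    by (subst sum.swap) (simp add: sum_distrib_left)
  finally show ?thesis by (simp add: \<sigma>\<rho> if_distrib[of "(*) _"] cong: if_cong)
qed

lemma left_inverse:
  assumes "\<And>Q. (\<Sum>P\<in>UNIV. \<sigma> Q P * \<theta> P) = g Q"
  shows "\<theta> P = (\<Sum>Q\<in>UNIV. \<rho> P Q * g Q)"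
proof -
  have "(\<Sum>Q\<in>UNIV. \<rho> P Q * g Q) = (\<Sum>Q\<in>UNIV. \<Sum>P'\<in>UNIV. \<theta> P' * (\<rho> P Q * \<sigma> Q P'))"
    unfolding assms[symmetric] by (simp add: sum_distrib_left ac_simps)
  also have "\<dots> = (\<Sum>P'\<in>UNIV. \<theta> P' * (\<Sum>Q\<in>UNIV. \<rho> P Q * \<sigma> Q P'))"
    by (subst sum.swap) (simp add: sum_distrib_left)
  finally show ?thesis by (simp add: \<rho>\<sigma> if_distrib[of "(*) _"] cong: if_cong)
qed

text \<open>In the exchange relation for \<psi>, one \<sigma> is moved to the other side as \<rho>.
  Summation over \<open>k\<close> closes a \<psi> into C on one side; on the other it cancels \<rho>
  against a \<psi> by \<open>skew2\<close> and leaves \<sigma> next to C.\<close>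

lemma \<sigma>_C: "(\<Sum>a\<in>UNIV. \<sigma> (p, n) (j, a) * C a b) = (\<Sum>x\<in>UNIV. C p x * \<psi> (n, x) (b, j))"
proof -
  define \<theta> where "\<theta> k P = (\<Sum>\<beta>\<in>UNIV. \<psi> (p, k) (\<beta>, fst P) * \<psi> (n, \<beta>) (b, snd P))" for k P
  have inv: "\<theta> k P = (\<Sum>Q\<in>UNIV. (\<Sum>x\<in>UNIV. \<Sum>y\<in>UNIV. \<sigma> (p, n) (y, x) *
      (\<Sum>\<beta>\<in>UNIV. \<psi> (y, k) (\<beta>, fst Q) * \<psi> (x, \<beta>) (b, snd Q))) * \<rho> Q P)" for k P
  proof (rule right_inverse)
    fix Q :: "'n \<times> 'n"
    have "(\<Sum>P\<in>UNIV. \<sigma> P Q * \<theta> k P) = (\<Sum>x\<in>UNIV. \<Sum>y\<in>UNIV. \<sigma> (y, x) (fst Q, snd Q) *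
        (\<Sum>\<beta>\<in>UNIV. \<psi> (p, k) (\<beta>, y) * \<psi> (n, \<beta>) (b, x)))"
      unfolding \<theta>_def sum_UNIV_prod by (subst sum.swap) simp
    then show "(\<Sum>P\<in>UNIV. \<sigma> P Q * \<theta> k P) = (\<Sum>x\<in>UNIV. \<Sum>y\<in>UNIV. \<sigma> (p, n) (y, x) *
        (\<Sum>\<beta>\<in>UNIV. \<psi> (y, k) (\<beta>, fst Q) * \<psi> (x, \<beta>) (b, snd Q)))"
      unfolding exchange2_skew .
  qed
  have "(\<Sum>x\<in>UNIV. C p x * \<psi> (n, x) (b, j)) = (\<Sum>x\<in>UNIV. \<Sum>k\<in>UNIV. \<psi> (p, k) (x, k) * \<psi> (n, x) (b, j))"
    by (simp add: C_def sum_distrib_right)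
  also have "\<dots> = (\<Sum>k\<in>UNIV. \<theta> k (k, j))"
    unfolding \<theta>_def by (subst sum.swap) simp
  also have "\<dots> = (\<Sum>k\<in>UNIV. \<Sum>d\<in>UNIV. \<Sum>c\<in>UNIV. \<Sum>x\<in>UNIV. \<Sum>y\<in>UNIV. \<Sum>\<beta>\<in>UNIV.
      \<sigma> (p, n) (y, x) * (\<psi> (x, \<beta>) (b, c) * (\<psi> (y, k) (\<beta>, d) * \<rho> (d, c) (k, j))))"
    unfolding inv sum_UNIV_prod by (simp add: sum_distrib_left sum_distrib_right ac_simps)
  also have "\<dots> = (\<Sum>c\<in>UNIV. \<Sum>x\<in>UNIV. \<Sum>y\<in>UNIV. \<Sum>k\<in>UNIV. \<Sum>d\<in>UNIV. \<Sum>\<beta>\<in>UNIV.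
      \<sigma> (p, n) (y, x) * (\<psi> (x, \<beta>) (b, c) * (\<psi> (y, k) (\<beta>, d) * \<rho> (d, c) (k, j))))"
    by (rule sum_swap23)
  also have "\<dots> = (\<Sum>c\<in>UNIV. \<Sum>x\<in>UNIV. \<Sum>y\<in>UNIV. \<Sum>\<beta>\<in>UNIV. \<Sum>k\<in>UNIV. \<Sum>d\<in>UNIV.
      \<sigma> (p, n) (y, x) * (\<psi> (x, \<beta>) (b, c) * (\<psi> (y, k) (\<beta>, d) * \<rho> (d, c) (k, j))))"
  proof (rule sum.cong[OF refl], rule sum.cong[OF refl], rule sum.cong[OF refl])
    show "(\<Sum>k\<in>UNIV. \<Sum>d\<in>UNIV. \<Sum>\<beta>\<in>UNIV. g k d \<beta>) = (\<Sum>\<beta>\<in>UNIV. \<Sum>k\<in>UNIV. \<Sum>d\<in>UNIV. g k d \<beta>)"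
      for g :: "'n \<Rightarrow> 'n \<Rightarrow> 'n \<Rightarrow> complex"
      by (subst (2) sum.swap, rule sum.cong[OF refl], rule sum.swap)
  qed
  also have "\<dots> = (\<Sum>c\<in>UNIV. \<Sum>x\<in>UNIV. \<Sum>y\<in>UNIV. \<Sum>\<beta>\<in>UNIV.
      if y = j \<and> c = \<beta> then \<sigma> (p, n) (y, x) * \<psi> (x, \<beta>) (b, c) else 0)"
    unfolding sum_distrib_left[symmetric] skew2
    by (intro sum.cong refl) (simp add: sum_distrib_left if_distrib[of "(*) _"] cong: if_cong)
  also have "\<dots> = (\<Sum>c\<in>UNIV. \<Sum>x\<in>UNIV. \<Sum>y\<in>UNIV. if y = j then \<sigma> (p, n) (y, x) * \<psi> (x, c) (b, c) else 0)"
  proof (intro sum.cong refl)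
    show "(\<Sum>\<beta>\<in>UNIV. if y = j \<and> c = \<beta> then \<sigma> (p, n) (y, x) * \<psi> (x, \<beta>) (b, c) else 0)
      = (if y = j then \<sigma> (p, n) (y, x) * \<psi> (x, c) (b, c) else 0)" for c x y
      by (cases "y = j") simp_all
  qed
  also have "\<dots> = (\<Sum>x\<in>UNIV. \<Sum>c\<in>UNIV. \<sigma> (p, n) (j, x) * \<psi> (x, c) (b, c))"
    by (subst sum.swap) simp
  finally show ?thesis by (simp add: C_def sum_distrib_left)
qed

text \<open>The mirror image of the previous identity, obtained from
  \<open>exchange1_skew\<close>.\<close>

lemma C_\<sigma>: "(\<Sum>y\<in>UNIV. C n y * \<sigma> (x, y) (m, b)) = (\<Sum>j\<in>UNIV. \<psi> (n, x) (b, j) * C j m)"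
proof -
  define \<theta> where "\<theta> k P = (\<Sum>\<beta>\<in>UNIV. \<psi> (n, snd P) (b, \<beta>) * \<psi> (\<beta>, fst P) (m, k))" for k P
  have inv: "\<theta> k P = (\<Sum>Q\<in>UNIV. \<rho> P Q * (\<Sum>u\<in>UNIV. \<Sum>v\<in>UNIV. \<sigma> (u, v) (m, b) *
      (\<Sum>\<beta>\<in>UNIV. \<psi> (n, snd Q) (v, \<beta>) * \<psi> (\<beta>, fst Q) (u, k))))" for k P
  proof (rule left_inverse)
    fix Q :: "'n \<times> 'n"
    have "(\<Sum>P\<in>UNIV. \<sigma> Q P * \<theta> k P) = (\<Sum>u\<in>UNIV. \<Sum>v\<in>UNIV. \<sigma> (fst Q, snd Q) (u, v) *
        (\<Sum>\<beta>\<in>UNIV. \<psi> (n, v) (b, \<beta>) * \<psi> (\<beta>, u) (m, k)))"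
      unfolding \<theta>_def sum_UNIV_prod by simp
    then show "(\<Sum>P\<in>UNIV. \<sigma> Q P * \<theta> k P) = (\<Sum>u\<in>UNIV. \<Sum>v\<in>UNIV. \<sigma> (u, v) (m, b) *
        (\<Sum>\<beta>\<in>UNIV. \<psi> (n, snd Q) (v, \<beta>) * \<psi> (\<beta>, fst Q) (u, k)))"
      unfolding exchange1_skew .
  qed
  have "(\<Sum>j\<in>UNIV. \<psi> (n, x) (b, j) * C j m) = (\<Sum>j\<in>UNIV. \<Sum>k\<in>UNIV. \<psi> (n, x) (b, j) * \<psi> (j, k) (m, k))"
    by (simp add: C_def sum_distrib_left)
  also have "\<dots> = (\<Sum>k\<in>UNIV. \<theta> k (k, x))"
    unfolding \<theta>_def by (subst sum.swap) simp
  also have "\<dots> = (\<Sum>k\<in>UNIV. \<Sum>c\<in>UNIV. \<Sum>d\<in>UNIV. \<Sum>u\<in>UNIV. \<Sum>v\<in>UNIV. \<Sum>\<beta>\<in>UNIV.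
      \<sigma> (u, v) (m, b) * (\<psi> (n, d) (v, \<beta>) * (\<psi> (\<beta>, c) (u, k) * \<rho> (k, x) (c, d))))"
    unfolding inv sum_UNIV_prod by (simp add: sum_distrib_left sum_distrib_right ac_simps)
  also have "\<dots> = (\<Sum>c\<in>UNIV. \<Sum>k\<in>UNIV. \<Sum>d\<in>UNIV. \<Sum>u\<in>UNIV. \<Sum>v\<in>UNIV. \<Sum>\<beta>\<in>UNIV.
      \<sigma> (u, v) (m, b) * (\<psi> (n, d) (v, \<beta>) * (\<psi> (\<beta>, c) (u, k) * \<rho> (k, x) (c, d))))"
    by (rule sum.swap)
  also have "\<dots> = (\<Sum>d\<in>UNIV. \<Sum>u\<in>UNIV. \<Sum>v\<in>UNIV. \<Sum>c\<in>UNIV. \<Sum>k\<in>UNIV. \<Sum>\<beta>\<in>UNIV.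
      \<sigma> (u, v) (m, b) * (\<psi> (n, d) (v, \<beta>) * (\<psi> (\<beta>, c) (u, k) * \<rho> (k, x) (c, d))))"
    by (rule sum_swap23)
  also have "\<dots> = (\<Sum>d\<in>UNIV. \<Sum>u\<in>UNIV. \<Sum>v\<in>UNIV. \<Sum>\<beta>\<in>UNIV. \<Sum>c\<in>UNIV. \<Sum>k\<in>UNIV.
      \<sigma> (u, v) (m, b) * (\<psi> (n, d) (v, \<beta>) * (\<psi> (\<beta>, c) (u, k) * \<rho> (k, x) (c, d))))"
  proof (rule sum.cong[OF refl], rule sum.cong[OF refl], rule sum.cong[OF refl])
    show "(\<Sum>k\<in>UNIV. \<Sum>d\<in>UNIV. \<Sum>\<beta>\<in>UNIV. g k d \<beta>) = (\<Sum>\<beta>\<in>UNIV. \<Sum>k\<in>UNIV. \<Sum>d\<in>UNIV. g k d \<beta>)"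
      for g :: "'n \<Rightarrow> 'n \<Rightarrow> 'n \<Rightarrow> complex"
      by (subst (2) sum.swap, rule sum.cong[OF refl], rule sum.swap)
  qed
  also have "\<dots> = (\<Sum>d\<in>UNIV. \<Sum>u\<in>UNIV. \<Sum>v\<in>UNIV. \<Sum>\<beta>\<in>UNIV.
      if \<beta> = d \<and> x = u then \<sigma> (u, v) (m, b) * \<psi> (n, d) (v, \<beta>) else 0)"
    unfolding sum_distrib_left[symmetric] skew2
    by (intro sum.cong refl) (simp add: sum_distrib_left if_distrib[of "(*) _"] cong: if_cong)
  also have "\<dots> = (\<Sum>d\<in>UNIV. \<Sum>u\<in>UNIV. \<Sum>v\<in>UNIV. if x = u then \<sigma> (u, v) (m, b) * \<psi> (n, d) (v, d) else 0)"
  proof (intro sum.cong refl)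
    show "(\<Sum>\<beta>\<in>UNIV. if \<beta> = d \<and> x = u then \<sigma> (u, v) (m, b) * \<psi> (n, d) (v, \<beta>) else 0)
      = (if x = u then \<sigma> (u, v) (m, b) * \<psi> (n, d) (v, d) else 0)" for d u v
      by (cases "x = u") simp_all
  qed
  also have "\<dots> = (\<Sum>d\<in>UNIV. \<Sum>v\<in>UNIV. \<Sum>u\<in>UNIV. if x = u then \<sigma> (u, v) (m, b) * \<psi> (n, d) (v, d) else 0)"
    by (rule sum.cong[OF refl], rule sum.swap)
  also have "\<dots> = (\<Sum>v\<in>UNIV. \<Sum>d\<in>UNIV. \<sigma> (x, v) (m, b) * \<psi> (n, d) (v, d))"
    by (subst sum.swap) simp
  finally show ?thesis by (simp add: C_def sum_distrib_left mult.commute)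
qed

text \<open>Moving \<sigma> across C turns it into \<psi>, which then cancels \<rho> by the skew
  relation.\<close>

lemma C_conj: "(\<Sum>(a, j, l)\<in>UNIV. C a j * \<rho> (h, j) (k, l) * \<sigma> (m, l) (n, a)) = (if h = n then C m k else 0)"
proof -
  have "(\<Sum>(a, j, l)\<in>UNIV. C a j * \<rho> (h, j) (k, l) * \<sigma> (m, l) (n, a))
    = (\<Sum>a\<in>UNIV. \<Sum>j\<in>UNIV. \<Sum>l\<in>UNIV. \<rho> (h, j) (k, l) * (\<sigma> (m, l) (n, a) * C a j))"
    by (simp add: sum_UNIV_prod ac_simps)
  also have "\<dots> = (\<Sum>j\<in>UNIV. \<Sum>l\<in>UNIV. \<Sum>a\<in>UNIV. \<rho> (h, j) (k, l) * (\<sigma> (m, l) (n, a) * C a j))"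
    by (subst sum.swap, rule sum.cong[OF refl], rule sum.swap)
  also have "\<dots> = (\<Sum>j\<in>UNIV. \<Sum>l\<in>UNIV. \<Sum>x\<in>UNIV. C m x * (\<rho> (h, j) (k, l) * \<psi> (l, x) (j, n)))"
    unfolding sum_distrib_left[symmetric] \<sigma>_C by (simp add: sum_distrib_left ac_simps)
  also have "\<dots> = (\<Sum>x\<in>UNIV. C m x * (\<Sum>j\<in>UNIV. \<Sum>l\<in>UNIV. \<rho> (h, j) (k, l) * \<psi> (l, x) (j, n)))"
    unfolding sum_distrib_left by (subst (2) sum.swap, rule sum.cong[OF refl], rule sum.swap)
  also have "\<dots> = (\<Sum>x\<in>UNIV. if x = k then if h = n then C m x else 0 else 0)"
    unfolding skew1 by (intro sum.cong refl) simp
  finally show ?thesis by simp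
qed

lemma C_conj': "(\<Sum>(a, j, l)\<in>UNIV. C a j * \<sigma> (h, j) (k, l) * \<rho> (m, l) (n, a)) = (if h = n then C m k else 0)"
proof -
  have "(\<Sum>(a, j, l)\<in>UNIV. C a j * \<sigma> (h, j) (k, l) * \<rho> (m, l) (n, a))
    = (\<Sum>a\<in>UNIV. \<Sum>j\<in>UNIV. \<Sum>l\<in>UNIV. C a j * \<sigma> (h, j) (k, l) * \<rho> (m, l) (n, a))"
    by (simp add: sum_UNIV_prod)
  also have "\<dots> = (\<Sum>a\<in>UNIV. \<Sum>l\<in>UNIV. \<Sum>j\<in>UNIV. C a j * \<sigma> (h, j) (k, l) * \<rho> (m, l) (n, a))"
    by (rule sum.cong[OF refl], rule sum.swap)
  also have "\<dots> = (\<Sum>l\<in>UNIV. \<Sum>a\<in>UNIV. \<Sum>y\<in>UNIV. C y k * (\<rho> (m, l) (n, a) * \<psi> (a, h) (l, y)))"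
    unfolding sum_distrib_right[symmetric] C_\<sigma> by (subst sum.swap) (simp add: sum_distrib_left sum_distrib_right ac_simps)
  also have "\<dots> = (\<Sum>y\<in>UNIV. C y k * (\<Sum>l\<in>UNIV. \<Sum>a\<in>UNIV. \<rho> (m, l) (n, a) * \<psi> (a, h) (l, y)))"
    unfolding sum_distrib_left by (subst (2) sum.swap, rule sum.cong[OF refl], rule sum.swap)
  also have "\<dots> = (\<Sum>y\<in>UNIV. if y = m then if h = n then C y k else 0 else 0)"
    unfolding skew1 by (intro sum.cong refl) auto
  finally show ?thesis by simp
qed

text \<open>Crossing one factor C turns \<sigma> into \<psi>, and crossing the other turns it back.
  So the product of the two weights commutes with \<sigma>, hence with its inverse \<rho>.\<close>

lemma C_commute:
  "(\<Sum>U\<in>UNIV. C (fst P) (fst U) * C (snd P) (snd U) * \<rho> U Q)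
     = (\<Sum>U\<in>UNIV. \<rho> P U * (C (fst U) (fst Q) * C (snd U) (snd Q)))"
proof -
  let ?c = "\<lambda>P U. C (fst P) (fst U) * C (snd P) (snd U)"
  have "(\<Sum>U\<in>UNIV. ?c P U * \<sigma> U Q) = (\<Sum>U\<in>UNIV. \<sigma> P U * ?c U Q)" for P Q
  proof -
    obtain x1 x2 y1 y2 where PQ: "P = (x1, x2)" "Q = (y1, y2)" by (cases P, cases Q)
    have "(\<Sum>U\<in>UNIV. ?c P U * \<sigma> U Q) = (\<Sum>a\<in>UNIV. C x1 a * (\<Sum>b\<in>UNIV. C x2 b * \<sigma> (a, b) (y1, y2)))"
      by (simp add: PQ sum_UNIV_prod sum_distrib_left mult.assoc)
    also have "\<dots> = (\<Sum>a\<in>UNIV. \<Sum>j\<in>UNIV. C x1 a * \<psi> (x2, a) (y2, j) * C j y1)"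
      by (simp add: C_\<sigma> sum_distrib_left mult.assoc)
    also have "\<dots> = (\<Sum>j\<in>UNIV. (\<Sum>a\<in>UNIV. C x1 a * \<psi> (x2, a) (y2, j)) * C j y1)"
      by (subst sum.swap) (simp add: sum_distrib_right)
    also have "\<dots> = (\<Sum>j\<in>UNIV. (\<Sum>b\<in>UNIV. \<sigma> (x1, x2) (j, b) * C b y2) * C j y1)"
      by (simp only: \<sigma>_C)
    also have "\<dots> = (\<Sum>U\<in>UNIV. \<sigma> P U * ?c U Q)"
      by (simp add: PQ sum_UNIV_prod sum_distrib_left sum_distrib_right ac_simps)
    finally show ?thesis .
  qed
  then have "mop \<sigma> * mop ?c = mop ?c * mop \<sigma>" by (simp add: mop_mult)
  then have "mop ?c * mop \<rho> = mop \<rho> * mop ?c"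
    using inverse_commute[OF mop_\<rho>\<sigma>(2,1), of "mop ?c" "mop ?c"] by simp
  then show ?thesis unfolding mop_mult by (rule mop_inject)
qed

lemma C_trace: "(\<Sum>(j, a)\<in>UNIV. \<rho> (h, j) (k, a) * C a j) = (if h = k then 1 else 0)"
proof -
  have "(\<Sum>(j, a)\<in>UNIV. \<rho> (h, j) (k, a) * C a j)
    = (\<Sum>j\<in>UNIV. \<Sum>a\<in>UNIV. \<Sum>x\<in>UNIV. \<rho> (h, j) (k, a) * \<psi> (a, x) (j, x))"
    by (simp add: sum_UNIV_prod C_def sum_distrib_left)
  also have "\<dots> = (\<Sum>x\<in>UNIV. \<Sum>j\<in>UNIV. \<Sum>a\<in>UNIV. \<rho> (h, j) (k, a) * \<psi> (a, x) (j, x))"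
    by (subst (2) sum.swap, rule sum.cong[OF refl], rule sum.swap)
  also have "\<dots> = (\<Sum>x\<in>UNIV. if x = k then if h = x then 1 else 0 else 0)"
    unfolding skew1 by (intro sum.cong refl) auto
  finally show ?thesis by simp
qed

end

section \<open>The operators of a Hecke symmetry\<close>

lemma fconst_inject: "fconst c = fconst d \<Longrightarrow> c = d"
  by (metis fconst_def lookup_single_eq)

lemma fconst_sum: "fconst (sum f A) = (\<Sum>i\<in>A. fconst (f i))"
  by (induction A rule: infinite_finite_induct) (simp_all add: fconst_simps)

lemma scal_tmult: "scal (tmult k A B) = tmult k (scal A) (scal B)"
  by (simp add: scal_def tmult_def fconst_sum fconst_simps fun_eq_iff)

lemma scal_tid: "scal tid = tid"
  by (simp add: scal_def tid_def fconst_simps fun_eq_iff)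

lemma scal_tprod: "scal (tprod k As) = tprod k (map scal As)"
  by (induction As) (simp_all add: tprod_def scal_tid scal_tmult)

lemma upd_pair: "x(i := a, Suc i := b, i := c, Suc i := d) = x(i := c, Suc i := d)"
  by (simp add: fun_eq_iff)

lemma at2_mult: "at2 i A * at2 i B = at2 i (A ** B)"
proof (rule op_eqI)
  fix v :: "(nat \<Rightarrow> 'a) \<Rightarrow> 'b falg" and x
  let ?v = "\<lambda>U. v (x(i := fst U, Suc i := snd U))"
  have "app (at2 i A * at2 i B) v x
    = (\<Sum>Q\<in>UNIV. \<Sum>U\<in>UNIV. fconst (A $ (x i, x (Suc i)) $ Q * B $ Q $ U) * ?v U)"
    by (simp add: app_at2 sum_distrib_left fconst_simps mult.assoc upd_pair)
  also have "\<dots> = (\<Sum>U\<in>UNIV. \<Sum>Q\<in>UNIV. fconst (A $ (x i, x (Suc i)) $ Q * B $ Q $ U) * ?v U)"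
    by (rule sum.swap)
  finally show "app (at2 i A * at2 i B) v x = app (at2 i (A ** B)) v x"
    by (simp add: app_at2 matrix_matrix_mult_def fconst_sum sum_distrib_right)
qed

lemma at2_one: "at2 i (mat 1) = 1"
proof (rule op_eqI)
  fix v :: "(nat \<Rightarrow> 'a) \<Rightarrow> 'b falg" and x
  have "app (at2 i (mat 1)) v x
    = (\<Sum>Q\<in>UNIV. if (x i, x (Suc i)) = Q then v (x(i := fst Q, Suc i := snd Q)) else 0)"
    unfolding app_at2 by (intro sum.cong refl) (simp add: mat_def fconst_simps)
  then show "app (at2 i (mat 1)) v x = app 1 v x" by simp
qed

lemma at2_add: "at2 i (A + B) = at2 i A + at2 i B"
  by (rule op_eqI) (simp add: app_at2 fconst_simps distrib_right sum.distrib)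

lemma at2_scale: "at2 i (\<chi> P Q. c * A $ P $ Q) = sc c * at2 i A"
  by (rule op_eqI) (simp add: app_at2 fconst_simps mult.assoc sum_distrib_left)

lemma at2_commute:
  assumes "\<And>a b. tunit i a b * F = F * tunit i a b" "\<And>a b. tunit (Suc i) a b * F = F * tunit (Suc i) a b"
  shows "at2 i A * F = F * at2 i A"
proof -
  have "(sc c * (tunit i (fst P) (fst Q) * tunit (Suc i) (snd P) (snd Q))) * F
    = F * (sc c * (tunit i (fst P) (fst Q) * tunit (Suc i) (snd P) (snd Q)))" for P Q c
  proof -
    have "(sc c * (tunit i (fst P) (fst Q) * tunit (Suc i) (snd P) (snd Q))) * F
      = sc c * (tunit i (fst P) (fst Q) * (tunit (Suc i) (snd P) (snd Q) * F))" by (simp only: mult.assoc)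
    also have "\<dots> = sc c * ((tunit i (fst P) (fst Q) * F) * tunit (Suc i) (snd P) (snd Q))"
      by (simp only: assms(2) mult.assoc)
    also have "\<dots> = sc c * (F * (tunit i (fst P) (fst Q) * tunit (Suc i) (snd P) (snd Q)))"
      by (simp only: assms(1) mult.assoc)
    finally show ?thesis by (simp only: op.sc_left_commute)
  qed
  then show ?thesis unfolding at2_def sum_distrib_left sum_distrib_right by (intro sum.cong refl)
qed

lemma at2_far:
  fixes A B :: "'n::finite rmat"
  assumes "Suc i < j"
  shows "at2 i A * at2 j B = (at2 j B * at2 i A :: ('n, 'g) tensor_op)"
proof -
  have "tunit i' a b * at2 j B = (at2 j B * tunit i' a b :: ('n, 'g) tensor_op)" if "i' \<noteq> j" "i' \<noteq> Suc j" for i' a b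
    by (rule at2_commute[symmetric]; rule tunit_commute) (use that in auto)
  then show ?thesis using assms by (intro at2_commute) simp_all
qed

lemma sum_idx_Suc: "(\<Sum>a\<in>idx (Suc k). g a) = (\<Sum>x\<in>UNIV. \<Sum>a\<in>idx k. g (x # a))"
  for g :: "'n::finite list \<Rightarrow> 'b::comm_monoid_add"
proof -
  have "(\<Sum>a\<in>idx (Suc k). g a) = (\<Sum>(x, a)\<in>UNIV \<times> idx k. g (x # a))"
    by (rule sum.reindex_bij_witness[of _ "\<lambda>(x, a). x # a" "\<lambda>a. (hd a, tl a)"])
      (auto simp: idx_def length_Suc_conv)
  then show ?thesis by (simp add: sum.cartesian_product)
qed

lemma idx_0: "idx 0 = {[]}"
  by (auto simp: idx_def)

lemma mat_mult_left: "mat c ** A = (\<chi> P Q. c * A $ P $ Q)"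
  and mat_mult_right: "A ** mat c = (\<chi> P Q. c * A $ P $ Q)"
  for A :: "complex ^ 'm::finite ^ 'm"
  by (simp_all add: vec_eq_iff matrix_matrix_mult_def mat_def if_distrib[of "(*) _"]
      if_distrib[of "\<lambda>t. t * _"] mult.commute cong: if_cong)

lemma matrix_diff_distrib: "(A - B) ** D = A ** D - B ** D" "D ** (A - B) = D ** A - D ** B"
  for A B D :: "complex ^ 'm::finite ^ 'm"
  by (simp_all add: vec_eq_iff matrix_matrix_mult_def left_diff_distrib right_diff_distrib sum_subtractf)

locale hecke_data =
  fixes q :: complex and R \<Psi> :: "'n::finite rmat"
  assumes hecke_symmetry: "hecke_symmetry q R" and skew_inverse: "skew_inverse R \<Psi>"
begin

definition lam :: complex where "lam = q - inverse q"

abbreviation S :: "'n rmat" where "S \<equiv> matrix_inv R"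

abbreviation (input) r :: "nat \<Rightarrow> ('n, 'n gen) tensor_op" where "r \<equiv> \<lambda>i. at2 i R"

abbreviation (input) s :: "nat \<Rightarrow> ('n, 'n gen) tensor_op" where "s \<equiv> \<lambda>i. at2 i S"

lemma q: "q \<noteq> 0" "q \<noteq> 1" "q \<noteq> -1"
  using hecke_symmetry by (auto simp: hecke_symmetry_def generic_def)

lemma lam_nonzero: "lam \<noteq> 0"
proof
  assume "lam = 0"
  then have "q * q = 1" using q(1) by (simp add: lam_def field_simps)
  then show False using q(2,3) by (metis mult_cancel_right1 mult_minus1 square_eq_1_iff)
qed

lemma R_quadratic: "R ** R = (\<chi> P Q. lam * R $ P $ Q) + mat 1"
proof -
  have "(mat q - R) ** (mat (inverse q) + R) = 0"
    using hecke_symmetry by (simp add: hecke_symmetry_def)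
  then have "mat q ** mat (inverse q) + mat q ** R - R ** mat (inverse q) - R ** R = 0"
    by (simp add: matrix_add_ldistrib matrix_diff_distrib algebra_simps)
  then have RR: "R ** R = mat q ** mat (inverse q) + mat q ** R - R ** mat (inverse q)"
    by (simp add: algebra_simps)
  have "q * (mat (inverse q) :: 'n rmat) $ P $ Q = mat 1 $ P $ Q" for P Q
    using q(1) by (simp add: mat_def)
  then have one: "mat q ** mat (inverse q) = (mat 1 :: 'n rmat)"
    unfolding mat_mult_left by (simp only: vec_eq_iff vec_lambda_beta) simp
  have lam: "(\<chi> P Q. lam * R $ P $ Q) = (\<chi> P Q. q * R $ P $ Q) - (\<chi> P Q. inverse q * R $ P $ Q)"
    by (simp add: vec_eq_iff lam_def left_diff_distrib)
  show ?thesis unfolding RR one unfolding mat_mult_left mat_mult_right lam by (simp add: algebra_simps)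
qed

lemma invertible_R: "R ** S = mat 1" "S ** R = mat 1"
proof -
  \<comment> \<open>The quadratic relation shows the inverse.\<close>
  have "R ** (R - mat lam) = mat 1"
    by (simp add: matrix_diff_distrib R_quadratic mat_mult_right)
  then have "invertible R" using invertible_right_inverse by blast
  then have "R ** S = mat 1 \<and> S ** R = mat 1"
    unfolding invertible_def matrix_inv_def by (rule someI_ex)
  then show "R ** S = mat 1" "S ** R = mat 1" by auto
qed

lemma braid_op: "at2 m R * at2 (Suc m) R * at2 m R = at2 (Suc m) R * at2 m R * (at2 (Suc m) R :: ('n, 'g) tensor_op)"
proof -
  have "teq 3 (scal (tprod 3 [at_pair 1 R, at_pair 2 R, at_pair 1 R]) :: ('n, 'g falg) tmat)
      (scal (tprod 3 [at_pair 2 R, at_pair 1 R, at_pair 2 R]))"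
    using hecke_symmetry by (simp add: hecke_symmetry_def braid_relation_def teq_def scal_def)
  from emb_cong[OF this, of m] show ?thesis
    by (simp add: scal_tprod emb_tprod emb_at_pair mult.assoc)
qed

end

sublocale hecke_data \<subseteq> hecke r s sc lam
proof
  fix i j
  show "at2 i R * at2 i S = (1 :: ('n, 'n gen) tensor_op)" "at2 i S * at2 i R = (1 :: ('n, 'n gen) tensor_op)"
    by (simp_all add: at2_mult invertible_R at2_one)
  show "at2 i R * at2 (Suc i) R * at2 i R = at2 (Suc i) R * at2 i R * (at2 (Suc i) R :: ('n, 'n gen) tensor_op)"
    by (rule braid_op)
  show "at2 i R * at2 j R = (at2 j R * at2 i R :: ('n, 'n gen) tensor_op)" if "Suc i < j"
    using that by (rule at2_far)
  show "at2 i R * at2 i R = sc lam * at2 i R + (1 :: ('n, 'n gen) tensor_op)"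
    by (simp add: at2_mult R_quadratic at2_add at2_scale at2_one)
qed

context hecke_data
begin

definition \<rho> :: "'n \<times> 'n \<Rightarrow> 'n \<times> 'n \<Rightarrow> complex" where "\<rho> P Q = R $ P $ Q"
definition \<sigma> :: "'n \<times> 'n \<Rightarrow> 'n \<times> 'n \<Rightarrow> complex" where "\<sigma> P Q = S $ P $ Q"
definition \<psi> :: "'n \<times> 'n \<Rightarrow> 'n \<times> 'n \<Rightarrow> complex" where "\<psi> P Q = \<Psi> $ P $ Q"

lemma ptrace_pair: "ptrace 2 (tmult 3 (at_pair 1 A) (at_pair 2 B)) [x, u] [y, w]
  = (\<Sum>t\<in>UNIV. \<Sum>z\<in>UNIV. A $ (x, t) $ (y, z) * B $ (z, u) $ (t, w))"
proof -
  have "tmult 3 (at_pair 1 A) (at_pair 2 B) [x, t, u] [y, t, w]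
    = (\<Sum>z\<in>UNIV. A $ (x, t) $ (y, z) * B $ (z, u) $ (t, w))" for t
  proof -
    have "tmult 3 (at_pair 1 A) (at_pair 2 B) [x, t, u] [y, t, w]
      = (\<Sum>c1\<in>UNIV. \<Sum>c2\<in>UNIV. \<Sum>c3\<in>UNIV. if c3 = u then if c1 = y then
          A $ (x, t) $ (c1, c2) * B $ (c2, c3) $ (t, w) else 0 else 0)"
      unfolding tmult_def numeral_3_eq_3 sum_idx_Suc idx_0
      by (intro sum.cong refl) (auto simp: at_pair_def)
    also have "\<dots> = (\<Sum>c1\<in>UNIV. if c1 = y then (\<Sum>c2\<in>UNIV. A $ (x, t) $ (c1, c2) * B $ (c2, u) $ (t, w)) else 0)"
      by (intro sum.cong refl) simp
    finally show ?thesis by simp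
  qed
  then show ?thesis by (simp add: ptrace_def)
qed

lemma skew_pair:
  assumes "teq 2 (ptrace 2 (tmult 3 (at_pair 1 A) (at_pair 2 B))) flip"
  shows "(\<Sum>t\<in>UNIV. \<Sum>z\<in>UNIV. A $ (x, t) $ (y, z) * B $ (z, u) $ (t, w)) = (if x = w \<and> u = y then 1 else 0)"
proof -
  have "ptrace 2 (tmult 3 (at_pair 1 A) (at_pair 2 B)) [x, u] [y, w] = flip [x, u] [y, w]"
    using assms by (auto simp: teq_def idx_def)
  then show ?thesis unfolding ptrace_pair flip_def by (simp split: if_splits)
qed

text \<open>Entries of operator identities are read off by applying both sides to a test vector.\<close>

definition test :: "'n \<Rightarrow> 'n \<Rightarrow> 'n \<Rightarrow> (nat \<Rightarrow> 'n) \<Rightarrow> 'n gen falg" where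
  "test y1 y2 y3 x = (if x 0 = y1 \<and> x 1 = y2 \<and> x 2 = y3 then 1 else 0)"

lemma sum_pick_pair:
  "(\<Sum>Q\<in>UNIV. fconst (g Q) * (if fst Q = a \<and> snd Q = b then 1 else 0)) = fconst (g (a, b))"
  for g :: "'n \<times> 'n \<Rightarrow> complex"
proof -
  have "(\<Sum>Q\<in>UNIV. fconst (g Q) * (if fst Q = a \<and> snd Q = b then 1 else 0))
    = (\<Sum>Q\<in>UNIV. if Q = (a, b) then fconst (g Q) else 0)"
    by (intro sum.cong refl) (auto simp: prod_eq_iff)
  then show ?thesis by simp
qed

lemma sum_pick_fst:
  "(\<Sum>Q\<in>UNIV. fconst (g Q) * (if fst Q = a then h (snd Q) else 0)) = (\<Sum>c\<in>UNIV. fconst (g (a, c)) * h c)"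
  for g :: "'n \<times> 'n \<Rightarrow> complex"
proof -
  have "(\<Sum>Q\<in>UNIV. fconst (g Q) * (if fst Q = a then h (snd Q) else 0))
    = (\<Sum>b\<in>UNIV. \<Sum>c\<in>UNIV. if b = a then fconst (g (b, c)) * h c else 0)"
    unfolding sum_UNIV_prod by (intro sum.cong refl) simp
  then show ?thesis by (subst (asm) sum.swap) simp
qed

lemma sum_pick_snd:
  "(\<Sum>Q\<in>UNIV. fconst (g Q) * (if snd Q = a then h (fst Q) else 0)) = (\<Sum>c\<in>UNIV. fconst (g (c, a)) * h c)"
  for g :: "'n \<times> 'n \<Rightarrow> complex"
proof -
  have "(\<Sum>Q\<in>UNIV. fconst (g Q) * (if snd Q = a then h (fst Q) else 0))
    = (\<Sum>b\<in>UNIV. \<Sum>c\<in>UNIV. if c = a then fconst (g (b, c)) * h b else 0)"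
    unfolding sum_UNIV_prod by (intro sum.cong refl) simp
  then show ?thesis by simp
qed

lemma at2_test0: "app (at2 0 A) (test y1 y2 y3) =
  (\<lambda>x. if x 2 = y3 then fconst (A $ (x 0, x 1) $ (y1, y2)) else 0)"
proof (rule ext)
  fix x
  have "app (at2 0 A) (test y1 y2 y3) x = (\<Sum>Q\<in>UNIV. fconst (if x 2 = y3 then A $ (x 0, x 1) $ Q else 0) *
      (if fst Q = y1 \<and> snd Q = y2 then 1 else 0))"
    unfolding app_at2 by (intro sum.cong refl) (auto simp: test_def fconst_simps)
  then show "app (at2 0 A) (test y1 y2 y3) x = (if x 2 = y3 then fconst (A $ (x 0, x 1) $ (y1, y2)) else 0)"
    by (simp only: sum_pick_pair) (simp add: fconst_simps)
qed

lemma at2_test1: "app (at2 (Suc 0) A) (test y1 y2 y3) =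
  (\<lambda>x. if x 0 = y1 then fconst (A $ (x 1, x 2) $ (y2, y3)) else 0)"
proof (rule ext)
  fix x
  have "app (at2 (Suc 0) A) (test y1 y2 y3) x = (\<Sum>Q\<in>UNIV. fconst (if x 0 = y1 then A $ (x 1, x 2) $ Q else 0) *
      (if fst Q = y2 \<and> snd Q = y3 then 1 else 0))"
    unfolding app_at2 by (intro sum.cong refl) (auto simp: test_def fconst_simps numeral_2_eq_2)
  then show "app (at2 (Suc 0) A) (test y1 y2 y3) x = (if x 0 = y1 then fconst (A $ (x 1, x 2) $ (y2, y3)) else 0)"
    by (simp only: sum_pick_pair) (simp add: fconst_simps)
qed

lemma at2_at2_test01: "app (at2 0 A) (app (at2 (Suc 0) B) (test y1 y2 y3)) =
  (\<lambda>x. \<Sum>c\<in>UNIV. fconst (A $ (x 0, x 1) $ (y1, c)) * fconst (B $ (c, x 2) $ (y2, y3)))"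
proof (rule ext)
  fix x
  have "app (at2 0 A) (app (at2 (Suc 0) B) (test y1 y2 y3)) x = (\<Sum>Q\<in>UNIV. fconst (A $ (x 0, x 1) $ Q) *
      (if fst Q = y1 then fconst (B $ (snd Q, x 2) $ (y2, y3)) else 0))"
    unfolding app_at2 at2_test1 by (intro sum.cong refl) simp
  then show "app (at2 0 A) (app (at2 (Suc 0) B) (test y1 y2 y3)) x
    = (\<Sum>c\<in>UNIV. fconst (A $ (x 0, x 1) $ (y1, c)) * fconst (B $ (c, x 2) $ (y2, y3)))"
    using sum_pick_fst[where h = "\<lambda>c. fconst (B $ (c, x 2) $ (y2, y3))"] by simp
qed

lemma at2_at2_test10: "app (at2 (Suc 0) A) (app (at2 0 B) (test y1 y2 y3)) =
  (\<lambda>x. \<Sum>c\<in>UNIV. fconst (A $ (x 1, x 2) $ (c, y3)) * fconst (B $ (x 0, c) $ (y1, y2)))"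
proof (rule ext)
  fix x
  have "app (at2 (Suc 0) A) (app (at2 0 B) (test y1 y2 y3)) x = (\<Sum>Q\<in>UNIV. fconst (A $ (x 1, x 2) $ Q) *
      (if snd Q = y3 then fconst (B $ (x 0, fst Q) $ (y1, y2)) else 0))"
    unfolding app_at2 at2_test0 by (intro sum.cong refl) (simp add: numeral_2_eq_2)
  then show "app (at2 (Suc 0) A) (app (at2 0 B) (test y1 y2 y3)) x
    = (\<Sum>c\<in>UNIV. fconst (A $ (x 1, x 2) $ (c, y3)) * fconst (B $ (x 0, c) $ (y1, y2)))"
    using sum_pick_snd[where h = "\<lambda>c. fconst (B $ (x 0, c) $ (y1, y2))"] by simp
qed

lemma exchange1: "(\<Sum>a\<in>UNIV. \<Sum>b\<in>UNIV. \<Sum>c\<in>UNIV. \<sigma> (x2, x3) (a, b) * (\<rho> (x1, a) (y1, c) * \<rho> (c, b) (y2, y3))) =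
  (\<Sum>a\<in>UNIV. \<Sum>b\<in>UNIV. \<Sum>c\<in>UNIV. \<rho> (x1, x2) (a, b) * (\<rho> (b, x3) (c, y3) * \<sigma> (a, c) (y1, y2)))"
proof (rule fconst_inject[where 'a = "'n gen"])
  define x where "x = (\<lambda>i :: nat. if i = 0 then x1 else if i = 1 then x2 else x3)"
  have "app (at2 (Suc 0) S * (at2 0 R * at2 (Suc 0) R)) (test y1 y2 y3) x
    = app (at2 0 R * at2 (Suc 0) R * at2 0 S) (test y1 y2 y3) x"
    using braid_rrs[of 0] by simp
  then show "fconst (\<Sum>a\<in>UNIV. \<Sum>b\<in>UNIV. \<Sum>c\<in>UNIV. \<sigma> (x2, x3) (a, b) * (\<rho> (x1, a) (y1, c) * \<rho> (c, b) (y2, y3))) =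
    (fconst (\<Sum>a\<in>UNIV. \<Sum>b\<in>UNIV. \<Sum>c\<in>UNIV. \<rho> (x1, x2) (a, b) * (\<rho> (b, x3) (c, y3) * \<sigma> (a, c) (y1, y2))) :: 'n gen falg)"
    by (simp add: at2_at2_test01 at2_at2_test10)
      (simp add: app_at2 x_def \<rho>_def \<sigma>_def sum_UNIV_prod fconst_sum fconst_simps sum_distrib_left numeral_2_eq_2)
qed

lemma exchange2: "(\<Sum>a\<in>UNIV. \<Sum>b\<in>UNIV. \<Sum>c\<in>UNIV. \<sigma> (x1, x2) (a, b) * (\<rho> (b, x3) (c, y3) * \<rho> (a, c) (y1, y2))) =
  (\<Sum>a\<in>UNIV. \<Sum>b\<in>UNIV. \<Sum>c\<in>UNIV. \<rho> (x2, x3) (a, b) * (\<rho> (x1, a) (y1, c) * \<sigma> (c, b) (y2, y3)))"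
proof (rule fconst_inject[where 'a = "'n gen"])
  define x where "x = (\<lambda>i :: nat. if i = 0 then x1 else if i = 1 then x2 else x3)"
  have "app (at2 0 S * (at2 (Suc 0) R * at2 0 R)) (test y1 y2 y3) x
    = app (at2 (Suc 0) R * at2 0 R * at2 (Suc 0) S) (test y1 y2 y3) x"
    using braid_srr[of 0] by simp
  then show "fconst (\<Sum>a\<in>UNIV. \<Sum>b\<in>UNIV. \<Sum>c\<in>UNIV. \<sigma> (x1, x2) (a, b) * (\<rho> (b, x3) (c, y3) * \<rho> (a, c) (y1, y2))) =
    (fconst (\<Sum>a\<in>UNIV. \<Sum>b\<in>UNIV. \<Sum>c\<in>UNIV. \<rho> (x2, x3) (a, b) * (\<rho> (x1, a) (y1, c) * \<sigma> (c, b) (y2, y3))) :: 'n gen falg)"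
    by (simp add: at2_at2_test01 at2_at2_test10)
      (simp add: app_at2 x_def \<rho>_def \<sigma>_def sum_UNIV_prod fconst_sum fconst_simps sum_distrib_left numeral_2_eq_2)
qed

end

sublocale hecke_data \<subseteq> skew: skew_braiding \<rho> \<sigma> \<psi>
proof
  show "(\<Sum>U\<in>UNIV. \<rho> P U * \<sigma> U Q) = (if P = Q then 1 else 0)" for P Q
    using arg_cong[OF invertible_R(1), of "\<lambda>A. A $ P $ Q"] by (simp add: \<rho>_def \<sigma>_def matrix_matrix_mult_def mat_def)
  show "(\<Sum>U\<in>UNIV. \<sigma> P U * \<rho> U Q) = (if P = Q then 1 else 0)" for P Q
    using arg_cong[OF invertible_R(2), of "\<lambda>A. A $ P $ Q"] by (simp add: \<rho>_def \<sigma>_def matrix_matrix_mult_def mat_def)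
  show "(\<Sum>t\<in>UNIV. \<Sum>z\<in>UNIV. \<rho> (x, t) (y, z) * \<psi> (z, u) (t, w)) = (if x = w \<and> u = y then 1 else 0)" for x y u w
    unfolding \<rho>_def \<psi>_def using skew_inverse unfolding skew_inverse_def by (intro skew_pair) blast
  show "(\<Sum>t\<in>UNIV. \<Sum>z\<in>UNIV. \<psi> (x, t) (y, z) * \<rho> (z, u) (t, w)) = (if x = w \<and> u = y then 1 else 0)" for x y u w
    unfolding \<rho>_def \<psi>_def using skew_inverse unfolding skew_inverse_def by (intro skew_pair) blast
qed (rule exchange1 exchange2)+

lemma (in hecke_data) skew_C: "skew.C = Cmat \<Psi>"
  by (simp add: skew.C_def Cmat_def \<psi>_def fun_eq_iff)

sublocale hecke_data \<subseteq> traced r s sc lam tunit \<rho> \<sigma> "Cmat \<Psi>"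
  by unfold_locales
    (simp_all add: tunit_mult tunit_sum tunit_commute at2_def \<rho>_def[symmetric] \<sigma>_def[symmetric]
      skew.C_conj[unfolded skew_C] skew.C_conj'[unfolded skew_C] skew.C_commute[unfolded skew_C] skew.C_trace[unfolded skew_C])

section \<open>Ideals and subalgebras of the free algebra\<close>

lemma ring_free_ring: "ring free_ring"
proof (rule ringI)
  show "abelian_group (free_ring :: 'n gen falg ring)"
  proof (rule abelian_groupI)
    fix x :: "'n gen falg"
    show "\<exists>y\<in>carrier free_ring. y \<oplus>\<^bsub>free_ring\<^esub> x = \<zero>\<^bsub>free_ring\<^esub>"
      by (rule bexI[of _ "- x"]) (simp_all add: free_ring_def)
  qed (simp_all add: free_ring_def add_ac)
  show "monoid (free_ring :: 'n gen falg ring)"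
    by unfold_locales (simp_all add: free_ring_def mult.assoc)
qed (simp_all add: free_ring_def distrib_left distrib_right)

lemma minus_free_ring: "\<ominus>\<^bsub>free_ring\<^esub> x = - x"
proof -
  interpret ring free_ring by (rule ring_free_ring)
  have "- x \<oplus>\<^bsub>free_ring\<^esub> x = \<zero>\<^bsub>free_ring\<^esub>" by (simp add: free_ring_def)
  then show ?thesis using minus_equality[of "- x" x] by (simp add: free_ring_def)
qed

lemma ideal_free_ring: "ideal I free_ring \<longleftrightarrow> ring_ideal I"
proof
  interpret ring free_ring by (rule ring_free_ring)
  assume "ideal I free_ring"
  then interpret ideal I free_ring .
  have add: "a \<in> I \<Longrightarrow> b \<in> I \<Longrightarrow> a + b \<in> I" for a b using a_closed[of a b] by (simp add: free_ring_def)
  have minus: "a \<in> I \<Longrightarrow> - a \<in> I" for a using a_inv_closed[of a] by (simp add: minus_free_ring)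
  show "ring_ideal I"
  proof
    show "0 \<in> I" using additive_subgroup.zero_closed[OF additive_subgroup_axioms] by (simp add: free_ring_def)
    show "a - b \<in> I" if "a \<in> I" "b \<in> I" for a b using add[OF that(1) minus[OF that(2)]] by simp
    show "x * a \<in> I" if "a \<in> I" for a x using I_l_closed[OF that, of x] by (simp add: free_ring_def)
    show "a * x \<in> I" if "a \<in> I" for a x using I_r_closed[OF that, of x] by (simp add: free_ring_def)
  qed
next
  assume "ring_ideal I"
  then interpret ring_ideal I .
  show "ideal I free_ring"
  proof (rule idealI[OF ring_free_ring])
    show "subgroup I (add_monoid free_ring)"
    proof (rule subgroup.intro)
      fix x assume "x \<in> I"
      then have "\<ominus>\<^bsub>free_ring\<^esub> x \<in> I" by (simp add: minus_free_ring minus_mem)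
      then show "inv\<^bsub>add_monoid free_ring\<^esub> x \<in> I" by (simp add: a_inv_def)
    qed (auto simp: free_ring_def zero_mem plus_mem)
  qed (auto simp: free_ring_def mult_left_mem mult_right_mem)
qed

abbreviation fideal :: "'n gen falg set \<Rightarrow> 'n gen falg set" where
  "fideal X \<equiv> genideal free_ring X"

lemma fideal_ring_ideal: "ring_ideal (fideal X)"
  unfolding ideal_free_ring[symmetric]
  by (rule ring.genideal_ideal[OF ring_free_ring]) (simp add: free_ring_def)

lemma fideal_self: "X \<subseteq> fideal X"
  using ring.genideal_self[OF ring_free_ring, of X] by (simp add: free_ring_def)

lemma fideal_minimal: "ring_ideal I \<Longrightarrow> X \<subseteq> I \<Longrightarrow> fideal X \<subseteq> I"
  using ring.genideal_minimal[OF ring_free_ring] by (simp add: ideal_free_ring)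

text \<open>Several sets below are closed under linear combinations without being ideals; entries of
  operators are tested against these as well.\<close>

definition csubspace :: "'g falg set \<Rightarrow> bool" where
  "csubspace V \<longleftrightarrow> 0 \<in> V \<and> (\<forall>x\<in>V. \<forall>y\<in>V. x + y \<in> V) \<and> (\<forall>c. \<forall>x\<in>V. fconst c * x \<in> V)"

lemma subspaceI:
  "0 \<in> V \<Longrightarrow> (\<And>x y. x \<in> V \<Longrightarrow> y \<in> V \<Longrightarrow> x + y \<in> V) \<Longrightarrow> (\<And>c x. x \<in> V \<Longrightarrow> fconst c * x \<in> V) \<Longrightarrow> csubspace V"
  by (simp add: csubspace_def)

lemma subspace_sum: "csubspace V \<Longrightarrow> (\<And>i. i \<in> A \<Longrightarrow> f i \<in> V) \<Longrightarrow> sum f A \<in> V"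
  by (induction A rule: infinite_finite_induct) (auto simp: csubspace_def)

lemma subspace_diff: "csubspace V \<Longrightarrow> x \<in> V \<Longrightarrow> y \<in> V \<Longrightarrow> x - y \<in> V"
proof -
  assume V: "csubspace V" "x \<in> V" "y \<in> V"
  then have "x + fconst (- 1) * y \<in> V" unfolding csubspace_def by blast
  then show ?thesis by (simp add: fconst_simps)
qed

lemma ring_ideal_subspace: "ring_ideal I \<Longrightarrow> csubspace I"
  by (intro subspaceI) (auto intro: ring_ideal.zero_mem ring_ideal.plus_mem ring_ideal.mult_left_mem)

definition subalgebra :: "'g falg set \<Rightarrow> bool" where
  "subalgebra V \<longleftrightarrow> csubspace V \<and> 1 \<in> V \<and> (\<forall>x\<in>V. \<forall>y\<in>V. x * y \<in> V)"

lemma subalgebra_fconst: "subalgebra V \<Longrightarrow> fconst c \<in> V"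
  unfolding subalgebra_def csubspace_def by (metis mult.right_neutral)

lemma ent_tunit_left: "ent (tunit j a b * F) x y = (if x j = a then ent F (x(j := b)) y else 0)"
  by (simp add: ent_def)

lemma app_tunit_delta: "app (tunit j a b) (delta y) = (\<lambda>x. if y j = b then delta (y(j := a)) x else 0)"
  by (auto simp: delta_def fun_eq_iff)

lemma ent_tunit_right: "ent (F * tunit j a b) x y = (if y j = b then ent F x (y(j := a)) else 0)"
  by (cases "y j = b") (simp_all add: ent_def app_tunit_delta app_zero)

lemma ent_sc_left: "ent (sc c * F) x y = fconst c * ent F x y"
  by (simp add: ent_def)

lemma entries_in_sum:
  "csubspace V \<Longrightarrow> (\<And>i. i \<in> A \<Longrightarrow> F i \<in> entries_in V) \<Longrightarrow> sum F A \<in> entries_in V"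
  by (simp add: entries_in_def ent_sum subspace_sum)

lemma entries_in_diff: "csubspace V \<Longrightarrow> F \<in> entries_in V \<Longrightarrow> G \<in> entries_in V \<Longrightarrow> F - G \<in> entries_in V"
  by (simp add: entries_in_def ent_simps subspace_diff)

lemma entries_in_sc: "csubspace V \<Longrightarrow> F \<in> entries_in V \<Longrightarrow> sc c * F \<in> entries_in V"
  by (simp add: entries_in_def ent_sc_left csubspace_def)

lemma entries_in_tunit:
  assumes "csubspace V" "F \<in> entries_in V"
  shows "tunit j a b * F \<in> entries_in V" "F * tunit j a b \<in> entries_in V"
  using assms by (auto simp: entries_in_def ent_tunit_left ent_tunit_right csubspace_def)

lemma entries_in_at2:
  assumes V: "csubspace V" "F \<in> entries_in V"
  shows "at2 i A * F \<in> entries_in V" "F * at2 i A \<in> entries_in V"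
proof -
  show "at2 i A * F \<in> entries_in V"
    unfolding at2_def sum_distrib_right mult.assoc
    by (intro entries_in_sum entries_in_sc entries_in_tunit V)
  have "F * (sc c * (tunit i a b * tunit (Suc i) a' b')) \<in> entries_in V" for c a b a' b'
  proof -
    have "F * (sc c * (tunit i a b * tunit (Suc i) a' b')) = sc c * (F * tunit i a b * tunit (Suc i) a' b')"
      by (simp only: op.sc_left_commute[of F] mult.assoc)
    then show ?thesis using V by (simp add: entries_in_sc entries_in_tunit)
  qed
  then show "F * at2 i A \<in> entries_in V"
    unfolding at2_def sum_distrib_left by (intro entries_in_sum V)
qed

lemma entries_in_mult_right:
  assumes V: "csubspace V" "\<And>x y. x \<in> V \<Longrightarrow> x * y \<in> V" and F: "F \<in> entries_in V"
  shows "F * G \<in> entries_in V"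
  unfolding entries_in_def
proof safe
  fix x y
  obtain T where "\<forall>G y. ent (F * G) x y = (\<Sum>z\<in>T. ent F x z * ent G z y)" using ent_mult[of F x] by blast
  then show "ent (F * G) x y \<in> V" using F V by (auto simp: entries_in_def intro!: subspace_sum)
qed

lemma entries_in_mult:
  assumes V: "subalgebra V" and F: "F \<in> entries_in V" "G \<in> entries_in V"
  shows "F * G \<in> entries_in V"
  unfolding entries_in_def
proof safe
  fix x y
  obtain T where "\<forall>G y. ent (F * G) x y = (\<Sum>z\<in>T. ent F x z * ent G z y)" using ent_mult[of F x] by blast
  then show "ent (F * G) x y \<in> V"
    using F V by (auto simp: entries_in_def subalgebra_def intro!: subspace_sum)
qed

lemma entries_in_one: "subalgebra V \<Longrightarrow> 1 \<in> entries_in V"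
  by (simp add: entries_in_def ent_simps delta_def subalgebra_def csubspace_def)

lemma subalgebra_at2: "subalgebra V \<Longrightarrow> at2 i A \<in> entries_in V"
  using entries_in_at2(1)[of V 1] entries_in_one[of V] by (simp add: subalgebra_def)

lemma app_at1_delta: "ent (at1 j X * F) x y = (\<Sum>b\<in>UNIV. X (x j) b * ent F (x(j := b)) y)"
  by (simp add: ent_def app_at1)

lemma entries_in_at1_left:
  assumes "csubspace V" "\<And>a b x. x \<in> V \<Longrightarrow> X a b * x \<in> V" "F \<in> entries_in V"
  shows "at1 j X * F \<in> entries_in V"
  using assms by (auto simp: entries_in_def app_at1_delta intro!: subspace_sum)

lemma entries_in_at1:
  assumes "csubspace V" "\<And>a b. X a b \<in> V" shows "at1 j X \<in> entries_in V"
proof -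
  have "ent (at1 j X) x y \<in> V" for x y
  proof -
    have "ent (at1 j X) x y = (\<Sum>b\<in>UNIV. if x(j := b) = y then X (x j) b else 0)"
      using app_at1_delta[of j X 1 x y] by (simp add: ent_simps delta_def if_distrib[of "(*) _"] cong: if_cong)
    then show ?thesis using assms by (auto simp: csubspace_def intro!: subspace_sum)
  qed
  then show ?thesis by (simp add: entries_in_def)
qed

lemma emb_relators:
  assumes "csubspace V" "relators As Bs \<subseteq> V"
  shows "emb 0 2 (tprod 2 As) - emb 0 2 (tprod 2 Bs) \<in> entries_in V"
proof -
  have "ent (emb 0 2 (tprod 2 As) - emb 0 2 (tprod 2 Bs)) x y \<in> V" for x y
  proof -
    have "tprod 2 As (get_slice x 0 2) (get_slice y 0 2) - tprod 2 Bs (get_slice x 0 2) (get_slice y 0 2) \<in> V"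
      by (rule subsetD[OF assms(2)]) (unfold relators_def, use slice_idx in blast)
    then show ?thesis using assms(1) by (simp add: ent_simps ent_emb csubspace_def)
  qed
  then show ?thesis by (simp add: entries_in_def)
qed

lemma relators_ent:
  assumes "g \<in> relators As Bs"
  shows "\<exists>x y. g = ent (emb 0 2 (tprod 2 As) - emb 0 2 (tprod 2 Bs)) x y"
proof -
  obtain a b where ab: "a \<in> idx 2" "b \<in> idx 2" "g = tprod 2 As a b - tprod 2 Bs a b"
    using assms by (auto simp: relators_def)
  then show ?thesis
    by (intro exI[of _ "put_slice (\<lambda>_. undefined) 0 a"] exI[of _ "put_slice (\<lambda>_. undefined) 0 b"])
      (simp add: ent_simps ent_emb)
qed

section \<open>The free algebra as a module over itself by normal ordering\<close>

definition lin :: "('w \<Rightarrow> 'g falg) \<Rightarrow> ('w \<Rightarrow>\<^sub>0 complex) \<Rightarrow> 'g falg" where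
  "lin f x = (\<Sum>w\<in>Poly_Mapping.keys x. fconst (Poly_Mapping.lookup x w) * f w)"

lemma lin_superset:
  "finite A \<Longrightarrow> Poly_Mapping.keys x \<subseteq> A \<Longrightarrow> lin f x = (\<Sum>w\<in>A. fconst (Poly_Mapping.lookup x w) * f w)"
  unfolding lin_def by (rule sum.mono_neutral_left) (auto simp: in_keys_iff fconst_simps)

lemma lin_single: "lin f (Poly_Mapping.single w c) = fconst c * f w"
  by (subst lin_superset[of "{w}"]) auto

lemma lin_add: "lin f (x + y) = lin f x + lin f y"
proof -
  let ?A = "Poly_Mapping.keys x \<union> Poly_Mapping.keys y"
  have "Poly_Mapping.keys (x + y) \<subseteq> ?A" by (rule keys_add)
  then show ?thesis
    by (simp add: lin_superset[of ?A] lookup_add fconst_simps distrib_right sum.distrib)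
qed

lemma lin_cong: "(\<And>w. w \<in> Poly_Mapping.keys x \<Longrightarrow> f w = g w) \<Longrightarrow> lin f x = lin g x"
  unfolding lin_def by (intro sum.cong refl) simp

abbreviation word_mono :: "'g list \<Rightarrow> 'g falg" where
  "word_mono w \<equiv> Poly_Mapping.single (Word w) 1"

lemma mono_Nil: "word_mono [] = 1"
  by (simp add: zero_word_def[symmetric] flip: single_one)

lemma mono_mult: "word_mono u * word_mono w = word_mono (u @ w)"
  by (simp add: mult_single plus_word_def)

lemma fvar_mono: "fvar g * word_mono w = word_mono (g # w)"
  by (simp add: fvar_def mono_mult)

lemma falg_induct:
  assumes "\<And>x y. P x \<Longrightarrow> P y \<Longrightarrow> P (x + y)" "\<And>c x. P x \<Longrightarrow> P (fconst c * x)" "P (word_mono [])"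
    "\<And>g w. P (word_mono w) \<Longrightarrow> P (word_mono (g # w))"
  shows "P x"
proof (induction x rule: poly_mapping_additive_induct)
  fix w :: "'a word" and c :: complex
  have "P (word_mono u)" for u by (induction u) (auto intro: assms)
  then have "P (fconst c * word_mono (letters w))" by (rule assms(2))
  then show "P (Poly_Mapping.single w c)" by (simp add: fconst_def mult_single)
qed (rule assms(1))

lemma fconst_left_swap: "fconst c * (x * y) = x * (fconst c * y)"
  by (metis fconst_commute mult.assoc)

lemma letters_zero: "letters 0 = []"
  by (simp add: zero_word_def)

lemma lin_fconst:
  fixes f :: "'g word \<Rightarrow> 'h falg"
  shows "lin f (fconst c * x) = fconst c * lin f x"
proof (induction x rule: poly_mapping_additive_induct)
  fix w :: "'g word" and d
  show "lin f (fconst c * Poly_Mapping.single w d) = fconst c * lin f (Poly_Mapping.single w d)"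
    by (simp add: fconst_def mult_single lin_single flip: mult.assoc)
qed (simp add: distrib_left lin_add)

context hecke_data
begin

text \<open>The entries of \<open>R M R\<^sup>-\<^sup>1 D R\<^sup>-\<^sup>1\<close>, with the entries of \<open>D\<close> replaced by given elements.\<close>

definition passed :: "('n \<Rightarrow> 'n \<Rightarrow> 'n gen falg) \<Rightarrow> 'n \<Rightarrow> 'n \<Rightarrow> 'n \<Rightarrow> 'n \<Rightarrow> 'n gen falg" where
  "passed X i j k l = (\<Sum>P\<in>UNIV. \<Sum>c\<in>UNIV. \<Sum>U\<in>UNIV. \<Sum>f\<in>UNIV.
     fconst (\<rho> (i, j) P) * (Mmat (fst P) c * (fconst (\<sigma> (c, snd P) U) * (fconst (\<sigma> (f, snd U) (k, l)) * X (fst U) f))))"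

text \<open>How \<open>\<partial>\<^sub>i\<^sup>p\<close> acts on a word: it passes the leading letters \<open>m\<close> by the homogeneous permutation
  relations, solved for \<open>\<partial>\<^sub>i\<^sup>p m\<^sub>s\<^sup>k\<close> by means of \<open>\<Psi>\<close>, and stops in front of the first \<open>\<partial>\<close>.\<close>

primrec dact :: "'n gen list \<Rightarrow> 'n \<Rightarrow> 'n \<Rightarrow> 'n gen falg" where
  "dact [] i p = word_mono [Dgen i p]"
| "dact (g # w) i p = (case g of
      Mgen t k \<Rightarrow> (\<Sum>j\<in>UNIV. \<Sum>l\<in>UNIV. fconst (\<psi> (l, t) (j, p)) * passed (dact w) i j k l)
    | Dgen a b \<Rightarrow> word_mono (Dgen i p # g # w))"

definition gact :: "'n gen \<Rightarrow> 'n gen falg \<Rightarrow> 'n gen falg" where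
  "gact g v = (case g of Mgen a b \<Rightarrow> fvar g * v | Dgen i p \<Rightarrow> lin (\<lambda>w. dact (letters w) i p) v)"

definition act :: "'n gen falg \<Rightarrow> 'n gen falg \<Rightarrow> 'n gen falg" where
  "act x v = lin (\<lambda>w. foldr gact (letters w) v) x"

lemma gact_add: "gact g (v + w) = gact g v + gact g w"
  by (cases g) (simp_all add: gact_def lin_add distrib_left)

lemma gact_fconst: "gact g (fconst c * v) = fconst c * gact g v"
  by (cases g) (simp_all add: gact_def lin_fconst fconst_left_swap)

lemma foldr_gact_add: "foldr gact u (v + w) = foldr gact u v + foldr gact u w"
  by (induction u) (simp_all add: gact_add)

lemma foldr_gact_fconst: "foldr gact u (fconst c * v) = fconst c * foldr gact u v"
  by (induction u) (simp_all add: gact_fconst)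

lemma act_add_left: "act (x + y) v = act x v + act y v"
  by (simp add: act_def lin_add)

lemma act_fconst_left: "act (fconst c * x) v = fconst c * act x v"
  by (simp add: act_def lin_fconst)

lemma act_mono: "act (word_mono u) v = foldr gact u v"
  by (simp add: act_def lin_single fconst_simps)

lemma act_add: "act x (v + w) = act x v + act x w"
  by (simp add: act_def lin_def foldr_gact_add distrib_left sum.distrib)

lemma act_fconst: "act x (fconst c * v) = fconst c * act x v"
  by (simp add: act_def lin_def foldr_gact_fconst sum_distrib_left fconst_left_swap[of c])

text \<open>Words act by composing the actions of their letters, so the free algebra acts with no
  relation to be checked.\<close>

lemma act_mult: "act (x * y) v = act x (act y v)"
proof (induction x rule: poly_mapping_additive_induct)
  case (1 w c)
  show ?case
  proof (induction y rule: poly_mapping_additive_induct)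
    case (1 u d)
    obtain W U where wu: "w = Word W" "u = Word U" by (cases w, cases u)
    have c: "Poly_Mapping.single (Word W) c = fconst c * word_mono W" and d: "Poly_Mapping.single (Word U) d = fconst d * word_mono U"
      and cd: "fconst c * word_mono W * (fconst d * word_mono U) = fconst (c * d) * word_mono (W @ U)"
      by (simp_all add: fconst_def mult_single plus_word_def letters_zero)
    have "act (fconst (c * d) * word_mono (W @ U)) v = fconst c * (fconst d * foldr gact W (foldr gact U v))"
      by (simp only: act_fconst_left act_mono foldr_append o_apply fconst_simps mult.assoc)
    also have "\<dots> = act (fconst c * word_mono W) (act (fconst d * word_mono U) v)"
      by (simp only: act_fconst_left act_fconst act_mono) (rule fconst_left_swap)
    finally show ?case unfolding wu c d cd .
  next
    case (2 x y)
    then show ?case by (simp add: distrib_left act_add_left act_add)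
  qed
next
  case (2 x y)
  then show ?case by (simp add: distrib_right act_add_left)
qed

lemma act_one: "act 1 v = v"
  using act_mono[of "[]" v] by (simp add: mono_Nil)

lemma act_zero: "act 0 v = 0" "act x 0 = 0"
  using act_fconst_left[of 0 0 v] act_fconst[of x 0 0] by (simp_all add: fconst_simps)

lemma act_sum_left: "act (sum f A) v = (\<Sum>i\<in>A. act (f i) v)"
  by (induction A rule: infinite_finite_induct) (simp_all add: act_zero act_add_left)

lemma act_minus: "act (- x) v = - act x v"
  using act_fconst_left[of "-1" x v] by (simp add: fconst_simps)

lemma act_diff: "act (x - y) v = act x v - act y v"
  using act_add_left[of x "- y" v] by (simp add: act_minus)

lemma act_Mmat: "act (Mmat a b) v = Mmat a b * v"
  unfolding Mmat_def fvar_def act_mono by (simp add: gact_def fvar_def)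

lemma act_Dmat_mono: "act (Dmat i p) (word_mono w) = dact w i p"
  unfolding Dmat_def fvar_def act_mono by (simp add: gact_def lin_single fconst_simps)

lemma act_Dmat_Mmat: "act (Dmat i p) (Mmat t k * v)
  = (\<Sum>j\<in>UNIV. \<Sum>l\<in>UNIV. fconst (\<psi> (l, t) (j, p)) * passed (\<lambda>d f. act (Dmat d f) v) i j k l)"
proof (induction v rule: poly_mapping_additive_induct)
  case (1 w c)
  obtain W where W: "w = Word W" by (cases w)
  have w: "Poly_Mapping.single w c = fconst c * word_mono W"
    by (simp add: W fconst_def mult_single)
  have "Mmat t k * Poly_Mapping.single w c = fconst c * word_mono (Mgen t k # W)"
    unfolding w fconst_left_swap[symmetric] Mmat_def fvar_mono ..
  then have "act (Dmat i p) (Mmat t k * Poly_Mapping.single w c) = fconst c * dact (Mgen t k # W) i p"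
    by (simp only: act_fconst act_Dmat_mono)
  also have "\<dots> = (\<Sum>j\<in>UNIV. \<Sum>l\<in>UNIV. fconst (\<psi> (l, t) (j, p)) *
      passed (\<lambda>d f. fconst c * act (Dmat d f) (word_mono W)) i j k l)"
    unfolding passed_def by (simp add: sum_distrib_left fconst_left_swap[of c] passed_def act_Dmat_mono)
  finally show ?case by (simp only: w act_fconst)
next
  case (2 x y)
  then show ?case
    by (simp add: distrib_left act_add passed_def sum.distrib)
qed

end

section \<open>Uniqueness of the normal ordering\<close>

context hecke_ideal
begin

context
  fixes M D :: 't
  assumes M: "at_first M" and D: "at_first D"
    and hom_perm: "D * r 0 * M \<doteq> r 0 * M * s 0 * D * s 0"
begin

text \<open>Braid relations and commutations on three sites, oriented as rewrite rules for
  right-associated words; they prove the word identities between applications of the permutation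
  relation.\<close>

lemma word_rules:
  "r 0 * (r 1 * (r 0 * x)) = r 1 * (r 0 * (r 1 * x))" "s 0 * (r 1 * (r 0 * x)) = r 1 * (r 0 * (s 1 * x))"
  "s 0 * (s 1 * (r 0 * x)) = r 1 * (s 0 * (s 1 * x))" "s 0 * (s 1 * r 0) = r 1 * (s 0 * s 1)"
  "r 0 * (s 1 * (s 0 * x)) = s 1 * (s 0 * (r 1 * x))"
  "s 0 * (s 1 * (s 0 * x)) = s 1 * (s 0 * (s 1 * x))" "s 0 * (s 1 * s 0) = s 1 * (s 0 * s 1)"
  "D * (r 1 * x) = r 1 * (D * x)" "D * (s 1 * x) = s 1 * (D * x)" "D * s 1 = s 1 * D"
  "r 1 * (M * x) = M * (r 1 * x)" "s 1 * (M * x) = M * (s 1 * x)" "s 1 * M = M * s 1"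
  using braid[of 0] braid_srr[of 0] braid_ssr[of 0] braid_rss[of 0] braid_sss[of 0]
    at_first_r[OF M, of 1] at_first_s[OF M, of 1] at_first_r[OF D, of 1] at_first_s[OF D, of 1]
  by (simp_all add: mult.assoc[symmetric])

text \<open>The overlap of the permutation relation with the reflection relation of M. D crosses
  both factors M of either term with the same braid words left over, so the relator itself
  reappears.\<close>

lemma D_pass_reflection:
  "D * r 0 * r 1 * (r 0 * M * r 0 * M - M * r 0 * M * r 0)
    \<doteq> r 0 * r 1 * (r 0 * M * r 0 * M - M * r 0 * M * r 0) * (s 1 * s 0 * D * s 0 * s 1)"
proof -
  note ctx = ceq_ctx[OF hom_perm]
  have "D * r 0 * r 1 * (r 0 * M * r 0 * M) = r 1 * (D * r 0 * M) * (r 1 * r 0 * M)"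
    by (simp only: mult.assoc word_rules)
  also have "\<dots> \<doteq> r 1 * (r 0 * M * s 0 * D * s 0) * (r 1 * r 0 * M)" by (rule ctx)
  also have "\<dots> = (r 1 * r 0 * M * s 0 * r 1) * (D * r 0 * M) * s 1"
    by (simp only: mult.assoc word_rules)
  also have "\<dots> \<doteq> (r 1 * r 0 * M * s 0 * r 1) * (r 0 * M * s 0 * D * s 0) * s 1" by (rule ctx)
  also have "\<dots> = r 0 * r 1 * (r 0 * M * r 0 * M) * (s 1 * s 0 * D * s 0 * s 1)"
    by (simp only: mult.assoc word_rules)
  finally have 1: "D * r 0 * r 1 * (r 0 * M * r 0 * M)
    \<doteq> r 0 * r 1 * (r 0 * M * r 0 * M) * (s 1 * s 0 * D * s 0 * s 1)" .
  have "D * r 0 * r 1 * (M * r 0 * M * r 0) = 1 * (D * r 0 * M) * (r 1 * r 0 * M * r 0)"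
    by (simp only: mult.assoc word_rules mult_1_left)
  also have "\<dots> \<doteq> 1 * (r 0 * M * s 0 * D * s 0) * (r 1 * r 0 * M * r 0)" by (rule ctx)
  also have "\<dots> = (r 0 * M * s 0 * r 1) * (D * r 0 * M) * (s 1 * r 0)"
    by (simp only: mult.assoc word_rules mult_1_left)
  also have "\<dots> \<doteq> (r 0 * M * s 0 * r 1) * (r 0 * M * s 0 * D * s 0) * (s 1 * r 0)" by (rule ctx)
  also have "\<dots> = r 0 * r 1 * (M * r 0 * M * r 0) * (s 1 * s 0 * D * s 0 * s 1)"
    by (simp only: mult.assoc word_rules)
  finally have 2: "D * r 0 * r 1 * (M * r 0 * M * r 0)
    \<doteq> r 0 * r 1 * (M * r 0 * M * r 0) * (s 1 * s 0 * D * s 0 * s 1)" .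
  show ?thesis using ceq_diff[OF 1 2] by (simp only: right_diff_distrib left_diff_distrib)
qed

text \<open>The other overlap: M crosses both factors D of the reflection relator, which again
  reappears between braid words.\<close>

lemma reflection_pass_M:
  "(s 0 * D * s 0 * D - D * s 0 * D * s 0) * r 1 * (r 0 * M)
    \<doteq> r 1 * r 0 * M * s 0 * s 1 * (s 0 * D * s 0 * D - D * s 0 * D * s 0) * s 1 * s 0"
proof -
  note ctx = ceq_ctx[OF hom_perm]
  have "(s 0 * D * s 0 * D) * r 1 * (r 0 * M) = (s 0 * D * s 0 * r 1) * (D * r 0 * M) * 1"
    by (simp only: mult.assoc word_rules mult_1_right)
  also have "\<dots> \<doteq> (s 0 * D * s 0 * r 1) * (r 0 * M * s 0 * D * s 0) * 1" by (rule ctx)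
  also have "\<dots> = (s 0 * r 1) * (D * r 0 * M) * (s 1 * s 0 * D * s 0)"
    by (simp only: mult.assoc word_rules mult_1_right)
  also have "\<dots> \<doteq> (s 0 * r 1) * (r 0 * M * s 0 * D * s 0) * (s 1 * s 0 * D * s 0)" by (rule ctx)
  also have "\<dots> = r 1 * r 0 * M * s 0 * s 1 * (s 0 * D * s 0 * D) * s 1 * s 0"
    by (simp only: mult.assoc word_rules)
  finally have 1: "(s 0 * D * s 0 * D) * r 1 * (r 0 * M)
    \<doteq> r 1 * r 0 * M * s 0 * s 1 * (s 0 * D * s 0 * D) * s 1 * s 0" .
  have "(D * s 0 * D * s 0) * r 1 * (r 0 * M) = (D * s 0 * r 1) * (D * r 0 * M) * s 1"
    by (simp only: mult.assoc word_rules)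
  also have "\<dots> \<doteq> (D * s 0 * r 1) * (r 0 * M * s 0 * D * s 0) * s 1" by (rule ctx)
  also have "\<dots> = r 1 * (D * r 0 * M) * (s 1 * s 0 * D * s 0 * s 1)"
    by (simp only: mult.assoc word_rules)
  also have "\<dots> \<doteq> r 1 * (r 0 * M * s 0 * D * s 0) * (s 1 * s 0 * D * s 0 * s 1)" by (rule ctx)
  also have "\<dots> = r 1 * r 0 * M * s 0 * s 1 * (D * s 0 * D * s 0) * s 1 * s 0"
    by (simp only: mult.assoc word_rules)
  finally have 2: "(D * s 0 * D * s 0) * r 1 * (r 0 * M)
    \<doteq> r 1 * r 0 * M * s 0 * s 1 * (D * s 0 * D * s 0) * s 1 * s 0" .
  show ?thesis using ceq_diff[OF 1 2] by (simp only: right_diff_distrib left_diff_distrib)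
qed

end

end

lemma tunit_at1:
  fixes X :: "'n::finite \<Rightarrow> 'n \<Rightarrow> 'a::ring_1"
  assumes ij: "i \<noteq> j"
  shows "tunit i a b * at1 j X = at1 j X * tunit i a b"
proof -
  have "tunit i a b * (lmul c * tunit j a' b') = (lmul c * tunit j a' b' * tunit i a b :: (nat \<Rightarrow> 'n, 'a) op)" for a' b' c
  proof -
    have "tunit i a b * (lmul c * tunit j a' b') = lmul c * (tunit i a b * tunit j a' b')"
      by (simp add: tunit_lmul flip: mult.assoc)
    then show ?thesis by (simp add: tunit_commute[OF ij] mult.assoc)
  qed
  then show ?thesis by (simp add: at1_def sum_distrib_left sum_distrib_right)
qed

section \<open>Stripping braid generators, and the relations as operators\<close>

context hecke_data
begin

abbreviation (input) MM :: "('n, 'n gen) tensor_op" where "MM \<equiv> at1 0 Mmat"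
abbreviation (input) DD :: "('n, 'n gen) tensor_op" where "DD \<equiv> at1 0 Dmat"

lemma triv_at1: "j \<noteq> i \<Longrightarrow> triv j (at1 i X)"
  by (simp add: triv_def tunit_at1)

lemma at_first_at1: "at_first (at1 0 X)"
  by (rule at_first_triv) (simp add: triv_at1)

text \<open>Contraction with \<psi> over the second site undoes \<open>r i\<close>. This writes a
  product of units on both sites through \<open>r i\<close> and units on the second site
  alone.\<close>

lemma two_site_unit:
  "tunit i y z * tunit (Suc i) b x = (\<Sum>j\<in>UNIV. \<Sum>l\<in>UNIV.
    sc (\<psi> (l, z) (j, y)) * (tunit (Suc i) b j * r i * tunit (Suc i) l x))"
proof -
  have inner: "tunit (Suc i) b j * r i * tunit (Suc i) l x = slice i \<rho> j l * tunit (Suc i) b x" for j l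
  proof -
    have "tunit (Suc i) b j * r i * tunit (Suc i) l x
      = (\<Sum>d\<in>UNIV. if d = l then slice i \<rho> j d * tunit (Suc i) b x else 0)"
      unfolding r_mx unit_pair_mx sum_distrib_right by (intro sum.cong refl) (simp add: mult.assoc tunit_mult)
    then show ?thesis by simp
  qed
  have "(\<Sum>j\<in>UNIV. \<Sum>l\<in>UNIV. sc (\<psi> (l, z) (j, y)) * slice i \<rho> j l)
    = (\<Sum>j\<in>UNIV. \<Sum>l\<in>UNIV. \<Sum>a\<in>UNIV. \<Sum>c\<in>UNIV. sc (\<rho> (a, j) (c, l) * \<psi> (l, z) (j, y)) * tunit i a c)"
    unfolding slice_def site.mx_def sum_distrib_left
    by (intro sum.cong refl) (simp add: site.sc_sc mult.commute)
  also have "\<dots> = (\<Sum>a\<in>UNIV. \<Sum>c\<in>UNIV. \<Sum>j\<in>UNIV. \<Sum>l\<in>UNIV. sc (\<rho> (a, j) (c, l) * \<psi> (l, z) (j, y)) * tunit i a c)"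
    by (rule sum_swap22)
  also have "\<dots> = (\<Sum>a\<in>UNIV. \<Sum>c\<in>UNIV. sc (if a = y \<and> z = c then 1 else 0) * tunit i a c)"
    unfolding skew.skew1[symmetric] by (simp add: sc_sum sum_distrib_right)
  also have "\<dots> = (\<Sum>a\<in>UNIV. if a = y then tunit i a z else 0)"
    by (intro sum.cong refl) (simp add: if_distrib[of sc] if_distribR sc_one sc_zero if_distrib[of "\<lambda>t. t * _"] cong: if_cong)
  finally have h: "(\<Sum>j\<in>UNIV. \<Sum>l\<in>UNIV. sc (\<psi> (l, z) (j, y)) * slice i \<rho> j l) = tunit i y z" by simp
  show ?thesis unfolding inner h[symmetric] by (simp only: sum_distrib_right mult.assoc)
qed

text \<open>A unit on site \<open>Suc i\<close> passes \<open>A\<close> and ends up outside, where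
  it keeps the entries in the subspace. Thus a relation containing \<open>r i\<close> yields one
  with a bare matrix unit in its place.\<close>

lemma recover:
  assumes V: "csubspace V" and A: "triv (Suc i) A"
    and mem: "\<And>l x. A * r i * tunit (Suc i) l x * B \<in> entries_in V"
  shows "A * (tunit i y z * tunit (Suc i) b x) * B \<in> entries_in V"
proof -
  have "A * (tunit i y z * tunit (Suc i) b x) * B = (\<Sum>j\<in>UNIV. \<Sum>l\<in>UNIV.
    sc (\<psi> (l, z) (j, y)) * (tunit (Suc i) b j * (A * r i * tunit (Suc i) l x * B)))"
    unfolding two_site_unit sum_distrib_left sum_distrib_right
  proof (intro sum.cong refl)
    fix j l
    have "A * (sc (\<psi> (l, z) (j, y)) * (tunit (Suc i) b j * r i * tunit (Suc i) l x)) * B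
      = sc (\<psi> (l, z) (j, y)) * ((A * tunit (Suc i) b j) * r i * tunit (Suc i) l x * B)"
      by (simp only: mult.assoc sc_left_commute[of A])
    also have "A * tunit (Suc i) b j = tunit (Suc i) b j * A" using A by (simp add: triv_def)
    finally show "A * (sc (\<psi> (l, z) (j, y)) * (tunit (Suc i) b j * r i * tunit (Suc i) l x)) * B
      = sc (\<psi> (l, z) (j, y)) * (tunit (Suc i) b j * (A * r i * tunit (Suc i) l x * B))"
      by (simp only: mult.assoc)
  qed
  then show ?thesis by (auto intro!: entries_in_sum entries_in_sc entries_in_tunit V mem)
qed

lemma recover_right:
  assumes V: "csubspace V" and B: "triv (Suc i) B"
    and mem: "\<And>b j. A * tunit (Suc i) b j * r i * B \<in> entries_in V"
  shows "A * (tunit i y z * tunit (Suc i) b x) * B \<in> entries_in V"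
proof -
  have "A * (tunit i y z * tunit (Suc i) b x) * B = (\<Sum>j\<in>UNIV. \<Sum>l\<in>UNIV.
    sc (\<psi> (l, z) (j, y)) * ((A * tunit (Suc i) b j * r i * B) * tunit (Suc i) l x))"
    unfolding two_site_unit sum_distrib_left sum_distrib_right
  proof (intro sum.cong refl)
    fix j l
    have "A * (sc (\<psi> (l, z) (j, y)) * (tunit (Suc i) b j * r i * tunit (Suc i) l x)) * B
      = sc (\<psi> (l, z) (j, y)) * (A * tunit (Suc i) b j * r i * (tunit (Suc i) l x * B))"
      by (simp only: mult.assoc sc_left_commute[of A])
    also have "tunit (Suc i) l x * B = B * tunit (Suc i) l x" using B by (simp add: triv_def)
    finally show "A * (sc (\<psi> (l, z) (j, y)) * (tunit (Suc i) b j * r i * tunit (Suc i) l x)) * B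
      = sc (\<psi> (l, z) (j, y)) * ((A * tunit (Suc i) b j * r i * B) * tunit (Suc i) l x)"
      by (simp only: mult.assoc)
  qed
  then show ?thesis by (auto intro!: entries_in_sum entries_in_sc entries_in_tunit V mem)
qed

lemma recover_both:
  assumes V: "csubspace V" and AB: "triv (Suc i) A" "triv (Suc i) B" and mem: "A * r i * B \<in> entries_in V"
  shows "A * tunit i y z * B \<in> entries_in V"
proof -
  have "A * r i * tunit (Suc i) l x * B \<in> entries_in V" for l x
  proof -
    have "A * r i * tunit (Suc i) l x * B = (A * r i * B) * tunit (Suc i) l x"
      using AB(2) by (simp add: triv_def mult.assoc)
    then show ?thesis using entries_in_tunit(2)[OF V mem] by simp
  qed
  then have "A * (tunit i y z * tunit (Suc i) c c) * B \<in> entries_in V" for c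
    by (rule recover[OF V AB(1)])
  then have "(\<Sum>c\<in>UNIV. A * (tunit i y z * tunit (Suc i) c c) * B) \<in> entries_in V"
    by (intro entries_in_sum V)
  also have "(\<Sum>c\<in>UNIV. A * (tunit i y z * tunit (Suc i) c c) * B) = A * (tunit i y z * (\<Sum>c\<in>UNIV. tunit (Suc i) c c)) * B"
    by (simp add: sum_distrib_left sum_distrib_right)
  finally show ?thesis by (simp add: tunit_sum)
qed

definition M_refl :: "('n, 'n gen) tensor_op" where "M_refl = r 0 * MM * r 0 * MM - MM * r 0 * MM * r 0"
definition D_refl :: "('n, 'n gen) tensor_op" where "D_refl = s 0 * DD * s 0 * DD - DD * s 0 * DD * s 0"
definition hom_perm :: "('n, 'n gen) tensor_op" where "hom_perm = DD * r 0 * MM - r 0 * MM * s 0 * DD * s 0"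

lemma triv_refl: "2 \<le> j \<Longrightarrow> triv j M_refl" "2 \<le> j \<Longrightarrow> triv j D_refl"
proof -
  have diff: "triv j A \<Longrightarrow> triv j B \<Longrightarrow> triv j (A - B)" for A B
    by (simp add: triv_def left_diff_distrib right_diff_distrib)
  show "2 \<le> j \<Longrightarrow> triv j M_refl" "2 \<le> j \<Longrightarrow> triv j D_refl"
    unfolding M_refl_def D_refl_def by (auto intro!: diff triv_mult triv_r triv_s triv_at1)
qed

definition M_tmat :: "('n, 'n gen falg) tmat" where
  "M_tmat = (let R1 = scal (at_pair 1 R); M1 = at_site 1 Mmat in
     (\<lambda>a b. tprod 2 [R1, M1, R1, M1] a b - tprod 2 [M1, R1, M1, R1] a b))"

definition D_tmat :: "('n, 'n gen falg) tmat" where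
  "D_tmat = (let S1 = scal (at_pair 1 S); D1 = at_site 1 Dmat in
     (\<lambda>a b. tprod 2 [S1, D1, S1, D1] a b - tprod 2 [D1, S1, D1, S1] a b))"

lemma emb_one: "emb 0 2 (scal (at_pair (Suc 0) A)) = at2 0 A" "emb 0 2 (at_site (Suc 0) X) = at1 0 X"
  using emb_at_pair[of 1 2 0 A] emb_at_site[of 1 2 0 X] by simp_all

lemma emb_M_tmat: "emb 0 2 M_tmat = M_refl" and emb_D_tmat: "emb 0 2 D_tmat = D_refl"
  by (simp_all add: M_tmat_def D_tmat_def Let_def emb_diff emb_tprod emb_one M_refl_def D_refl_def mult.assoc)

lemma M_relators_eq: "M_relators R = {M_tmat a b | a b. a \<in> idx 2 \<and> b \<in> idx 2}"
  and D_relators_eq: "D_relators R = {D_tmat a b | a b. a \<in> idx 2 \<and> b \<in> idx 2}"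
  by (simp_all add: M_relators_def D_relators_def M_tmat_def D_tmat_def Let_def relators_def)

lemma ent_emb_mem: "a \<in> idx k \<Longrightarrow> b \<in> idx k \<Longrightarrow> ent (emb 0 k X) (put_slice u 0 a) (put_slice u 0 b) = X a b"
  by (simp add: ent_emb)

lemma emb_entries_in:
  assumes "csubspace V" "\<And>a b. a \<in> idx k \<Longrightarrow> b \<in> idx k \<Longrightarrow> X a b \<in> V"
  shows "emb 0 k X \<in> entries_in V"
  using assms by (simp add: entries_in_def ent_emb csubspace_def)

lemma M_refl_entries: "csubspace V \<Longrightarrow> M_relators R \<subseteq> V \<Longrightarrow> M_refl \<in> entries_in V"
  and D_refl_entries: "csubspace V \<Longrightarrow> D_relators R \<subseteq> V \<Longrightarrow> D_refl \<in> entries_in V"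
  unfolding emb_M_tmat[symmetric] emb_D_tmat[symmetric] M_relators_eq D_relators_eq
  by (auto intro!: emb_entries_in)

lemma hom_perm_entries:
  assumes "csubspace V" "hom_permutation_relators R \<subseteq> V" shows "hom_perm \<in> entries_in V"
proof -
  have "emb 0 2 (tprod 2 [at_site 1 Dmat, scal (at_pair 1 R), at_site 1 Mmat])
    - emb 0 2 (tprod 2 [scal (at_pair 1 R), at_site 1 Mmat, scal (at_pair 1 S), at_site 1 Dmat, scal (at_pair 1 S)])
    \<in> entries_in V"
    using assms by (intro emb_relators) (simp_all add: hom_permutation_relators_def Let_def)
  then show ?thesis by (simp add: emb_tprod emb_one hom_perm_def mult.assoc)
qed

end

lemma sum_rotate5:
  "(\<Sum>k\<in>K. \<Sum>a\<in>A. \<Sum>b\<in>B. \<Sum>c\<in>C. \<Sum>d\<in>D. g k a b c d) =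
   (\<Sum>a\<in>A. \<Sum>b\<in>B. \<Sum>c\<in>C. \<Sum>d\<in>D. \<Sum>k\<in>K. g k a b c d)"
  by (subst sum.swap, intro sum.cong refl)+

lemma fconst_right: "x * (fconst c * y) = fconst c * (x * y)"
  by (rule fconst_left_swap[symmetric])

section \<open>The homogeneous permutation relations act as zero; vectors on which D acts by
  multiplication\<close>

context hecke_data
begin

text \<open>The annihilator of the module.\<close>

definition killed :: "'n gen falg set" where "killed = {x. \<forall>v. act x v = 0}"

lemma killed_ideal: "ring_ideal killed"
  by unfold_locales (auto simp: killed_def act_zero act_diff act_mult)

lemma killed_subspace: "csubspace killed"
  by (rule ring_ideal_subspace[OF killed_ideal])

lemma passed_in:
  assumes "csubspace V" "\<And>a b x. x \<in> V \<Longrightarrow> Mmat a b * x \<in> V" "\<And>d f. X d f \<in> V"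
  shows "passed X i j k l \<in> V"
proof -
  have sc: "fconst c * x \<in> V" if "x \<in> V" for c x using assms(1) that by (simp add: csubspace_def)
  show ?thesis unfolding passed_def by (intro subspace_sum assms(1) sc assms(2,3))
qed

lemma act_scalar: "act (fconst c) v = fconst c * v"
  using act_fconst_left[of c 1 v] by (simp add: act_one)

lemma act_passed: "act (passed Dmat i j k l) v = passed (\<lambda>d f. act (Dmat d f) v) i j k l"
  by (simp add: passed_def act_sum_left act_scalar act_mult act_Mmat)

text \<open>The action of D on a letter m was defined by solving the permutation relation with
  \<psi>; multiplication by \<rho> cancels that \<psi> by \<open>skew2\<close>.\<close>

lemma act_D_r_M:
  "act (\<Sum>t\<in>UNIV. \<Sum>p\<in>UNIV. fconst (\<rho> (p, j) (t, l)) * (Dmat i p * Mmat t k)) v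
    = passed (\<lambda>d f. act (Dmat d f) v) i j k l"
proof -
  let ?Y = "\<lambda>j l. passed (\<lambda>d f. act (Dmat d f) v) i j k l"
  have "act (\<Sum>t\<in>UNIV. \<Sum>p\<in>UNIV. fconst (\<rho> (p, j) (t, l)) * (Dmat i p * Mmat t k)) v
    = (\<Sum>t\<in>UNIV. \<Sum>p\<in>UNIV. \<Sum>j'\<in>UNIV. \<Sum>l'\<in>UNIV. fconst (\<psi> (l', t) (j', p) * \<rho> (p, j) (t, l)) * ?Y j' l')"
    unfolding act_sum_left act_mult act_scalar act_Mmat act_Dmat_Mmat sum_distrib_left
    by (intro sum.cong refl) (simp only: fconst_simps mult.assoc, rule fconst_left_swap)
  also have "\<dots> = (\<Sum>j'\<in>UNIV. \<Sum>l'\<in>UNIV. fconst (\<Sum>t\<in>UNIV. \<Sum>p\<in>UNIV. \<psi> (l', t) (j', p) * \<rho> (p, j) (t, l)) * ?Y j' l')"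
    by (subst sum_swap22) (simp add: fconst_sum sum_distrib_right)
  also have "\<dots> = (\<Sum>j'\<in>UNIV. \<Sum>l'\<in>UNIV. if l' = l then if j = j' then ?Y j' l' else 0 else 0)"
    unfolding skew.skew2 by (intro sum.cong refl) (simp add: fconst_simps)
  finally show ?thesis by simp
qed

lemma app_D_r_M: "app (DD * r 0 * MM) v x = (\<Sum>K\<in>UNIV.
    (\<Sum>t\<in>UNIV. \<Sum>p\<in>UNIV. fconst (\<rho> (p, x 1) (t, snd K)) * (Dmat (x 0) p * Mmat t (fst K)))
      * v (x(0 := fst K, Suc 0 := snd K)))"
proof -
  have upd: "x(0 := p, 0 := a, Suc 0 := b, 0 := c) = x(0 := c, Suc 0 := b)" for a b c p
    by (auto simp: fun_eq_iff)
  have "app (DD * r 0 * MM) v x = (\<Sum>p\<in>UNIV. \<Sum>t\<in>UNIV. \<Sum>l\<in>UNIV. \<Sum>k\<in>UNIV.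
      fconst (\<rho> (p, x 1) (t, l)) * (Dmat (x 0) p * Mmat t k) * v (x(0 := k, Suc 0 := l)))"
    by (simp add: app_at1 app_at2 \<rho>_def sum_UNIV_prod sum_distrib_left upd fconst_right mult.assoc fun_upd_twist[of "Suc 0" 0])
  also have "\<dots> = (\<Sum>t\<in>UNIV. \<Sum>p\<in>UNIV. \<Sum>l\<in>UNIV. \<Sum>k\<in>UNIV.
      fconst (\<rho> (p, x 1) (t, l)) * (Dmat (x 0) p * Mmat t k) * v (x(0 := k, Suc 0 := l)))"
    by (rule sum.swap)
  also have "\<dots> = (\<Sum>l\<in>UNIV. \<Sum>k\<in>UNIV. \<Sum>t\<in>UNIV. \<Sum>p\<in>UNIV.
      fconst (\<rho> (p, x 1) (t, l)) * (Dmat (x 0) p * Mmat t k) * v (x(0 := k, Suc 0 := l)))"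
    by (rule sum_swap22)
  also have "\<dots> = (\<Sum>k\<in>UNIV. \<Sum>l\<in>UNIV. \<Sum>t\<in>UNIV. \<Sum>p\<in>UNIV.
      fconst (\<rho> (p, x 1) (t, l)) * (Dmat (x 0) p * Mmat t k) * v (x(0 := k, Suc 0 := l)))"
    by (rule sum.swap)
  finally show ?thesis by (simp add: sum_UNIV_prod sum_distrib_right)
qed

lemma app_passed: "app (r 0 * MM * s 0 * DD * s 0) v x =
    (\<Sum>K\<in>UNIV. passed Dmat (x 0) (x 1) (fst K) (snd K) * v (x(0 := fst K, Suc 0 := snd K)))"
proof -
  have upd: "x(0 := a, Suc 0 := b, 0 := c, 0 := a', Suc 0 := b', 0 := c', 0 := a'', Suc 0 := b'') = x(0 := a'', Suc 0 := b'')"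
    for a b c a' b' c' a'' b'' by (auto simp: fun_eq_iff)
  have "app (r 0 * MM * s 0 * DD * s 0) v x
    = (\<Sum>P\<in>UNIV. \<Sum>c\<in>UNIV. \<Sum>U\<in>UNIV. \<Sum>f\<in>UNIV. \<Sum>K\<in>UNIV. fconst (\<rho> (x 0, x 1) P) * (Mmat (fst P) c *
      (fconst (\<sigma> (c, snd P) U) * (fconst (\<sigma> (f, snd U) K) * (Dmat (fst U) f * v (x(0 := fst K, Suc 0 := snd K)))))))"
    by (simp add: app_at1 app_at2 \<rho>_def \<sigma>_def sum_distrib_left upd fconst_right[of "Dmat _ _"])
  also have "\<dots> = (\<Sum>K\<in>UNIV. \<Sum>P\<in>UNIV. \<Sum>c\<in>UNIV. \<Sum>U\<in>UNIV. \<Sum>f\<in>UNIV. fconst (\<rho> (x 0, x 1) P) * (Mmat (fst P) c *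
      (fconst (\<sigma> (c, snd P) U) * (fconst (\<sigma> (f, snd U) K) * (Dmat (fst U) f * v (x(0 := fst K, Suc 0 := snd K)))))))"
    by (rule sum_rotate5[symmetric])
  finally show ?thesis by (simp add: passed_def sum_distrib_right mult.assoc)
qed

lemma hom_perm_killed: "hom_perm \<in> entries_in killed"
proof -
  interpret ring_ideal killed by (rule killed_ideal)
  have "app hom_perm v x \<in> killed" for v x
  proof -
    let ?a = "\<lambda>K. \<Sum>t\<in>UNIV. \<Sum>p\<in>UNIV. fconst (\<rho> (p, x 1) (t, snd K)) * (Dmat (x 0) p * Mmat t (fst K))"
    let ?b = "\<lambda>K. passed Dmat (x 0) (x 1) (fst K) (snd K)"
    have "app hom_perm v x = (\<Sum>K\<in>UNIV. (?a K - ?b K) * v (x(0 := fst K, Suc 0 := snd K)))"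
      unfolding hom_perm_def app_simps(5) app_D_r_M app_passed by (simp add: sum_subtractf left_diff_distrib)
    moreover have "?a K - ?b K \<in> killed" for K
      by (simp add: killed_def act_diff act_D_r_M act_passed)
    ultimately show ?thesis by (simp add: subspace_sum[OF killed_subspace] mult_right_mem)
  qed
  then show ?thesis by (simp add: entries_in_def ent_def)
qed

lemma hom_relators_killed: "hom_permutation_relators R \<subseteq> killed"
proof
  fix g assume "g \<in> hom_permutation_relators R"
  then obtain x y where "g = ent (emb 0 2 (tprod 2 [at_site 1 Dmat, scal (at_pair 1 R), at_site 1 Mmat])
    - emb 0 2 (tprod 2 [scal (at_pair 1 R), at_site 1 Mmat, scal (at_pair 1 S), at_site 1 Dmat, scal (at_pair 1 S)])) x y"
    unfolding hom_permutation_relators_def Let_def using relators_ent by blast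
  then have "g = ent hom_perm x y" by (simp add: emb_tprod emb_one hom_perm_def mult.assoc)
  then show "g \<in> killed" using hom_perm_killed by (simp add: entries_in_def)
qed

text \<open>Vectors on which D acts by plain multiplication. They include 1 and everything that
  starts with an entry of D.\<close>

definition stop :: "'n gen falg set" where
  "stop = {u. \<forall>i p. act (Dmat i p) u = Dmat i p * u}"

lemma stop_subspace: "csubspace stop"
  by (rule subspaceI) (auto simp: stop_def act_zero act_add act_fconst distrib_left fconst_left_swap)

lemma Dmat_mono: "Dmat a b * word_mono w = word_mono (Dgen a b # w)"
  by (simp only: Dmat_def fvar_mono)

lemma one_stop: "1 \<in> stop"
  unfolding stop_def mono_Nil[symmetric] by (simp only: mem_Collect_eq act_Dmat_mono Dmat_mono dact.simps) simp

lemma D_stop: "Dmat a b * y \<in> stop"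
proof -
  have word: "word_mono (Dgen a b # w) \<in> stop" for w
    unfolding stop_def by (simp only: mem_Collect_eq act_Dmat_mono Dmat_mono dact.simps) simp
  show ?thesis
  proof (induction y rule: falg_induct)
    case (1 x y)
    then show ?case using stop_subspace by (simp add: distrib_left csubspace_def)
  next
    case (2 c x)
    then show ?case using stop_subspace by (simp add: csubspace_def fconst_right)
  qed (simp_all only: Dmat_mono word)
qed

definition M_alg :: "'n gen falg set" where "M_alg = {x. \<forall>v. act x v = x * v}"
text \<open>Invariance of \<open>stop\<close> is part of the condition because it makes the set
  closed under products.\<close>

definition D_alg :: "'n gen falg set" where "D_alg = {x. \<forall>u\<in>stop. act x u = x * u \<and> x * u \<in> stop}"

lemma M_alg_subalgebra: "subalgebra M_alg"
  unfolding subalgebra_def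
  by (auto intro!: subspaceI simp: M_alg_def act_zero act_add_left act_scalar act_one act_mult distrib_right mult.assoc)

lemma D_alg_subalgebra: "subalgebra D_alg"
proof -
  have "0 \<in> stop" "u + v \<in> stop" "fconst c * u \<in> stop" if "u \<in> stop" "v \<in> stop" for u v c
    using stop_subspace that by (auto simp: csubspace_def)
  then show ?thesis
    unfolding subalgebra_def
    by (auto intro!: subspaceI simp: D_alg_def act_zero act_add_left act_scalar act_one act_mult distrib_right mult.assoc)
qed

lemma Mmat_M_alg: "Mmat a b \<in> M_alg"
  by (simp add: M_alg_def act_Mmat)

lemma Dmat_D_alg: "Dmat a b \<in> D_alg"
  by (simp add: D_alg_def D_stop) (simp add: stop_def)

lemma refl_alg: "M_refl \<in> entries_in M_alg" "D_refl \<in> entries_in D_alg"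
proof -
  have M: "MM \<in> entries_in M_alg" and D: "DD \<in> entries_in D_alg"
    using M_alg_subalgebra D_alg_subalgebra
    by (auto intro!: entries_in_at1 Mmat_M_alg Dmat_D_alg simp: subalgebra_def)
  have "csubspace M_alg" "csubspace D_alg" using M_alg_subalgebra D_alg_subalgebra by (auto simp: subalgebra_def)
  then show "M_refl \<in> entries_in M_alg" "D_refl \<in> entries_in D_alg"
    unfolding M_refl_def D_refl_def
    using M_alg_subalgebra D_alg_subalgebra M D
    by (auto intro!: entries_in_diff entries_in_mult subalgebra_at2)
qed

lemma emb_entries:
  assumes "emb 0 k X \<in> entries_in V" "a \<in> idx k" "b \<in> idx k" shows "X a b \<in> V"
proof -
  have "ent (emb 0 k X) (put_slice u 0 a) (put_slice u 0 b) \<in> V" for u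
    using assms(1) by (simp add: entries_in_def)
  then show ?thesis using assms(2,3) by (simp add: ent_emb_mem)
qed

lemma M_relators_alg: "M_relators R \<subseteq> M_alg" and D_relators_alg: "D_relators R \<subseteq> D_alg"
  using emb_entries[of 2 M_tmat] emb_entries[of 2 D_tmat] refl_alg
  by (auto simp: emb_M_tmat emb_D_tmat M_relators_eq D_relators_eq)

text \<open>Up to scalars, each term of a relator of D starts with an entry of D, and such products
  lie in \<open>stop\<close>.\<close>

lemma D_relators_stop: "g \<in> D_relators R \<Longrightarrow> g * z \<in> stop"
proof -
  let ?V = "{x. \<forall>z. x * z \<in> stop}"
  have V: "csubspace ?V"
    using stop_subspace by (auto intro!: subspaceI simp: csubspace_def distrib_right mult.assoc)
  have right: "x * y \<in> ?V" if "x \<in> ?V" for x y using that by (simp add: mult.assoc)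
  have D: "DD \<in> entries_in ?V" by (rule entries_in_at1[OF V]) (simp add: D_stop)
  have "s 0 * (DD * (s 0 * DD)) - DD * (s 0 * DD * s 0) \<in> entries_in ?V"
    by (intro entries_in_diff V entries_in_at2 entries_in_mult_right[OF V right] D)
  then have "D_refl \<in> entries_in ?V" by (simp add: D_refl_def mult.assoc)
  then have "D_tmat a b \<in> ?V" if "a \<in> idx 2" "b \<in> idx 2" for a b
    using emb_entries[OF _ that] by (simp only: emb_D_tmat[symmetric])
  then show "g \<in> D_relators R \<Longrightarrow> g * z \<in> stop" unfolding D_relators_eq by blast
qed

text \<open>The permutation relations are left out, so this ideal lies in that of the double as well
  as in the homogeneous one. It is the link between the two.\<close>

definition reflection_ideal :: "'n gen falg set" where
  "reflection_ideal = fideal (M_relators R \<union> D_relators R)"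

lemma reflection_ideal: "ring_ideal reflection_ideal"
  unfolding reflection_ideal_def by (rule fideal_ring_ideal)

lemma relators_reflection_ideal: "M_relators R \<subseteq> reflection_ideal" "D_relators R \<subseteq> reflection_ideal"
  using fideal_self[of "M_relators R \<union> D_relators R"] by (auto simp: reflection_ideal_def)

end

lemma app_emb_splice:
  assumes "a \<in> idx k"
  shows "app (emb m k X) v (put_slice u m a) = (\<Sum>b\<in>idx k. X a b * v (put_slice u m b))"
  unfolding app_emb using assms by (intro sum.cong refl) simp

section \<open>Compatibility of the action with the reflection relations\<close>

context hecke_data
begin

text \<open>Elements that act as zero modulo the reflection relations. Closure under right
  multiplication is immediate; closure under left multiplication needs
  \<open>act_reflection_ideal\<close>.\<close>

definition absorbed :: "'n gen falg set" where
  "absorbed = {x. \<forall>v. act x v \<in> reflection_ideal}"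

lemma absorbed_subspace: "csubspace absorbed"
  using ring_ideal_subspace[OF reflection_ideal]
  by (auto intro!: subspaceI simp: absorbed_def act_zero act_add_left act_fconst_left csubspace_def)

lemma M_relators_act: "g \<in> M_relators R \<Longrightarrow> act g v = g * v"
  using M_relators_alg unfolding M_alg_def by blast

lemma D_relators_act: "g \<in> D_relators R \<Longrightarrow> u \<in> stop \<Longrightarrow> act g u = g * u"
  using D_relators_alg unfolding D_alg_def by blast

lemma M_relators_absorbed: "M_relators R \<subseteq> absorbed"
proof
  fix g assume g: "g \<in> M_relators R"
  then have "g * v \<in> reflection_ideal" for v
    using relators_reflection_ideal(1) ring_ideal.mult_right_mem[OF reflection_ideal] by blast
  then show "g \<in> absorbed" by (simp add: absorbed_def M_relators_act[OF g])
qed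

lemma killed_absorbed: "killed \<subseteq> absorbed"
  using ring_ideal.zero_mem[OF reflection_ideal] by (simp add: killed_def absorbed_def subset_iff)

lemma hom_perm_congruence:
  "ring_ideal.ceq (entries_in killed) (DD * r 0 * MM) (r 0 * MM * s 0 * DD * s 0)"
  using hom_perm_killed
  by (simp add: ring_ideal.ceq_def[OF entries_in_ideal[OF killed_ideal]] hom_perm_def)

lemma hecke_ideal_entries: "ring_ideal J \<Longrightarrow> hecke_ideal r s sc lam (entries_in J)"
  using entries_in_ideal hecke_axioms by (intro hecke_ideal.intro)

lemma ceq_entries_in:
  assumes "csubspace V" "ring_ideal J" "ring_ideal.ceq (entries_in J) X Y" "J \<subseteq> V" "Y \<in> entries_in V"
  shows "X \<in> entries_in V"
proof -
  have "X - Y \<in> entries_in J"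
    using assms(3) by (simp only: ring_ideal.ceq_def[OF entries_in_ideal[OF assms(2)]])
  then have "X - Y \<in> entries_in V" using assms(4) by (auto simp: entries_in_def)
  then have "(X - Y) + Y \<in> entries_in V"
    using assms(1,5) by (simp only: entries_in_def mem_Collect_eq ent_simps csubspace_def) blast
  then show ?thesis by simp
qed

text \<open>By \<open>D_pass_reflection\<close>, D followed by the relator agrees, between braid
  generators, with an expression in which the relator comes first, and that one is absorbed. The
  skew inverse then removes the generators.\<close>

lemma D_M_relator_absorbed:
  assumes "a \<in> idx 2" "b \<in> idx 2" shows "Dmat i p * M_tmat a b \<in> absorbed"
proof -
  have right: "x * y \<in> absorbed" if "x \<in> absorbed" for x y
    using that by (simp add: absorbed_def act_mult)
  have E: "M_refl \<in> entries_in absorbed" by (rule M_refl_entries[OF absorbed_subspace M_relators_absorbed])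
  have "DD * r 0 * r 1 * M_refl \<in> entries_in absorbed"
  proof (rule ceq_entries_in[OF absorbed_subspace killed_ideal])
    show "ring_ideal.ceq (entries_in killed) (DD * r 0 * r 1 * M_refl)
        (r 0 * r 1 * M_refl * (s 1 * s 0 * DD * s 0 * s 1))"
      unfolding M_refl_def
      by (rule hecke_ideal.D_pass_reflection[OF hecke_ideal_entries[OF killed_ideal] at_first_at1 at_first_at1 hom_perm_congruence])
    show "killed \<subseteq> absorbed" by (rule killed_absorbed)
    have "r 0 * (r 1 * (M_refl * (s 1 * s 0 * DD * s 0 * s 1))) \<in> entries_in absorbed"
      by (intro entries_in_at2 absorbed_subspace entries_in_mult_right[OF absorbed_subspace right E])
    then show "r 0 * r 1 * M_refl * (s 1 * s 0 * DD * s 0 * s 1) \<in> entries_in absorbed"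
      by (simp only: mult.assoc)
  qed
  \<comment> \<open>First \<open>r 1\<close> and then \<open>r 0\<close> is replaced by matrix
    units.\<close>
  then have "DD * r 0 * at2 (Suc 0) R * M_refl \<in> entries_in absorbed" by simp
  then have "DD * r 0 * tunit (Suc 0) l x * M_refl \<in> entries_in absorbed" for l x
    by (rule recover_both[OF absorbed_subspace, rotated 2]) (auto intro!: triv_mult triv_r triv_at1 triv_refl)
  then have mem: "DD * (tunit 0 y z * tunit (Suc 0) b x) * M_refl \<in> entries_in absorbed" for y z b x
    by (rule recover[OF absorbed_subspace, rotated]) (simp add: triv_at1)
  define u :: "nat \<Rightarrow> 'n" where "u = put_slice (\<lambda>_. undefined) 0 a"
  define w :: "nat \<Rightarrow> 'n" where "w = put_slice (\<lambda>_. undefined) 0 b"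
  \<comment> \<open>The units select column \<open>p\<close> of D and reset the multi-index to
    \<open>u\<close>, so this entry is the single product that is wanted.\<close>
  have "ent (DD * (tunit 0 p (u 0) * tunit (Suc 0) (u 1) (u 1)) * M_refl) (u(0 := i)) w \<in> absorbed"
    using mem by (simp add: entries_in_def)
  also have "ent (DD * (tunit 0 p (u 0) * tunit (Suc 0) (u 1) (u 1)) * M_refl) (u(0 := i)) w
    = (\<Sum>c\<in>UNIV. if c = p then Dmat i c * ent M_refl u w else 0)"
    unfolding mult.assoc app_at1_delta by (intro sum.cong refl) (simp add: ent_tunit_left)
  also have "\<dots> = Dmat i p * M_tmat a b"
    using ent_emb_mem[OF assms, of M_tmat] by (simp add: emb_M_tmat u_def w_def)
  finally show ?thesis .
qed

text \<open>Inductive step along a word: by \<open>reflection_pass_M\<close> the letter m moves to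
  the left of the relator, which then acts on the shorter word.\<close>

lemma D_relator_M_step:
  assumes hyp: "\<And>g. g \<in> D_relators R \<Longrightarrow> act g w \<in> reflection_ideal" and g: "g \<in> D_relators R"
  shows "act g (Mmat z k * w) \<in> reflection_ideal"
proof -
  \<comment> \<open>With \<open>w\<close> fixed this is only a subspace, closed under left
    multiplication by entries of M; \<open>reflection_pass_M\<close> needs no more, since only
    scalars stand to the right of the relator.\<close>
  define V where "V = {x. act x w \<in> reflection_ideal}"
  have V: "csubspace V"
    using ring_ideal_subspace[OF reflection_ideal]
    by (auto intro!: subspaceI simp: V_def act_zero act_add_left act_fconst_left csubspace_def)
  have left: "Mmat a b * x \<in> V" if "x \<in> V" for a b x
    using that ring_ideal.mult_left_mem[OF reflection_ideal] by (simp add: V_def act_mult act_Mmat)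
  have F: "D_refl \<in> entries_in V" using hyp by (intro D_refl_entries V) (auto simp: V_def)
  have "D_refl * r 1 * (r 0 * MM) \<in> entries_in V"
  proof (rule ceq_entries_in[OF V killed_ideal])
    show "ring_ideal.ceq (entries_in killed) (D_refl * r 1 * (r 0 * MM))
        (r 1 * r 0 * MM * s 0 * s 1 * D_refl * s 1 * s 0)"
      unfolding D_refl_def
      by (rule hecke_ideal.reflection_pass_M[OF hecke_ideal_entries[OF killed_ideal] at_first_at1 at_first_at1 hom_perm_congruence])
    show "killed \<subseteq> V"
      using ring_ideal.zero_mem[OF reflection_ideal] by (simp add: killed_def V_def subset_iff)
    have "r 1 * (r 0 * (MM * (s 0 * (s 1 * (D_refl * s 1 * s 0))))) \<in> entries_in V"
      by (intro entries_in_at2 entries_in_at1_left V left F)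
    then show "r 1 * r 0 * MM * s 0 * s 1 * D_refl * s 1 * s 0 \<in> entries_in V"
      by (simp only: mult.assoc)
  qed
  then have "D_refl * at2 (Suc 0) R * (r 0 * MM) \<in> entries_in V" by simp
  then have "D_refl * tunit (Suc 0) y z * (r 0 * MM) \<in> entries_in V" for y z
    by (rule recover_both[OF V, rotated 2]) (auto intro!: triv_mult triv_r triv_at1 triv_refl)
  then have "D_refl * tunit (Suc 0) y z * r 0 * MM \<in> entries_in V" for y z
    by (simp only: mult.assoc)
  then have mem: "D_refl * (tunit 0 y z * tunit (Suc 0) b x) * MM \<in> entries_in V" for y z b x
    by (rule recover_right[OF V, rotated]) (simp add: triv_at1)
  obtain a b where ab: "a \<in> idx 2" "b \<in> idx 2" "g = D_tmat a b" using g by (auto simp: D_relators_eq)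
  define u :: "nat \<Rightarrow> 'n" where "u = put_slice (\<lambda>_. undefined) 0 a"
  define t :: "nat \<Rightarrow> 'n" where "t = put_slice (\<lambda>_. undefined) 0 b"
  have nth: "put_slice (\<lambda>_. undefined) 0 c 0 = c ! 0" "put_slice (\<lambda>_. undefined) 0 c (Suc 0) = c ! 1" if "c \<in> idx 2" for c
    using that by (simp_all add: put_slice_def idx_def)
  have b_eq: "c = b" if "c \<in> idx 2" "c ! 0 = b ! 0" "c ! 1 = b ! 1" for c
    using that ab(2) by (intro nth_equalityI) (auto simp: idx_def less_2_cases_iff)
  \<comment> \<open>The units force the column of the relator to be \<open>b\<close> and hand row
    \<open>z\<close> to M, so the entry is \<open>g * Mmat z k\<close>.\<close>
  have "ent (D_refl * (tunit 0 (b ! 0) z * tunit (Suc 0) (b ! 1) (t (Suc 0))) * MM) u (t(0 := k)) \<in> V"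
    using mem by (simp add: entries_in_def)
  also have "ent (D_refl * (tunit 0 (b ! 0) z * tunit (Suc 0) (b ! 1) (t (Suc 0))) * MM) u (t(0 := k))
    = (\<Sum>c\<in>idx 2. if c = b then D_tmat a b * ent MM (t(0 := z)) (t(0 := k)) else 0)"
    unfolding emb_D_tmat[symmetric] ent_def mult.assoc app_simps(6) u_def app_emb_splice[OF ab(1)]
  proof (intro sum.cong refl)
    fix c :: "'n list" assume c: "c \<in> idx 2"
    let ?c = "put_slice (\<lambda>_. undefined) 0 c"
    have "app (tunit 0 (b ! 0) z) (app (tunit (Suc 0) (b ! 1) (t (Suc 0))) (app MM (delta (t(0 := k))))) ?c
      = (if c = b then app MM (delta (t(0 := k))) (t(0 := z)) else 0)"
    proof (cases "c = b")
      case True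
      have "?c = t" by (simp add: True t_def)
      moreover have "t 0 = b ! 0" "t (Suc 0) = b ! 1" using nth[OF ab(2)] by (simp_all add: t_def)
      moreover have "t(0 := z, Suc 0 := t (Suc 0)) = t(0 := z)" by (auto simp: fun_eq_iff)
      ultimately show ?thesis using True by simp
    next
      case False
      then have "?c 0 \<noteq> b ! 0 \<or> ?c (Suc 0) \<noteq> b ! 1" using b_eq[OF c] nth[OF c] by auto
      then show ?thesis using False by auto
    qed
    then show "D_tmat a c * app (tunit 0 (b ! 0) z) (app (tunit (Suc 0) (b ! 1) (t (Suc 0)))
        (app MM (delta (t(0 := k))))) ?c
      = (if c = b then D_tmat a b * app MM (delta (t(0 := k))) (t(0 := z)) else 0)"
      by simp
  qed
  also have "ent MM (t(0 := z)) (t(0 := k)) = Mmat z k"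
  proof -
    have "delta (t(0 := k)) (t(0 := c)) = (if c = k then 1 else (0 :: 'n gen falg))" for c
      unfolding delta_def by (metis fun_upd_same)
    then show ?thesis by (simp add: ent_def app_at1 if_distrib[of "(*) _"] cong: if_cong)
  qed
  also have "(\<Sum>c\<in>idx 2. if c = b then D_tmat a b * Mmat z k else 0) = g * Mmat z k"
    using ab by simp
  finally show ?thesis by (simp add: V_def act_mult act_Mmat)
qed

lemma D_relators_absorbed: "D_relators R \<subseteq> absorbed"
proof -
  have base: "act g u \<in> reflection_ideal" if "g \<in> D_relators R" "u \<in> stop" for g u
    unfolding D_relators_act[OF that]
    using that(1) relators_reflection_ideal(2) ring_ideal.mult_right_mem[OF reflection_ideal] by blast
  have "\<forall>g\<in>D_relators R. act g v \<in> reflection_ideal" for v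
  proof (induction v rule: falg_induct)
    case (1 x y)
    then show ?case using ring_ideal.plus_mem[OF reflection_ideal] by (simp add: act_add)
  next
    case (2 c x)
    then show ?case using ring_ideal.mult_left_mem[OF reflection_ideal] by (simp add: act_fconst)
  next
    case 3
    then show ?case using base one_stop by (simp add: mono_Nil)
  next
    case (4 g w)
    show ?case
    proof (cases g)
      case (Mgen a b)
      then have "word_mono (g # w) = Mmat a b * word_mono w" by (simp only: Mmat_def fvar_mono)
      then show ?thesis using D_relator_M_step[of "word_mono w"] 4 by simp
    next
      case (Dgen a b)
      then have "word_mono (g # w) = Dmat a b * word_mono w" by (simp only: Dmat_mono)
      then show ?thesis using base D_stop by simp
    qed
  qed
  then show ?thesis by (auto simp: absorbed_def)
qed

text \<open>Only the action of D needs work, as M acts by multiplication. D is followed through the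
  letters in front of a relator until it meets the relator itself.\<close>

lemma act_reflection_ideal:
  assumes "x \<in> reflection_ideal" shows "act y x \<in> reflection_ideal"
proof -
  interpret K: ring_ideal reflection_ideal by (rule reflection_ideal)
  \<comment> \<open>The quantifiers over the context \<open>y\<close>, \<open>z\<close> make this
    set a two-sided ideal, so only relators have to be tested.\<close>
  let ?L = "{x. \<forall>y z i p. act (Dmat i p) (y * x * z) \<in> reflection_ideal}"
  have L: "ring_ideal ?L"
  proof
    fix a b x assume a: "a \<in> ?L"
    show "a - b \<in> ?L" if "b \<in> ?L"
    proof -
      have "act (Dmat i p) (y * (a - b) * z) = act (Dmat i p) (y * a * z) - act (Dmat i p) (y * b * z)" for y z i p
        using act_add[of "Dmat i p" "y * (a - b) * z" "y * b * z"] by (simp add: algebra_simps)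
      then show ?thesis using a that by (simp add: K.diff_mem)
    qed
    show "x * a \<in> ?L" "a * x \<in> ?L" using a by (auto simp: mult.assoc) (metis mult.assoc)+
  qed (simp add: act_zero K.zero_mem)
  have "g \<in> ?L" if g: "g \<in> M_relators R \<union> D_relators R" for g
  proof -
    have gK: "g \<in> reflection_ideal" using g relators_reflection_ideal by blast
    have "\<forall>i p z. act (Dmat i p) (y * g * z) \<in> reflection_ideal" for y
    proof (induction y rule: falg_induct)
      case (1 x y)
      then show ?case by (simp add: distrib_right act_add K.plus_mem)
    next
      case (2 c x)
      then show ?case by (simp add: mult.assoc act_fconst K.mult_left_mem)
    next
      case 3
      from g show ?case
      proof
        assume "g \<in> M_relators R"
        then have gz: "act g z = g * z" for z by (rule M_relators_act)
        obtain a b where ab: "a \<in> idx 2" "b \<in> idx 2" "g = M_tmat a b"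
          using \<open>g \<in> M_relators R\<close> unfolding M_relators_eq by blast
        \<comment> \<open>Since \<open>g\<close> acts by multiplication, D applied to
          \<open>g * z\<close> is the action of the product of D and \<open>g\<close> on
          \<open>z\<close>.\<close>
        have "act (Dmat i p) (g * z) \<in> reflection_ideal" for i p z
          using D_M_relator_absorbed[OF ab(1,2), of i p] unfolding gz[symmetric] ab(3)[symmetric]
          by (simp add: absorbed_def act_mult)
        then show ?case by (simp add: mono_Nil)
      next
        assume "g \<in> D_relators R"
        then have "act (Dmat i p) (g * z) = Dmat i p * (g * z)" for i p z
          using D_relators_stop by (simp add: stop_def)
        then show ?case using gK by (simp add: mono_Nil K.mult_left_mem K.mult_right_mem)
      qed
    next
      case (4 h w)
      show ?case
      proof (cases h)
        case (Mgen a b)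
        then have h: "word_mono (h # w) = Mmat a b * word_mono w" by (simp only: Mmat_def fvar_mono)
        have "passed (\<lambda>d f. act (Dmat d f) (word_mono w * g * z)) i j k l \<in> reflection_ideal" for z i j k l
          by (rule passed_in) (use 4 in \<open>auto intro: ring_ideal_subspace[OF reflection_ideal] K.mult_left_mem\<close>)
        then show ?thesis unfolding h
          by (auto simp: mult.assoc act_Dmat_Mmat intro!: subspace_sum ring_ideal_subspace[OF reflection_ideal] K.mult_left_mem)
      next
        case (Dgen a b)
        then have h: "word_mono (h # w) = Dmat a b * word_mono w" by (simp only: Dmat_mono)
        have "act (Dmat i p) (Dmat a b * (word_mono w * g * z)) = Dmat i p * (Dmat a b * (word_mono w * g * z))" for i p z
          using D_stop by (simp add: stop_def)
        then show ?thesis unfolding h using gK by (simp add: mult.assoc K.mult_left_mem K.mult_right_mem)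
      qed
    qed
    then show ?thesis by simp
  qed
  then have "M_relators R \<union> D_relators R \<subseteq> ?L" by (intro subsetI)
  from fideal_minimal[OF L this] have sub: "reflection_ideal \<subseteq> ?L"
    by (subst reflection_ideal_def)
  have D: "act (Dmat i p) x \<in> reflection_ideal" if x: "x \<in> reflection_ideal" for i p x
  proof -
    have "act (Dmat i p) (1 * x * 1) \<in> reflection_ideal" using subsetD[OF sub x] by blast
    then show ?thesis by simp
  qed
  have "\<forall>x\<in>reflection_ideal. act y x \<in> reflection_ideal"
  proof (induction y rule: falg_induct)
    case (1 x y)
    then show ?case by (simp add: act_add_left K.plus_mem)
  next
    case (2 c x)
    then show ?case by (simp add: act_fconst_left K.mult_left_mem)
  next
    case 3
    then show ?case by (simp add: mono_Nil act_one)
  next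
    case (4 g w)
    show ?case
    proof (cases g)
      case (Mgen a b)
      then have "word_mono (g # w) = Mmat a b * word_mono w" by (simp only: Mmat_def fvar_mono)
      then show ?thesis using 4 by (simp add: act_mult act_Mmat K.mult_left_mem)
    next
      case (Dgen a b)
      then have "word_mono (g # w) = Dmat a b * word_mono w" by (simp only: Dmat_mono)
      then show ?thesis using 4 D by (simp add: act_mult)
    qed
  qed
  then show ?thesis using assms by blast
qed

lemma hom_ideal_absorbed: "hom_ideal R \<subseteq> absorbed"
  unfolding hom_ideal_def
proof (rule fideal_minimal)
  interpret K: ring_ideal reflection_ideal by (rule reflection_ideal)
  show "ring_ideal absorbed"
    by unfold_locales
      (auto simp: absorbed_def act_zero act_diff act_mult K.zero_mem K.diff_mem act_reflection_ideal)
  show "M_relators R \<union> D_relators R \<union> hom_permutation_relators R \<subseteq> absorbed"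
    using M_relators_absorbed D_relators_absorbed hom_relators_killed killed_absorbed by blast
qed

lemma lin_mono: "lin (\<lambda>w. word_mono (letters w)) x = x"
  by (induction x rule: poly_mapping_additive_induct)
    (simp_all add: lin_add lin_single fconst_def mult_single)

lemma act_ordered: "ordered x \<Longrightarrow> act x 1 = x"
proof -
  assume x: "ordered x"
  have M: "word_mono (map (\<lambda>(i, j). Mgen i j) us) \<in> M_alg" for us
  proof (induction us)
    case Nil
    then show ?case using M_alg_subalgebra by (simp add: mono_Nil subalgebra_def)
  next
    case (Cons ij us)
    have "word_mono (map (\<lambda>(i, j). Mgen i j) (ij # us)) = Mmat (fst ij) (snd ij) * word_mono (map (\<lambda>(i, j). Mgen i j) us)"
      by (simp only: Mmat_def fvar_mono list.map case_prod_unfold)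
    then show ?case using Cons Mmat_M_alg M_alg_subalgebra by (simp add: subalgebra_def)
  qed
  have D: "word_mono (map (\<lambda>(i, j). Dgen i j) us) \<in> D_alg" for us
  proof (induction us)
    case Nil
    then show ?case using D_alg_subalgebra by (simp add: mono_Nil subalgebra_def)
  next
    case (Cons ij us)
    have "word_mono (map (\<lambda>(i, j). Dgen i j) (ij # us)) = Dmat (fst ij) (snd ij) * word_mono (map (\<lambda>(i, j). Dgen i j) us)"
      by (simp only: Dmat_mono list.map case_prod_unfold)
    then show ?case using Cons Dmat_D_alg D_alg_subalgebra by (simp add: subalgebra_def)
  qed
  have "foldr gact (letters w) 1 = word_mono (letters w)" if w: "w \<in> Poly_Mapping.keys x" for w
  proof -
    obtain us vs where l: "letters w = map (\<lambda>(i, j). Mgen i j) us @ map (\<lambda>(i, j). Dgen i j) vs"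
      using x w by (auto simp: ordered_def)
    have "act (word_mono (letters w)) 1 = act (word_mono (map (\<lambda>(i, j). Mgen i j) us)) (act (word_mono (map (\<lambda>(i, j). Dgen i j) vs)) 1)"
      unfolding l mono_mult[symmetric] act_mult ..
    also have "\<dots> = word_mono (letters w)"
      using M[of us] D[of vs] one_stop unfolding l by (simp only: M_alg_def D_alg_def mem_Collect_eq mult_1_right mono_mult)
    finally show ?thesis by (simp only: act_mono)
  qed
  then have "act x 1 = lin (\<lambda>w. word_mono (letters w)) x" unfolding act_def by (rule lin_cong)
  then show ?thesis by (simp only: lin_mono)
qed

text \<open>The vector 1 is mapped into the reflection ideal by the membership, and to
  \<open>x\<close> itself by the ordering.\<close>

lemma ordered_hom_ideal: "ordered x \<Longrightarrow> x \<in> hom_ideal R \<Longrightarrow> x \<in> double_ideal R"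
proof -
  assume x: "ordered x" "x \<in> hom_ideal R"
  then have "act x 1 \<in> reflection_ideal" using hom_ideal_absorbed by (auto simp: absorbed_def)
  moreover have "reflection_ideal \<subseteq> double_ideal R"
    unfolding reflection_ideal_def double_ideal_def
    by (rule fideal_minimal[OF fideal_ring_ideal order_trans[OF _ fideal_self]]) (rule Un_upper1)
  ultimately show ?thesis unfolding act_ordered[OF x(1)] by (rule rev_subsetD)
qed

end

section \<open>Casimir operators as traces of operators\<close>

sublocale hecke_data \<subseteq> hom: hecke_ideal r s sc lam "entries_in (hom_ideal R)"
  by (rule hecke_ideal_entries) (simp add: hom_ideal_def fideal_ring_ideal)

sublocale hecke_data \<subseteq> dbl: traced_ideal r s sc lam tunit \<rho> \<sigma> "Cmat \<Psi>" "entries_in (double_ideal R)"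
  by (intro traced_ideal.intro traced_axioms entries_in_ideal) (simp add: double_ideal_def fideal_ring_ideal)

lemma sum_idx_snoc: "(\<Sum>a\<in>idx (Suc k). g a) = (\<Sum>x\<in>UNIV. \<Sum>a\<in>idx k. g (a @ [x]))"
  for g :: "'n::finite list \<Rightarrow> 'b::comm_monoid_add"
proof -
  have "(\<Sum>a\<in>idx (Suc k). g a) = (\<Sum>(x, a)\<in>UNIV \<times> idx k. g (a @ [x]))"
    by (rule sum.reindex_bij_witness[of _ "\<lambda>(x, a). a @ [x]" "\<lambda>a. (last a, butlast a)"])
      (auto simp: idx_def length_Suc_conv_rev)
  then show ?thesis by (simp add: sum.cartesian_product)
qed

lemma slice_Suc: "get_slice (x(k := y)) 0 (Suc k) = get_slice x 0 k @ [y]"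
  by (simp add: get_slice_def)

lemma splice_snoc: "a \<in> idx k \<Longrightarrow> (put_slice (x(k := y)) 0 (a @ [z]))(k := x k) = put_slice x 0 a"
  "a \<in> idx k \<Longrightarrow> put_slice (x(k := y)) 0 (a @ [z]) k = z"
  by (auto simp: put_slice_def idx_def fun_eq_iff nth_append)

text \<open>Identifies the sandwich by matrix units with the ordinary partial trace over the last
  factor.\<close>

lemma app_flat_emb:
  fixes X :: "('n::finite, 'g falg) tmat"
  shows "(\<Sum>a\<in>UNIV. \<Sum>b\<in>UNIV. tunit k b a * emb 0 (Suc k) X * tunit k a b)
    = emb 0 k (\<lambda>a b. \<Sum>x\<in>UNIV. X (a @ [x]) (b @ [x]))"
proof (rule op_eqI)
  fix v :: "(nat \<Rightarrow> 'n) \<Rightarrow> 'g falg" and x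
  have "app (\<Sum>a\<in>UNIV. \<Sum>b\<in>UNIV. tunit k b a * emb 0 (Suc k) X * tunit k a b) v x
    = (\<Sum>a\<in>UNIV. \<Sum>b\<in>UNIV. if x k = b then app (emb 0 (Suc k) X) (app (tunit k a b) v) (x(k := a)) else 0)"
    by (simp add: app_sum)
  also have "\<dots> = (\<Sum>a\<in>UNIV. app (emb 0 (Suc k) X) (app (tunit k a (x k)) v) (x(k := a)))"
    by simp
  also have "\<dots> = (\<Sum>a\<in>UNIV. \<Sum>y\<in>UNIV. \<Sum>c\<in>idx k. if y = a then X (get_slice x 0 k @ [a]) (c @ [y]) * v (put_slice x 0 c) else 0)"
    unfolding app_emb sum_idx_snoc by (intro sum.cong refl) (simp add: slice_Suc splice_snoc)
  also have "\<dots> = (\<Sum>a\<in>UNIV. \<Sum>c\<in>idx k. X (get_slice x 0 k @ [a]) (c @ [a]) * v (put_slice x 0 c))"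
    by (rule sum.cong[OF refl], subst sum.swap) simp
  also have "\<dots> = app (emb 0 k (\<lambda>a b. \<Sum>x\<in>UNIV. X (a @ [x]) (b @ [x]))) v x"
    by (subst sum.swap) (simp add: app_emb sum_distrib_right)
  finally show "app (\<Sum>a\<in>UNIV. \<Sum>b\<in>UNIV. tunit k b a * emb 0 (Suc k) X * tunit k a b) v x
    = app (emb 0 k (\<lambda>a b. \<Sum>x\<in>UNIV. X (a @ [x]) (b @ [x]))) v x" .
qed

lemma emb_0: "emb 0 0 X = lmul (X [] [])" for X :: "('n::finite, 'a::ring_1) tmat"
proof (rule op_eqI)
  fix v and x :: "nat \<Rightarrow> 'n"
  have "put_slice x 0 [] = x" by (simp add: put_slice_def)
  then show "app (emb 0 0 X) v x = app (lmul (X [] [])) v x" by (simp add: app_emb idx_0 get_slice_def)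
qed

lemma at1_mult: "at1 j X * at1 j Y = at1 j (\<lambda>a b. \<Sum>c\<in>UNIV. X a c * Y c b)"
proof (rule op_eqI)
  fix v x
  have "app (at1 j X * at1 j Y) v x = (\<Sum>c\<in>UNIV. \<Sum>b\<in>UNIV. X (x j) c * (Y c b * v (x(j := b))))"
    by (simp add: app_at1 sum_distrib_left)
  also have "\<dots> = (\<Sum>b\<in>UNIV. \<Sum>c\<in>UNIV. X (x j) c * (Y c b * v (x(j := b))))" by (rule sum.swap)
  finally show "app (at1 j X * at1 j Y) v x = app (at1 j (\<lambda>a b. \<Sum>c\<in>UNIV. X a c * Y c b)) v x"
    by (simp add: app_at1 sum_distrib_right mult.assoc)
qed

lemma scal_at_site: "scal (at_site i X) = at_site i (\<lambda>a b. fconst (X a b))"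
  by (simp add: scal_def at_site_def fconst_simps fun_eq_iff)

context hecke_data
begin

abbreviation (input) LL :: "('n, 'n gen) tensor_op" where "LL \<equiv> at1 0 Lmat"

lemma LL_eq: "LL = MM * DD"
  by (simp add: at1_mult Lmat_def[abs_def])

primrec flats :: "nat \<Rightarrow> ('n, 'n gen) tensor_op \<Rightarrow> ('n, 'n gen) tensor_op" where
  "flats 0 X = X"
| "flats (Suc k) X = flats k (site.flat k X)"

lemma triv_asc_Cm: "k \<le> j \<Longrightarrow> triv j (asc Cm k)"
  by (induction k) (auto intro!: triv_mult triv_one triv_Cm)

text \<open>The weights of lower sites act trivially on the site being traced, so all weights gather
  in front, as in the definition of the R-trace.\<close>

lemma traces_flats: "traces 0 k X = flats k (asc Cm k * X)"
proof (induction k arbitrary: X)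
  case (Suc k)
  have "traces 0 (Suc k) X = flats k (asc Cm k * E k X)" by (simp add: Suc)
  also have "asc Cm k * E k X = site.flat k (asc Cm (Suc k) * X)"
    using site.flat_bimodule[of k "asc Cm k" 1 "Cm k * X"] triv_asc_Cm[of k k]
    by (simp add: E_def triv_def mult.assoc)
  finally show ?case by simp
qed simp

lemma flats_emb: "flats k (emb 0 k X) = lmul (\<Sum>a\<in>idx k. X a a)"
proof (induction k arbitrary: X)
  case 0
  then show ?case by (simp add: emb_0 idx_0)
next
  case (Suc k)
  have "flats (Suc k) (emb 0 (Suc k) X) = lmul (\<Sum>a\<in>idx k. \<Sum>x\<in>UNIV. X (a @ [x]) (a @ [x]))"
    by (simp add: site.flat_def app_flat_emb Suc)
  also have "(\<Sum>a\<in>idx k. \<Sum>x\<in>UNIV. X (a @ [x]) (a @ [x])) = (\<Sum>a\<in>idx (Suc k). X a a)"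
    unfolding sum_idx_snoc by (rule sum.swap)
  finally show ?case .
qed

lemma emb_Cprod: "emb 0 k (scal (Cprod \<Psi> k)) = asc Cm k"
proof -
  have Cm: "at1 j (\<lambda>a b. fconst (Cmat \<Psi> a b)) = Cm j" for j
    by (simp add: at1_def Cm_def site.mx_def sc_def)
  have "prod_list (map (emb 0 k) (map scal (map (\<lambda>i. at_site i (Cmat \<Psi>)) [1..<Suc m]))) = asc Cm m" if "m \<le> k" for m
    using that
  proof (induction m)
    case (Suc m)
    have "emb 0 k (scal (at_site (Suc m) (Cmat \<Psi>))) = Cm m"
      using Suc.prems emb_at_site[of "Suc m" k 0 "\<lambda>a b. fconst (Cmat \<Psi> a b) :: 'n gen falg"]
      by (simp add: scal_at_site Cm)
    then show ?case using Suc by simp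
  qed simp
  then show ?thesis by (simp only: Cprod_def scal_tprod emb_tprod order_refl)
qed

lemma rtrace_eq: "lmul (rtrace \<Psi> k X) = traces 0 k (emb 0 k X)"
  by (simp add: rtrace_def traces_flats flats_emb emb_Cprod flip: emb_mult) (simp add: emb_mult emb_Cprod flip: flats_emb)

lemma emb_bar:
  assumes "1 \<le> k" shows "i < k \<Longrightarrow> emb 0 k (bar R k X i) = copy r s (at1 0 X) i"
proof (induction i)
  case 0
  then show ?case using emb_at_site[of 1 k 0 X] assms by simp
next
  case (Suc i)
  then show ?case by (simp add: emb_tprod emb_at_pair mult.assoc)
qed

lemma emb_bar_prod: "1 \<le> k \<Longrightarrow> emb 0 k (bar_prod R k X) = copy_prod r s (at1 0 X) k"
proof -
  assume k: "1 \<le> k"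
  have "prod_list (map (emb 0 k) (map (bar R k X) [0..<m])) = copy_prod r s (at1 0 X) m" if "m \<le> k" for m
    using that by (induction m) (simp_all add: emb_bar[OF k])
  then show ?thesis by (simp only: bar_prod_def emb_tprod order_refl)
qed

text \<open>Letters of \<open>Q\<close> count from 1 and generators of the operator ring from
  0.\<close>

definition poly_op :: "nat falg \<Rightarrow> ('n, 'n gen) tensor_op" where
  "poly_op Q = (\<Sum>w\<in>Poly_Mapping.keys Q. sc (Poly_Mapping.lookup Q w) * prod_list (map (\<lambda>i. at2 (i - 1) R) (letters w)))"

lemma emb_sum: "emb m k (\<lambda>a b. \<Sum>i\<in>I. X i a b) = (\<Sum>i\<in>I. emb m k (X i))"
  by (rule op_eqI) (simp add: app_emb app_sum sum_distrib_right sum.swap[of _ I])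

lemma emb_eval_poly:
  assumes "fvars Q \<subseteq> {1..<k}" shows "emb 0 k (scal (eval_poly R k Q)) = poly_op Q"
proof -
  have "(scal (eval_poly R k Q) :: ('n, 'n gen falg) tmat) = (\<lambda>a b. \<Sum>w\<in>Poly_Mapping.keys Q. fconst (Poly_Mapping.lookup Q w) *
      scal (tprod k (map (\<lambda>i. at_pair i R) (letters w))) a b)"
    by (simp add: scal_def eval_poly_def fconst_sum fconst_simps fun_eq_iff)
  then have "(emb 0 k (scal (eval_poly R k Q)) :: ('n, 'n gen) tensor_op) = (\<Sum>w\<in>Poly_Mapping.keys Q. sc (Poly_Mapping.lookup Q w) *
      prod_list (map (emb 0 k) (map scal (map (\<lambda>i. at_pair i R) (letters w)))))"
    by (simp add: emb_sum emb_scale sc_def scal_tprod emb_tprod)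
  also have "\<dots> = poly_op Q"
    unfolding poly_op_def
  proof (intro sum.cong refl)
    fix w assume "w \<in> Poly_Mapping.keys Q"
    then have "map (emb 0 k) (map scal (map (\<lambda>i. at_pair i R) (letters w)))
        = (map (\<lambda>i. at2 (i - 1) R) (letters w) :: ('n, 'n gen) tensor_op list)"
      using assms by (auto simp: fvars_def emb_at_pair)
    then show "sc (Poly_Mapping.lookup Q w) * prod_list (map (emb 0 k) (map scal (map (\<lambda>i. at_pair i R) (letters w))))
      = (sc (Poly_Mapping.lookup Q w) * prod_list (map (\<lambda>i. at2 (i - 1) R) (letters w)) :: ('n, 'n gen) tensor_op)"
      by (simp only:)
  qed
  finally show ?thesis .
qed

lemma poly_op_superset:
  "finite A \<Longrightarrow> Poly_Mapping.keys Q \<subseteq> A \<Longrightarrow>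
    poly_op Q = (\<Sum>w\<in>A. sc (Poly_Mapping.lookup Q w) * prod_list (map (\<lambda>i. at2 (i - 1) R) (letters w)))"
  unfolding poly_op_def by (rule sum.mono_neutral_left) (auto simp: in_keys_iff sc_zero)

lemma poly_op_single: "poly_op (Poly_Mapping.single w c) = sc c * prod_list (map (\<lambda>i. at2 (i - 1) R) (letters w))"
  by (subst poly_op_superset[of "{w}"]) auto

lemma poly_op_add: "poly_op (P + Q) = poly_op P + poly_op Q"
proof -
  let ?A = "Poly_Mapping.keys P \<union> Poly_Mapping.keys Q"
  have "Poly_Mapping.keys (P + Q) \<subseteq> ?A" by (rule keys_add)
  then show ?thesis
    by (simp add: poly_op_superset[of ?A] lookup_add sc_add distrib_right sum.distrib)
qed

lemma poly_op_mult: "poly_op (P * Q) = poly_op P * poly_op Q"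
proof (induction P rule: poly_mapping_additive_induct)
  case (1 w c)
  show ?case
  proof (induction Q rule: poly_mapping_additive_induct)
    case (1 u d)
    have "poly_op (Poly_Mapping.single w c * Poly_Mapping.single u d)
      = sc c * (sc d * (prod_list (map (\<lambda>i. at2 (i - 1) R) (letters w)) * prod_list (map (\<lambda>i. at2 (i - 1) R) (letters u))))"
      by (simp add: mult_single poly_op_single plus_word_def sc_mult mult.assoc)
    also have "\<dots> = poly_op (Poly_Mapping.single w c) * poly_op (Poly_Mapping.single u d)"
      unfolding poly_op_single mult.assoc sc_left_commute[of "prod_list _"] ..
    finally show ?case .
  next
    case (2 x y)
    then show ?case by (simp add: distrib_left poly_op_add)
  qed
next
  case (2 x y)
  then show ?case by (simp add: distrib_right poly_op_add)
qed

lemma poly_op_H: "fvars Q \<subseteq> {1..<k} \<Longrightarrow> poly_op Q \<in> H k"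
proof -
  assume Q: "fvars Q \<subseteq> {1..<k}"
  have prods: "prod_list (map (\<lambda>i. at2 (i - 1) R) u) \<in> H k" if "set u \<subseteq> {1..<k}" for u
    using that
  proof (induction u)
    case (Cons i u)
    have "at2 (i - 1) R \<in> H k"
      using Cons.prems by (intro hecke_algebra.gen[of "i - 1" k r sc]) auto
    then show ?case using Cons by (simp add: hecke_algebra.mult)
  qed (simp add: H_one)
  have summand: "sc (Poly_Mapping.lookup Q w) * prod_list (map (\<lambda>i. at2 (i - 1) R) (letters w)) \<in> H k"
    if "w \<in> Poly_Mapping.keys Q" for w
  proof -
    have "set (letters w) \<subseteq> {1..<k}" using Q that by (auto simp: fvars_def)
    then show ?thesis by (rule hecke_algebra.mult[OF hecke_algebra.scalar prods])
  qed
  have "sum g A \<in> H k" if "\<And>i. i \<in> A \<Longrightarrow> g i \<in> H k" for g :: "nat word \<Rightarrow> _" and A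
    using that
  proof (induction A rule: infinite_finite_induct)
    case (insert x F)
    then show ?case by (simp add: hecke_algebra.add)
  qed (use hecke_algebra.scalar[of sc 0 r k] in \<open>simp_all add: sc_zero\<close>)
  then show ?thesis unfolding poly_op_def using summand by simp
qed

text \<open>Needed to recognise a trace with a coefficient from the Hecke algebra as a Casimir
  operator of some polynomial.\<close>

lemma H_poly_op: "A \<in> H k \<Longrightarrow> \<exists>Q. fvars Q \<subseteq> {1..<k} \<and> poly_op Q = A"
proof (induction rule: hecke_algebra.induct)
  case (scalar c)
  have "fvars (fconst c :: nat falg) \<subseteq> {1..<k}" "poly_op (fconst c) = sc c"
    by (auto simp: fvars_def fconst_def poly_op_single letters_zero split: if_splits)
  then show ?case by blast
next
  case (gen i)
  then have "fvars (fvar (Suc i)) \<subseteq> {1..<k}" "poly_op (fvar (Suc i)) = at2 i R"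
    by (auto simp: fvars_def fvar_def poly_op_single sc_one)
  then show ?case by blast
next
  case (add A B)
  then obtain P Q where "fvars P \<subseteq> {1..<k}" "fvars Q \<subseteq> {1..<k}" "poly_op P = A" "poly_op Q = B" by blast
  moreover have "fvars (P + Q) \<subseteq> fvars P \<union> fvars Q" using keys_add[of P Q] by (auto simp: fvars_def)
  ultimately show ?case using poly_op_add[of P Q] by (intro exI[of _ "P + Q"]) blast
next
  case (mult A B)
  then obtain P Q where "fvars P \<subseteq> {1..<k}" "fvars Q \<subseteq> {1..<k}" "poly_op P = A" "poly_op Q = B" by blast
  moreover have "fvars (P * Q) \<subseteq> fvars P \<union> fvars Q"
    using keys_mult[of P Q] by (force simp: fvars_def plus_word_def)
  ultimately show ?case using poly_op_mult[of P Q] by (intro exI[of _ "P * Q"]) blast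
qed

lemma casimir_eq:
  assumes "1 \<le> k" "fvars Q \<subseteq> {1..<k}"
  shows "lmul (casimir R \<Psi> k Q) = traces 0 k (poly_op Q * copy_prod r s LL k)"
  using assms by (simp add: casimir_def rtrace_eq emb_mult emb_eval_poly emb_bar_prod)

definition casimir_span :: "'n gen falg set" where
  "casimir_span = falg.span (insert 1 {casimir R \<Psi> k Q | k Q. 1 \<le> k \<and> fvars Q \<subseteq> {1..<k}})"

lemma traces_casimir_span:
  assumes "X \<in> dbl.copy_span LL k" "B \<in> H k"
  shows "\<exists>z\<in>casimir_span. traces 0 k (B * X) = lmul z"
proof -
  have "traces 0 k (B * X) \<in> {t. \<exists>z\<in>casimir_span. t = lmul z}"
  proof (rule dbl.traces_copy_span[OF _ _ _ assms(2,1)])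
    show "triv j LL" if "0 < j" for j using that by (simp add: triv_at1)
    show "x + y \<in> {t. \<exists>z\<in>casimir_span. t = lmul z}"
      if "x \<in> {t. \<exists>z\<in>casimir_span. t = lmul z}" "y \<in> {t. \<exists>z\<in>casimir_span. t = lmul z}" for x y :: "('n, 'n gen) tensor_op"
      using that by (auto simp: casimir_span_def lmul_add[symmetric] intro: falg.span_add)
    show "traces 0 j (A * copy_prod r s LL j) \<in> {t. \<exists>z\<in>casimir_span. t = lmul z}" if A: "A \<in> H j" for j A
    proof (cases "j = 0")
      \<comment> \<open>Casimir operators start at \<open>k = 1\<close>; over no sites the trace is
        a scalar, covered by the unit in the span.\<close>
      case True
      have "\<exists>c. A = sc c" using A unfolding True
        by induction (auto simp flip: sc_add sc_mult)
      then obtain c where "A = lmul (fconst c)" by (auto simp: sc_def)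
      moreover have "fscale c 1 \<in> casimir_span"
        unfolding casimir_span_def by (intro falg.span_scale falg.span_base) simp
      ultimately show ?thesis using True by (auto simp: fscale_def)
    next
      case False
      obtain Q where Q: "fvars Q \<subseteq> {1..<j}" "poly_op Q = A" using H_poly_op[OF A] by blast
      then have "casimir R \<Psi> j Q \<in> casimir_span"
        using False unfolding casimir_span_def by (intro falg.span_base) auto
      moreover have "lmul (casimir R \<Psi> j Q) = traces 0 j (A * copy_prod r s LL j)"
        using casimir_eq[of j Q] Q False by simp
      ultimately show ?thesis by (metis (mono_tags, lifting) mem_Collect_eq)
    qed
  qed
  then show ?thesis by blast
qed


end

section \<open>The characteristic subalgebra\<close>

context hecke_data
begin

lemma double_ideal: "ring_ideal (double_ideal R)" and hom_ideal: "ring_ideal (hom_ideal R)"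
  by (simp_all add: double_ideal_def hom_ideal_def fideal_ring_ideal)

lemma relators_double: "M_relators R \<subseteq> double_ideal R" "D_relators R \<subseteq> double_ideal R"
    "permutation_relators R \<subseteq> double_ideal R"
  and relators_hom: "M_relators R \<subseteq> hom_ideal R" "hom_permutation_relators R \<subseteq> hom_ideal R"
  using fideal_self[of "M_relators R \<union> D_relators R \<union> permutation_relators R"]
    fideal_self[of "M_relators R \<union> D_relators R \<union> hom_permutation_relators R"]
  by (auto simp: double_ideal_def hom_ideal_def)

lemma M_reflection_dbl: "dbl.ceq (r 0 * MM * r 0 * MM) (MM * r 0 * MM * r 0)"
  and M_reflection_hom: "hom.ceq (r 0 * MM * r 0 * MM) (MM * r 0 * MM * r 0)"
  and D_reflection_dbl: "dbl.ceq (s 0 * DD * s 0 * DD) (DD * s 0 * DD * s 0)"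
  unfolding dbl.ceq_def hom.ceq_def M_refl_def[symmetric] D_refl_def[symmetric]
  by (intro M_refl_entries D_refl_entries ring_ideal_subspace double_ideal hom_ideal relators_double relators_hom)+

lemma perm_hom: "hom.ceq (DD * r 0 * MM) (r 0 * MM * s 0 * DD * s 0 + sc 0)"
  using hom_perm_entries[OF ring_ideal_subspace[OF hom_ideal] relators_hom(2)]
  by (simp add: hom.ceq_def hom_perm_def sc_zero)

lemma perm_dbl: "dbl.ceq (DD * r 0 * MM) (r 0 * MM * s 0 * DD * s 0 + sc 1)"
proof -
  let ?R1 = "scal (at_pair 1 R) :: ('n, 'n gen falg) tmat" and ?S1 = "scal (at_pair 1 S) :: ('n, 'n gen falg) tmat"
  let ?M1 = "at_site 1 Mmat" and ?D1 = "at_site 1 Dmat"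
  have "emb 0 2 (\<lambda>a b. tprod 2 [?D1, ?R1, ?M1, ?R1] a b - (tprod 2 [?R1, ?M1, ?S1, ?D1] a b + ?R1 a b))
      \<in> entries_in (double_ideal R)"
    using relators_double(3)
    by (intro emb_entries_in ring_ideal_subspace double_ideal) (auto simp: permutation_relators_def Let_def)
  then have "dbl.ceq (DD * r 0 * MM * r 0) (r 0 * MM * s 0 * DD + r 0)"
    by (simp add: dbl.ceq_def emb_diff emb_add emb_tprod emb_one mult.assoc)
  from dbl.ceq_right[OF this, of "s 0"] show ?thesis
    by (simp add: distrib_right mult.assoc r_s sc_one)
qed

text \<open>One operator with two roles: it is congruent to the product of copies of L under the
  homogeneous relations, and in the double it obeys the recursion with constant terms.\<close>

definition normal_form :: "nat \<Rightarrow> ('n, 'n gen) tensor_op" where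
  "normal_form k = copy_prod r s MM k * dbl.dual_prod DD k"

lemma copy_prod_normal: "hom.ceq (copy_prod r s LL k) (normal_form k)"
proof (induction k)
  case 0
  show ?case by (simp add: normal_form_def)
next
  case (Suc k)
  have "hom.ceq (LL * asc r k * copy_prod r s LL k * desc s k) (LL * asc r k * normal_form k * desc s k)"
    by (rule hom.ceq_ctx[OF Suc])
  moreover have "hom.ceq (LL * asc r k * normal_form k * desc s k) (normal_form (Suc k))"
    using hom.normal_ordered_recursion[OF at_first_at1 at_first_at1 perm_hom M_reflection_hom, of k]
    unfolding LL_eq normal_form_def by (simp add: sc_zero)
  ultimately show ?case
    using hom.ceq_trans by (simp only: copy_prod_Suc[OF at_first_at1 order_refl])
qed

lemma normal_recursion:
  "dbl.ceq (normal_form (Suc k)) (LL * asc r k * normal_form k * desc s k + (- dbl.const_part k) * normal_form k * desc s k)"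
proof -
  have "dbl.ceq (LL * asc r k * normal_form k * desc s k)
      (normal_form (Suc k) + dbl.const_part k * normal_form k * desc s k)"
    using dbl.normal_ordered_recursion[OF at_first_at1 at_first_at1 perm_dbl M_reflection_dbl, of k]
    unfolding LL_eq normal_form_def by (simp only: sc_one mult_1_left)
  from dbl.ceq_diff[OF this dbl.ceq_refl[of "dbl.const_part k * normal_form k * desc s k"]] show ?thesis
    using dbl.ceq_sym by simp
qed

lemma traces_normal:
  assumes "A \<in> H k" shows "\<exists>z\<in>casimir_span. dbl.ceq (traces 0 k (A * normal_form k)) (lmul z)"
proof -
  have "\<exists>X\<in>dbl.copy_span LL k. dbl.ceq (normal_form k) X"
    by (rule dbl.copy_span_recursion[OF at_first_at1 _ normal_recursion H_minus[OF dbl.const_part_H]])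
      (simp add: normal_form_def)
  then obtain X where X: "X \<in> dbl.copy_span LL k" "dbl.ceq (normal_form k) X" by blast
  obtain z where "z \<in> casimir_span" "traces 0 k (A * X) = lmul z"
    using traces_casimir_span[OF X(1) assms] by blast
  then show ?thesis using dbl.traces_ceq[OF dbl.ceq_left[OF X(2)], of 0 k A] by auto
qed

definition shifted :: "('n, 'n gen) tensor_op" where "shifted = LL - sc (inverse lam)"

lemma triv_shifted: "0 < j \<Longrightarrow> triv j shifted"
  using triv_at1[of j 0 Lmat] triv_sc[of j "inverse lam"]
  by (simp add: shifted_def triv_def left_diff_distrib right_diff_distrib)

lemma shifted_reflection: "dbl.ceq (r 0 * shifted * r 0 * shifted) (shifted * r 0 * shifted * r 0)"
proof -
  have "dbl.ceq (r 0 * LL * r 0 * LL - LL * r 0 * LL * r 0) (r 0 * LL - LL * r 0)"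
    using dbl.linear_reflection_equation[OF at_first_at1 at_first_at1 perm_dbl M_reflection_dbl D_reflection_dbl]
    unfolding LL_eq by (simp only: sc_one mult_1_left)
  then show ?thesis unfolding shifted_def by (rule dbl.shifted_reflection_equation[OF _ lam_nonzero])
qed

text \<open>Commuting with L is the same as commuting with the shifted matrix. The product of copies
  of L is therefore expanded in products of copies of the latter, whose traces commute with it by
  \<open>traces_central\<close>.\<close>

lemma traces_commute_L:
  assumes A: "A \<in> H k"
  shows "dbl.ceq (LL * traces 0 k (A * copy_prod r s LL k)) (traces 0 k (A * copy_prod r s LL k) * LL)"
proof -
  let ?P = "copy_prod r s LL" and ?Z = shifted
  \<comment> \<open>Only the leading factor L is split into the shifted matrix and a scalar; the
    scalar part supplies the \<open>Y\<close> of the general recursion.\<close>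
  have rec: "dbl.ceq (?P (Suc k)) (?Z * asc r k * ?P k * desc s k + (sc (inverse lam) * asc r k) * ?P k * desc s k)" for k
    unfolding copy_prod_Suc[OF at_first_at1 order_refl, of Lmat k, symmetric]
    by (simp add: shifted_def left_diff_distrib mult.assoc)
  have Y: "sc (inverse lam) * asc r k \<in> H (Suc k)" for k
    by (intro hecke_algebra.mult hecke_algebra.scalar H_asc) simp
  have "\<exists>X\<in>dbl.copy_span ?Z k. dbl.ceq (?P k) X"
    by (rule dbl.copy_span_recursion[OF at_first_triv[OF triv_shifted] _ rec Y]) simp_all
  then obtain X where X: "X \<in> dbl.copy_span ?Z k" "dbl.ceq (?P k) X" by blast
  let ?W = "{t. dbl.ceq (?Z * t) (t * ?Z)}"
  have "traces 0 k (A * X) \<in> ?W"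
  proof (rule dbl.traces_copy_span[OF triv_shifted _ _ A X(1)])
    show "x + y \<in> ?W" if "x \<in> ?W" "y \<in> ?W" for x y
      using that dbl.ceq_add by (simp add: distrib_left distrib_right)
    show "traces 0 j (B * copy_prod r s ?Z j) \<in> ?W" if "B \<in> H j" for j B
      using dbl.traces_central[OF triv_shifted shifted_reflection that] by simp
  qed
  then have X': "dbl.ceq (?Z * traces 0 k (A * X)) (traces 0 k (A * X) * ?Z)" by simp
  have t: "dbl.ceq (traces 0 k (A * ?P k)) (traces 0 k (A * X))"
    by (rule dbl.traces_ceq[OF dbl.ceq_left[OF X(2)]])
  have "dbl.ceq (?Z * traces 0 k (A * ?P k)) (traces 0 k (A * ?P k) * ?Z)"
    by (rule dbl.ceq_trans[OF dbl.ceq_left[OF t] dbl.ceq_trans[OF X' dbl.ceq_right[OF dbl.ceq_sym[OF t]]]])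
  moreover have "LL * t - t * LL = ?Z * t - t * ?Z" for t
    by (simp add: shifted_def left_diff_distrib right_diff_distrib sc_central)
  ultimately show ?thesis by (simp only: dbl.ceq_def)
qed

lemma ent_at1: "ent (at1 0 X) u (u(0 := j)) = X (u 0) j"
  for X :: "'n \<Rightarrow> 'n \<Rightarrow> 'n gen falg"
proof -
  have "delta (u(0 := j)) (u(0 := b)) = (if b = j then 1 else (0 :: 'n gen falg))" for b
    unfolding delta_def by (metis fun_upd_same)
  then show ?thesis using app_at1_delta[of 0 X 1 u "u(0 := j)"]
    by (simp add: ent_simps if_distrib[of "(*) _"] cong: if_cong)
qed

lemma commute_entries:
  assumes "dbl.ceq (LL * lmul z) (lmul z * LL)" shows "Lmat i j * z - z * Lmat i j \<in> double_ideal R"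
proof -
  define u :: "nat \<Rightarrow> 'n" where "u = (\<lambda>_. i)"
  \<comment> \<open>The values of \<open>delta\<close> are 0 and 1, so left multiplication by
    \<open>z\<close> may be written on the right and leaves the operator.\<close>
  have lmul_delta: "app (lmul z) (delta w) = (\<lambda>x. delta w x * z)" for w :: "nat \<Rightarrow> 'n"
    by (auto simp: delta_def fun_eq_iff)
  have "ent (LL * lmul z) u (u(0 := j)) = Lmat i j * z"
    using ent_at1[of Lmat u j] by (simp add: ent_def lmul_delta app_mult u_def)
  moreover have "ent (lmul z * LL) u (u(0 := j)) = z * Lmat i j"
    using ent_at1[of Lmat u j] by (simp add: ent_def u_def)
  moreover have "LL * lmul z - lmul z * LL \<in> entries_in (double_ideal R)"
    using assms by (simp only: dbl.ceq_def)
  then have "ent (LL * lmul z - lmul z * LL) u (u(0 := j)) \<in> double_ideal R"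
    by (simp only: entries_in_def mem_Collect_eq)
  ultimately show ?thesis by (simp only: ent_simps)
qed

lemma subspace_falg: "falg.subspace V \<longleftrightarrow> csubspace V" for V :: "'n gen falg set"
  by (auto simp: falg.subspace_def csubspace_def fscale_def)

lemma casimir_span_minimal:
  assumes "csubspace V" "1 \<in> V" "\<And>k Q. 1 \<le> k \<Longrightarrow> fvars Q \<subseteq> {1..<k} \<Longrightarrow> casimir R \<Psi> k Q \<in> V"
  shows "casimir_span \<subseteq> V"
  unfolding casimir_span_def using assms by (intro falg.span_minimal) (auto simp: subspace_falg)

lemma casimir_span_commute:
  assumes "z \<in> casimir_span" shows "Lmat i j * z - z * Lmat i j \<in> double_ideal R"
proof -
  interpret I: ring_ideal "double_ideal R" by (rule double_ideal)
  have "casimir_span \<subseteq> {z. Lmat i j * z - z * Lmat i j \<in> double_ideal R}"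
  proof (rule casimir_span_minimal)
    show "csubspace {z. Lmat i j * z - z * Lmat i j \<in> double_ideal R}"
    proof (rule subspaceI)
      fix x y assume "x \<in> {z. Lmat i j * z - z * Lmat i j \<in> double_ideal R}"
        "y \<in> {z. Lmat i j * z - z * Lmat i j \<in> double_ideal R}"
      then have "(Lmat i j * x - x * Lmat i j) + (Lmat i j * y - y * Lmat i j) \<in> double_ideal R"
        by (simp add: I.plus_mem)
      then show "x + y \<in> {z. Lmat i j * z - z * Lmat i j \<in> double_ideal R}"
        by (simp add: distrib_left distrib_right algebra_simps)
    next
      fix c x assume "x \<in> {z. Lmat i j * z - z * Lmat i j \<in> double_ideal R}"
      then have "fconst c * (Lmat i j * x - x * Lmat i j) \<in> double_ideal R" by (simp add: I.mult_left_mem)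
      then show "fconst c * x \<in> {z. Lmat i j * z - z * Lmat i j \<in> double_ideal R}"
        by (simp add: right_diff_distrib mult.assoc fconst_right)
    qed (simp add: I.zero_mem)
    show "casimir R \<Psi> k Q \<in> {z. Lmat i j * z - z * Lmat i j \<in> double_ideal R}"
      if "1 \<le> k" "fvars Q \<subseteq> {1..<k}" for k Q
      using traces_commute_L[OF poly_op_H[OF that(2)]] unfolding casimir_eq[OF that, symmetric]
      by (simp add: commute_entries)
  qed (simp add: I.zero_mem)
  then show ?thesis using assms by blast
qed

lemma casimir_in_subalgebra:
  assumes V: "subalgebra V" and L: "\<And>i j. Lmat i j \<in> V" and k: "1 \<le> k"
  shows "casimir R \<Psi> k Q \<in> V"
proof -
  have Vs: "csubspace V" using V by (simp add: subalgebra_def)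
  have mult: "x * y \<in> V" if "x \<in> V" "y \<in> V" for x y using V that by (simp add: subalgebra_def)
  have LL: "LL \<in> entries_in V" by (rule entries_in_at1[OF Vs L])
  have copies: "copy r s LL i \<in> entries_in V" for i
    by (induction i) (auto intro!: entries_in_at2 Vs LL)
  have "copy_prod r s LL m \<in> entries_in V" for m
    by (induction m) (auto intro!: entries_in_mult[OF V] entries_in_one[OF V] copies)
  then have "bar_prod R k Lmat a b \<in> V" if "a \<in> idx k" "b \<in> idx k" for a b
    using emb_entries[of k "bar_prod R k Lmat" V, OF _ that] by (simp add: emb_bar_prod[OF k])
  then show ?thesis
    unfolding casimir_def rtrace_def tmult_def scal_def
    by (intro subspace_sum[OF Vs] mult subalgebra_fconst[OF V]) auto
qed

text \<open>Operators given by a finite matrix on the first \<open>k\<close> sites. The normal form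
  has to be one, as normal ordering is applied to the entries of a finite matrix.\<close>

definition locals :: "nat \<Rightarrow> ('n, 'n gen) tensor_op set" where
  "locals k = range (emb 0 k)"

lemma locals_mult: "X \<in> locals k \<Longrightarrow> Y \<in> locals k \<Longrightarrow> X * Y \<in> locals k"
  by (auto simp: locals_def simp flip: emb_mult)

lemma locals_one: "1 \<in> locals k"
  unfolding locals_def using emb_tid[of 0 k] by (metis rangeI)

lemma locals_at2: "Suc i < k \<Longrightarrow> at2 i A \<in> locals k"
  unfolding locals_def by (rule range_eqI[of _ _ "scal (at_pair (Suc i) A)"]) (simp add: emb_at_pair)

lemma locals_at1: "1 \<le> k \<Longrightarrow> at1 0 X \<in> locals k"
  unfolding locals_def by (rule range_eqI[of _ _ "at_site 1 X"]) (simp add: emb_at_site)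

lemma locals_normal: "1 \<le> k \<Longrightarrow> normal_form k \<in> locals k"
proof -
  assume k: "1 \<le> k"
  \<comment> \<open>The word of length \<open>m\<close> reaches site \<open>m\<close>, hence the
    strict bound; \<open>dual_prod\<close> of index \<open>m\<close> uses words of length below
    \<open>m\<close> only.\<close>
  have "m < k \<Longrightarrow> asc s m \<in> locals k \<and> desc s m \<in> locals k" for m
    by (induction m) (auto intro: locals_mult locals_one locals_at2)
  then have "m \<le> k \<Longrightarrow> dbl.dual_prod DD m \<in> locals k" for m
    by (induction m) (auto intro!: locals_mult locals_one locals_at1 k)
  moreover have "copy_prod r s MM k \<in> locals k"
    unfolding emb_bar_prod[OF k, symmetric] by (simp add: locals_def)
  ultimately show ?thesis by (simp add: normal_form_def locals_mult)
qed

end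

lemma subspace_keys: "csubspace {x. \<forall>w\<in>Poly_Mapping.keys x. P w}"
  for P :: "'g word \<Rightarrow> bool"
proof (rule subspaceI)
  fix c and x :: "'g falg"
  assume x: "x \<in> {x. \<forall>w\<in>Poly_Mapping.keys x. P w}"
  have "Poly_Mapping.keys (fconst c * x) \<subseteq> Poly_Mapping.keys x"
    using keys_mult[of "fconst c" x] by (auto simp: fconst_def split: if_splits)
  then show "fconst c * x \<in> {x. \<forall>w\<in>Poly_Mapping.keys x. P w}" using x by blast
next
  fix x y :: "'g falg"
  assume "x \<in> {x. \<forall>w\<in>Poly_Mapping.keys x. P w}" "y \<in> {x. \<forall>w\<in>Poly_Mapping.keys x. P w}"
  then show "x + y \<in> {x. \<forall>w\<in>Poly_Mapping.keys x. P w}" using keys_add[of x y] by blast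
qed simp

lemma subalgebra_keys:
  fixes P :: "'g word \<Rightarrow> bool"
  assumes "\<And>u v. P u \<Longrightarrow> P v \<Longrightarrow> P (u + v)" "P 0"
  shows "subalgebra {x. \<forall>w\<in>Poly_Mapping.keys x. P w}"
  unfolding subalgebra_def
proof (intro conjI subspace_keys ballI)
  show "1 \<in> {x. \<forall>w\<in>Poly_Mapping.keys x. P w}" using assms(2) by simp
  fix x y :: "'g falg"
  assume "x \<in> {x. \<forall>w\<in>Poly_Mapping.keys x. P w}" "y \<in> {x. \<forall>w\<in>Poly_Mapping.keys x. P w}"
  then show "x * y \<in> {x. \<forall>w\<in>Poly_Mapping.keys x. P w}" using keys_mult[of x y] assms(1) by fastforce
qed

section \<open>The entries of the normal form are ordered\<close>

context hecke_data
begin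

definition M_words :: "'n gen falg set" where
  "M_words = {x. \<forall>w\<in>Poly_Mapping.keys x. \<exists>us. letters w = map (\<lambda>(i, j). Mgen i j) us}"
definition D_words :: "'n gen falg set" where
  "D_words = {x. \<forall>w\<in>Poly_Mapping.keys x. \<exists>us. letters w = map (\<lambda>(i, j). Dgen i j) us}"

lemma M_words: "subalgebra M_words" "Mmat i j \<in> M_words"
  and D_words: "subalgebra D_words" "Dmat i j \<in> D_words"
proof -
  show "subalgebra M_words" "subalgebra D_words"
    unfolding M_words_def D_words_def
    by (rule subalgebra_keys; force simp: plus_word_def letters_zero simp flip: map_append)+
  show "Mmat i j \<in> M_words" "Dmat i j \<in> D_words"
    by (auto simp: M_words_def D_words_def Mmat_def Dmat_def fvar_def intro: exI[of _ "[(i, j)]"])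
qed

lemma ordered_mult: "x \<in> M_words \<Longrightarrow> y \<in> D_words \<Longrightarrow> ordered (x * y)"
  unfolding ordered_def M_words_def D_words_def using keys_mult[of x y] by (fastforce simp: plus_word_def)

lemma ordered_subspace: "csubspace {x. ordered x}"
  unfolding ordered_def by (rule subspace_keys)

lemma ordered_normal: "normal_form k \<in> entries_in {x. ordered x}"
proof -
  have MM: "MM \<in> entries_in M_words" and DD: "DD \<in> entries_in D_words"
    using M_words D_words by (auto intro!: entries_in_at1 simp: subalgebra_def)
  have "copy r s MM i \<in> entries_in M_words" for i
    by (induction i) (auto intro!: entries_in_mult[OF M_words(1)] subalgebra_at2 M_words MM)
  then have M: "copy_prod r s MM k \<in> entries_in M_words" for k
    by (induction k) (auto intro!: entries_in_mult[OF M_words(1)] entries_in_one M_words)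
  have S: "asc s m \<in> entries_in D_words" "desc s m \<in> entries_in D_words" for m
    by (induction m) (auto intro!: entries_in_mult[OF D_words(1)] entries_in_one subalgebra_at2 D_words)
  have D: "dbl.dual_prod DD k \<in> entries_in D_words" for k
    by (induction k) (auto intro!: entries_in_mult[OF D_words(1)] entries_in_one D_words DD S)
  have "ent (normal_form k) x y \<in> {x. ordered x}" for x y
  proof -
    obtain T where T: "\<forall>G y. ent (copy_prod r s MM k * G) x y = (\<Sum>z\<in>T. ent (copy_prod r s MM k) x z * ent G z y)"
      using ent_mult[of "copy_prod r s MM k" x] by blast
    have "ent (copy_prod r s MM k) x z * ent (dbl.dual_prod DD k) z y \<in> {x. ordered x}" for z
      using M[of k] D[of k] by (auto simp: entries_in_def intro: ordered_mult)
    then show ?thesis unfolding normal_form_def using T by (simp only: subspace_sum[OF ordered_subspace])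
  qed
  then show ?thesis by (simp add: entries_in_def)
qed

end

section \<open>The quantum double as a quotient\<close>

lemma ideal_double: "ideal (double_ideal R) free_ring"
  unfolding ideal_free_ring double_ideal_def by (rule fideal_ring_ideal)

lemma ring_quantum_double: "ring (quantum_double R)"
  unfolding quantum_double_def by (rule ideal.quotient_is_ring[OF ideal_double])

lemma cls_ring_hom: "cls R \<in> ring_hom free_ring (quantum_double R)"
  unfolding quantum_double_def cls_def[abs_def] by (rule ideal.rcos_ring_hom[OF ideal_double])

lemma cls_carrier [simp]: "cls R x \<in> carrier (quantum_double R)"
  using ring_hom_memE(1)[OF cls_ring_hom] by (simp add: free_ring_def)

lemma cls_add: "cls R x \<oplus>\<^bsub>quantum_double R\<^esub> cls R y = cls R (x + y)"
  and cls_mult: "cls R x \<otimes>\<^bsub>quantum_double R\<^esub> cls R y = cls R (x * y)"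
  and cls_one: "\<one>\<^bsub>quantum_double R\<^esub> = cls R 1"
  using ring_hom_memE(2,3,4)[OF cls_ring_hom, symmetric] by (simp_all add: free_ring_def)

lemma cls_eq_iff: "cls R x = cls R y \<longleftrightarrow> x - y \<in> double_ideal R"
proof -
  have "x \<ominus>\<^bsub>free_ring\<^esub> y = x - y"
    by (simp add: a_minus_def minus_free_ring) (simp add: free_ring_def)
  then show ?thesis
    using ring.quotient_eq_iff_same_a_r_cos[OF ring_free_ring ideal_double, of x y]
    by (simp add: cls_def free_ring_def)
qed

lemma cls_zero: "\<zero>\<^bsub>quantum_double R\<^esub> = cls R 0"
proof -
  interpret ring "quantum_double R" by (rule ring_quantum_double)
  have "cls R 0 \<oplus>\<^bsub>quantum_double R\<^esub> cls R 0 = cls R 0" by (simp add: cls_add)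
  then show ?thesis by (metis add.l_cancel_one cls_carrier)
qed

lemma cls_minus: "\<ominus>\<^bsub>quantum_double R\<^esub> cls R x = cls R (- x)"
proof -
  interpret ring "quantum_double R" by (rule ring_quantum_double)
  have "cls R (- x) \<oplus>\<^bsub>quantum_double R\<^esub> cls R x = \<zero>\<^bsub>quantum_double R\<^esub>"
    by (simp add: cls_add cls_zero)
  then show ?thesis using minus_equality cls_carrier by metis
qed

lemma cls_sum: "finite A \<Longrightarrow> finsum (quantum_double R) (\<lambda>i. cls R (f i)) A = cls R (sum f A)"
proof (induction A rule: finite_induct)
  interpret ring "quantum_double R" by (rule ring_quantum_double)
  case empty
  then show ?case by (simp add: cls_zero)
next
  interpret ring "quantum_double R" by (rule ring_quantum_double)
  case (insert x F)
  then show ?case by (simp add: finsum_insert Pi_def cls_add)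
qed

lemma cls_mem_L_algebra_subalgebra: "subalgebra {x. cls R x \<in> L_algebra R}"
proof -
  have "cls R (x + y) \<in> L_algebra R" "cls R (x * y) \<in> L_algebra R"
    if "cls R x \<in> L_algebra R" "cls R y \<in> L_algebra R" for x y
    using generate_ring.eng_add[OF that[unfolded L_algebra_def]] generate_ring.eng_mult[OF that[unfolded L_algebra_def]]
    by (simp_all add: cls_add cls_mult L_algebra_def)
  moreover have c: "cls R (fconst c) \<in> L_algebra R" for c
    unfolding L_algebra_def by (intro generate_ring.incl) auto
  moreover have "cls R 0 \<in> L_algebra R" "cls R 1 \<in> L_algebra R"
    using c[of 0] c[of 1] by (simp_all add: fconst_simps)
  ultimately show ?thesis
    by (simp add: subalgebra_def csubspace_def)
qed

lemma L_algebra_commute: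
  assumes z: "\<And>i j. Lmat i j * z - z * Lmat i j \<in> double_ideal R" and y: "y \<in> L_algebra R"
  shows "cls R z \<otimes>\<^bsub>quantum_double R\<^esub> y = y \<otimes>\<^bsub>quantum_double R\<^esub> cls R z"
proof -
  have "\<exists>x. y = cls R x \<and> cls R (z * x) = cls R (x * z)"
    using y unfolding L_algebra_def
  proof induction
    case one
    then show ?case by (intro exI[of _ 1]) (simp add: cls_one)
  next
    case (incl h)
    then show ?case
    proof
      assume "h \<in> range (\<lambda>c. cls R (fconst c))"
      then obtain c where "h = cls R (fconst c)" by blast
      then show ?thesis using fconst_commute[of c z] by (intro exI[of _ "fconst c"]) simp
    next
      assume "h \<in> {cls R (Lmat i j) | i j. True}"
      then obtain i j where "h = cls R (Lmat i j)" by blast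
      moreover have "cls R (Lmat i j * z) = cls R (z * Lmat i j)" using z by (simp add: cls_eq_iff)
      ultimately show ?thesis by (intro exI[of _ "Lmat i j"]) simp
    qed
  next
    case (a_inv h)
    then obtain x where x: "h = cls R x" "cls R (z * x) = cls R (x * z)" by blast
    have "cls R (z * - x) = cls R (- x * z)"
      using arg_cong[OF x(2), of "a_inv (quantum_double R)"] by (simp add: cls_minus)
    then show ?case by (intro exI[of _ "- x"]) (simp add: x(1) cls_minus)
  next
    case (eng_add h1 h2)
    then obtain x y where xy: "h1 = cls R x" "cls R (z * x) = cls R (x * z)"
      "h2 = cls R y" "cls R (z * y) = cls R (y * z)" by blast
    have "cls R (z * (x + y)) = cls R ((x + y) * z)"
      by (simp add: distrib_left distrib_right xy(2,4) flip: cls_add)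
    then show ?case by (intro exI[of _ "x + y"]) (simp add: xy(1,3) cls_add)
  next
    case (eng_mult h1 h2)
    then obtain x y where xy: "h1 = cls R x" "cls R (z * x) = cls R (x * z)"
      "h2 = cls R y" "cls R (z * y) = cls R (y * z)" by blast
    have "cls R (z * (x * y)) = cls R (z * x) \<otimes>\<^bsub>quantum_double R\<^esub> cls R y"
      by (simp add: cls_mult mult.assoc)
    also have "\<dots> = cls R x \<otimes>\<^bsub>quantum_double R\<^esub> cls R (z * y)"
      unfolding xy(2) by (simp add: cls_mult mult.assoc)
    also have "\<dots> = cls R (x * y * z)" unfolding xy(4) by (simp add: cls_mult mult.assoc)
    finally show ?case by (intro exI[of _ "x * y"]) (simp add: xy(1,3) cls_mult)
  qed
  then show ?thesis by (auto simp: cls_mult)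
qed

context hecke_data
begin

lemma casimir_span_central:
  assumes "z \<in> casimir_span" shows "cls R z \<in> central_elements (quantum_double R) (L_algebra R)"
proof -
  have V: "subalgebra {x. cls R x \<in> L_algebra R}" by (rule cls_mem_L_algebra_subalgebra)
  have "Lmat i j \<in> {x. cls R x \<in> L_algebra R}" for i j
    unfolding L_algebra_def by (auto intro!: generate_ring.incl)
  then have "casimir_span \<subseteq> {x. cls R x \<in> L_algebra R}"
    using V by (intro casimir_span_minimal casimir_in_subalgebra[OF V]) (simp_all add: subalgebra_def)
  then show ?thesis
    using assms L_algebra_commute[OF casimir_span_commute[OF assms]] by (auto simp: central_elements_def)
qed

text \<open>The difference of two ordered forms is ordered and lies in the homogeneous ideal, so
  \<open>ordered_hom_ideal\<close> puts it into the ideal of the double.\<close>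

lemma normal_order_eq:
  assumes x: "ordered x" "w - x \<in> hom_ideal R" shows "normal_order R w = cls R x"
  unfolding normal_order_def
proof (rule the_equality)
  show "\<exists>y. ordered y \<and> w - y \<in> hom_ideal R \<and> cls R x = cls R y" using x by blast
next
  fix c assume "\<exists>y. ordered y \<and> w - y \<in> hom_ideal R \<and> c = cls R y"
  then obtain y where y: "ordered y" "w - y \<in> hom_ideal R" "c = cls R y" by blast
  have "y - x \<in> hom_ideal R" using ring_ideal.diff_mem[OF hom_ideal x(2) y(2)] by simp
  moreover have "ordered (y - x)" using subspace_diff[OF ordered_subspace] x(1) y(1) by simp
  ultimately show "c = cls R x" using ordered_hom_ideal by (simp add: y(3) cls_eq_iff)
qed

lemma normal_ordered_casimir_mem:
  assumes k: "1 \<le> k" and Q: "fvars Q \<subseteq> {1..<k}"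
  shows "\<exists>z\<in>casimir_span. normal_ordered_casimir R \<Psi> k Q = cls R z"
proof -
  \<comment> \<open>The finite matrix of the normal form; its entries are ordered representatives of
    the normal ordered entries.\<close>
  obtain X where X: "normal_form k = emb 0 k X" using locals_normal[OF k] by (auto simp: locals_def)
  have ordered: "ordered (X a b)" if "a \<in> idx k" "b \<in> idx k" for a b
    using emb_entries[OF ordered_normal[of k, unfolded X] that] by simp
  have "emb 0 k (\<lambda>a b. bar_prod R k Lmat a b - X a b) \<in> entries_in (hom_ideal R)"
    using copy_prod_normal[of k] by (simp only: hom.ceq_def emb_diff emb_bar_prod[OF k] X)
  then have order: "normal_order R (bar_prod R k Lmat a b) = cls R (X a b)" if "a \<in> idx k" "b \<in> idx k" for a b
    using normal_order_eq[OF ordered[OF that]] emb_entries[OF _ that] by blast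
  let ?c = "\<lambda>a b. fconst (tmult k (Cprod \<Psi> k) (eval_poly R k Q) a b) :: 'n gen falg"
  define y where "y = (\<Sum>(a, b)\<in>idx k \<times> idx k. ?c a b * X b a)"
  interpret ring "quantum_double R" by (rule ring_quantum_double)
  have "normal_ordered_casimir R \<Psi> k Q
    = finsum (quantum_double R) (\<lambda>p. cls R ((\<lambda>(a, b). ?c a b * X b a) p)) (idx k \<times> idx k)"
    unfolding normal_ordered_casimir_def
    by (rule finsum_cong') (auto simp: order cls_mult)
  also have "\<dots> = cls R y" unfolding y_def by (rule cls_sum) simp
  finally have 1: "normal_ordered_casimir R \<Psi> k Q = cls R y" .
  \<comment> \<open>The element \<open>y\<close> is the trace of the weighted matrix product, hence
    as an operator the R-trace of \<open>poly_op Q\<close> times the normal form.\<close>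
  have "lmul y = flats k (emb 0 k (tmult k (scal (tmult k (Cprod \<Psi> k) (eval_poly R k Q))) X))"
    by (simp add: flats_emb y_def tmult_def scal_def sum.cartesian_product)
  also have "\<dots> = flats k (asc Cm k * (poly_op Q * normal_form k))"
    by (simp add: emb_mult scal_tmult emb_Cprod emb_eval_poly[OF Q] X mult.assoc)
  also have "\<dots> = traces 0 k (poly_op Q * normal_form k)" by (rule traces_flats[symmetric])
  finally have "lmul y = traces 0 k (poly_op Q * normal_form k)" .
  then obtain z where z: "z \<in> casimir_span" "dbl.ceq (lmul y) (lmul z)"
    using traces_normal[OF poly_op_H[OF Q]] by auto
  have "(lmul (y - z) :: ('n, 'n gen) tensor_op) \<in> entries_in (double_ideal R)"
    using z(2) by (simp only: dbl.ceq_def lmul_diff)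
  then have "ent (lmul (y - z) :: ('n, 'n gen) tensor_op) u u \<in> double_ideal R" for u
    by (simp add: entries_in_def)
  then have "y - z \<in> double_ideal R" by (simp only: ent_lmul)
  then have "cls R y = cls R z" by (simp only: cls_eq_iff)
  then show ?thesis using z(1) 1 by blast
qed

end

theorem theorem22:
  fixes R \<Psi> :: "complex ^ ('n::finite \<times> 'n) ^ ('n \<times> 'n)"
    and q :: complex
    and k :: nat
    and Q :: "nat falg"
  assumes "hecke_symmetry q R"
    and "skew_inverse R \<Psi>"
    and "skew_invertible (matrix_inv R)"
    and "has_involutive_limit q R"
    and "1 \<le> k"
    and "fvars Q \<subseteq> {1..<k}"
  shows "normal_ordered_casimir R \<Psi> k Q \<in> characteristic_subalgebra R \<Psi> \<and>
         normal_ordered_casimir R \<Psi> k Q \<in> central_elements (quantum_double R) (L_algebra R)"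
proof -
  interpret hecke_data q R \<Psi>
    by unfold_locales (rule assms)+
  obtain z where z: "z \<in> casimir_span" "normal_ordered_casimir R \<Psi> k Q = cls R z"
    using normal_ordered_casimir_mem[OF assms(5,6)] by blast
  have "cls R z \<in> characteristic_subalgebra R \<Psi>"
    using z(1) by (simp add: characteristic_subalgebra_def casimir_span_def)
  then show ?thesis using casimir_span_central[OF z(1)] z(2) by simp
qed

end
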